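(* Let $\gamma>0$ and $0<q<1$. Consider the discrete-time AWGN channel $Y_i=X_i+N_i$, $i=1,\dots,n$, where $N_1,N_2,\dots$ are i.i.d. standard Gaussian and independent of the input, and where every codeword $(x_1,\dots,x_n)$ must satisfy the idealized duty cycle constraint $\frac1n\sum_{i=1}^n 1_{\{x_i\neq 0\}}\le 1-q$ and the average power constraint $\frac1n\sum_{i=1}^n x_i^2\le\gamma$. The (operational) capacity of this channel is $$C(\gamma,q)=\max_{\mu\in\Lambda(\gamma,q)} I(\mu).$$ Moreover: (a) the maximum is attained by a unique distribution $\mu_0\in\Lambda(\gamma,q)$; (b) $\mu_0$ is symmetric about $0$ and $\mathbb{E}_{\mu_0}[X^2]=\gamma$; (c) $\mu_0$ is discrete with infinitely many probability mass points, while the number of mass points in any bounded interval is finite.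
   Context: $\phi(t)=\frac{1}{\sqrt{2\pi}}e^{-t^2/2}$ is the standard Gaussian density. For a Borel probability measure $\mu$ on $\mathbb{R}$ (the input distribution), the output density is $p_Y(y;\mu)=\mathbb{E}_\mu[\phi(y-X)]$, $d(x;\mu)=\int_{-\infty}^\infty \phi(y-x)\log\frac{\phi(y-x)}{p_Y(y;\mu)}\,dy$, and $I(\mu)=\int d(x;\mu)\,\mu(dx)$ is the input-output mutual information of the channel $Y=X+N$ with $X\sim\mu$, $N$ standard Gaussian independent of $X$. $\Lambda(\gamma,q)=\{\mu:\ \mu(\{0\})\ge q,\ \mathbb{E}_\mu[X^2]\le\gamma\}$. *)

theory Defs
  imports "HOL-Probability.Probability"
begin

definition phi :: "real \<Rightarrow> real" where
  "phi t = exp (- (t\<^sup>2) / 2) / sqrt (2 * pi)"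

definition pY :: "real \<Rightarrow> real measure \<Rightarrow> real" where
  "pY y \<mu> = (\<integral>x. phi (y - x) \<partial>\<mu>)"

definition dens :: "real \<Rightarrow> real measure \<Rightarrow> real" where
  "dens x \<mu> = (LBINT y. phi (y - x) * ln (phi (y - x) / pY y \<mu>))"

definition MI :: "real measure \<Rightarrow> real" where
  "MI \<mu> = (\<integral>x. dens x \<mu> \<partial>\<mu>)"

definition input_dist :: "real measure \<Rightarrow> bool" where
  "input_dist \<mu> \<longleftrightarrow> prob_space \<mu> \<and> sets \<mu> = sets borel"

definition Lambda :: "real \<Rightarrow> real \<Rightarrow> real measure set" where
  "Lambda \<gamma> q = {\<mu>. input_dist \<mu> \<and> measure \<mu> {0} \<ge> q \<and>
                      (\<integral>\<^sup>+ x. ennreal (x\<^sup>2) \<partial>\<mu>) \<le> ennreal \<gamma>}"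

definition noise :: "nat \<Rightarrow> (nat \<Rightarrow> real) measure" where
  "noise n = PiM {..<n} (\<lambda>_. density lborel (\<lambda>t. ennreal (phi t)))"

definition valid_code ::
  "real \<Rightarrow> real \<Rightarrow> nat \<Rightarrow> nat \<Rightarrow> (nat \<Rightarrow> nat \<Rightarrow> real) \<Rightarrow> ((nat \<Rightarrow> real) \<Rightarrow> nat) \<Rightarrow> bool" where
  "valid_code \<gamma> q n M enc dec \<longleftrightarrow>
     M \<ge> 1 \<and>
     dec \<in> measurable (PiM {..<n} (\<lambda>_. borel)) (count_space UNIV) \<and>
     (\<forall>m<M. real (card {i. i < n \<and> enc m i \<noteq> 0}) \<le> (1 - q) * real n \<and>
            (\<Sum>i<n. (enc m i)\<^sup>2) \<le> \<gamma> * real n)"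

definition err_prob ::
  "nat \<Rightarrow> (nat \<Rightarrow> nat \<Rightarrow> real) \<Rightarrow> ((nat \<Rightarrow> real) \<Rightarrow> nat) \<Rightarrow> nat \<Rightarrow> real" where
  "err_prob n enc dec m =
     measure (noise n) {z \<in> space (noise n). dec (\<lambda>i\<in>{..<n}. enc m i + z i) \<noteq> m}"

definition achievable :: "real \<Rightarrow> real \<Rightarrow> real \<Rightarrow> bool" where
  "achievable \<gamma> q R \<longleftrightarrow>
     (\<forall>\<epsilon>>0. \<exists>N. \<forall>n\<ge>N. \<exists>M enc dec.
        valid_code \<gamma> q n M enc dec \<and> real M \<ge> exp (real n * (R - \<epsilon>)) \<and>
        (\<forall>m<M. err_prob n enc dec m \<le> \<epsilon>))"

definition op_capacity :: "real \<Rightarrow> real \<Rightarrow> real" where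
  "op_capacity \<gamma> q = Sup {R. achievable \<gamma> q R}"

end

theory Submission
  imports Defs "HOL-Complex_Analysis.Complex_Analysis"
begin

text \<open>
  On \<^term>\<open>Lambda \<gamma> q\<close> the output density satisfies \<open>q \<phi> \<le> p\<^sub>Y \<le> 1\<close>, so \<open>I(\<mu>)\<close> is the cross entropy of the
  output law with itself minus a constant, where \<open>cross_entropy \<mu> \<nu> = - \<integral> p\<^sub>Y(\<cdot>;\<mu>) ln p\<^sub>Y(\<cdot>;\<nu>)\<close> is affine
  in \<open>\<mu>\<close> and, by Gibbs' inequality, minimal at \<open>\<nu> = \<mu>\<close>. This gives strict concavity, hence uniqueness and
  symmetry; existence follows from Helly selection and dominated convergence.

  Two-point perturbations of the maximizer yield multipliers with \<open>d(x) \<le> \<lambda>x\<^sup>2 + \<kappa>\<close> for all \<open>x\<close> and equality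
  almost everywhere off \<open>0\<close>. Both sides extend to entire functions. If the equality set accumulated,
  \<open>d\<close> would be quadratic, Gaussian deconvolution would make \<open>p\<^sub>Y\<close> Gaussian, and the maximizer would be
  Gaussian or \<open>\<delta>\<^sub>0\<close>, contradicting the atom at \<open>0\<close> or the power. If there were only finitely many mass points,
  then \<open>\<lambda> \<ge> 1/2\<close>, which makes \<open>\<lambda>x\<^sup>2 + \<kappa> - d(x)\<close> midpoint convex; it would vanish at \<open>x\<^sub>0 / 2\<^sup>n\<close> for every \<open>n\<close>.

  For the coding theorem, the same multipliers bound the divergence from every admissible codeword to the
  optimal output law by \<open>n I\<close>, which gives a Fano-type converse. Achievability is Feinstein's
  maximal coding lemma, applied to a mixture of the maximizer with \<open>\<delta>\<^sub>0\<close> (to gain slack in both constraints)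
  together with the weak law of large numbers.
\<close>

section \<open>The output density\<close>

text \<open>The atom at 0 keeps everything finite: it bounds \<open>- ln (pY y \<nu>)\<close> by a
  quadratic in y, so cross entropies exist for every first argument of finite power, including the
  one-point laws that probe optimality. The threshold 1/2 for the power multiplier is the curvature
  of the noise: ln p(y) + y^2/2 is, up to a constant, the logarithm of a Laplace transform, hence
  convex; bounded support makes d grow like x^2/2, so a smaller multiplier could not majorize it.
  The same Laplace transform serves three times: for injectivity of the map from input to output
  law, for deconvolution, and for the entire extension of d. Both constraints are linear in \<mu>,
  so the duty cycle has a multiplier too, namely \<kappa> - d(0). This pair of prices, summed over
  the letters of a codeword, reduces the converse to single letters. Since the constraints bind
  every codeword and not an average, the direct part picks codewords one at a time inside the
  admissible set instead of averaging over random codes.\<close>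

lemma phi_eq_std_normal: "phi = std_normal_density"
  by (rule ext) (simp add: phi_def std_normal_density_def)

lemma phi_pos [simp]: "0 < phi t"
  by (simp add: phi_eq_std_normal normal_density_pos)

lemma phi_nonneg [simp]: "0 \<le> phi t"
  using phi_pos[of t] by linarith

lemma phi_neq_0 [simp]: "phi t \<noteq> 0"
  using phi_pos[of t] by linarith

lemma measurable_phi [measurable]: "phi \<in> borel_measurable borel"
  by (simp add: phi_eq_std_normal)

text \<open>With unit noise variance all output densities stay below 1. Hence \<open>- ln\<close> of
  an output density is nonnegative, and cross entropies can be handled with nonnegative
  integrals.\<close>

lemma sqrt_2pi_gt_1: "1 < sqrt (2 * pi)"
  using pi_gt3 by (simp add: real_less_rsqrt)

lemma phi_le_const: "phi t \<le> 1 / sqrt (2 * pi)"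
  by (simp add: phi_def divide_right_mono)

lemma phi_le_1: "phi t \<le> 1"
  using phi_le_const[of t] sqrt_2pi_gt_1 by (smt (verit) divide_le_eq_1_pos)

lemma ln_phi: "ln (phi t) = - t\<^sup>2 / 2 - ln (sqrt (2 * pi))"
  using sqrt_2pi_gt_1 by (simp add: phi_def ln_div)

lemma phi_uminus [simp]: "phi (- t) = phi t"
  by (simp add: phi_def)

lemma continuous_on_phi [continuous_intros]:
  "continuous_on A f \<Longrightarrow> continuous_on A (\<lambda>x. phi (f x))"
  unfolding phi_def by (intro continuous_intros) auto

text \<open>Exponential tilting: up to Gaussian factors, convolution with \<open>phi\<close> becomes
  a Laplace transform.\<close>

lemma phi_shift: "phi (y - x) = exp (x * y - x\<^sup>2 / 2) * phi y"
proof -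
  have "- ((y - x)\<^sup>2) / 2 = (x * y - x\<^sup>2 / 2) + - (y\<^sup>2) / 2"
    by (simp add: power2_eq_square field_simps)
  then have "exp (- ((y - x)\<^sup>2) / 2) = exp (x * y - x\<^sup>2 / 2) * exp (- (y\<^sup>2) / 2)"
    by (simp only: exp_add)
  then show ?thesis by (simp add: phi_def)
qed

section \<open>The noise law and its moments\<close>

definition gauss :: "real measure" where
  "gauss = density lborel (\<lambda>t. ennreal (phi t))"

lemma sets_gauss [simp, measurable_cong]: "sets gauss = sets borel"
  and space_gauss [simp]: "space gauss = UNIV"
  by (simp_all add: gauss_def)

lemma gauss_eq_std_normal: "gauss = std_normal_distribution"
  by (simp add: gauss_def phi_eq_std_normal)

interpretation gauss: prob_space gauss
  unfolding gauss_eq_std_normal by (rule prob_space_normal_density) simp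

lemma integrable_gauss_power: "integrable gauss (\<lambda>z. z ^ k)"
  unfolding gauss_eq_std_normal by (rule integrable_std_normal_distribution_moment)

lemma integrable_gauss_id [simp]: "integrable gauss (\<lambda>z. z)"
  using integrable_gauss_power[of 1] by simp

lemma integrable_gauss_sq [simp]: "integrable gauss (\<lambda>z. z\<^sup>2)"
  using integrable_gauss_power[of 2] by simp

lemma integral_gauss_id [simp]: "(\<integral>z. z \<partial>gauss) = 0"
  using integral_std_normal_distribution_moment_odd[of 1] by (simp add: gauss_eq_std_normal)

lemma integral_gauss_sq [simp]: "(\<integral>z. z\<^sup>2 \<partial>gauss) = 1"
  using std_normal_distribution_even_moments(1)[of 1] by (simp add: gauss_eq_std_normal)

lemma integrable_gauss_shift_sq: "integrable gauss (\<lambda>z. (x + z)\<^sup>2)"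
  by (simp add: power2_sum)

lemma integral_gauss_shift_sq: "(\<integral>z. (x + z)\<^sup>2 \<partial>gauss) = x\<^sup>2 + 1"
  by (simp add: power2_sum gauss.prob_space[simplified])

lemma nn_integral_phi_shift:
  assumes [measurable]: "f \<in> borel_measurable borel"
  shows "(\<integral>\<^sup>+y. ennreal (phi (y - x)) * f y \<partial>lborel) = (\<integral>\<^sup>+z. f (x + z) \<partial>gauss)"
  by (subst nn_integral_real_affine[where c = 1 and t = x])
     (auto simp: gauss_def nn_integral_density)

lemma integral_phi_shift:
  assumes [measurable]: "f \<in> borel_measurable borel"
  shows "(LBINT y. phi (y - x) * f y) = (\<integral>z. f (x + z) \<partial>gauss)"
  by (subst lborel_integral_real_affine[where c = 1 and t = x])
     (auto simp: gauss_def integral_density)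

section \<open>Output densities of input laws\<close>

lemma input_dist_simps:
  assumes "input_dist \<mu>"
  shows "sets \<mu> = sets borel" "space \<mu> = UNIV" "prob_space \<mu>"
proof -
  show s: "sets \<mu> = sets borel" and "prob_space \<mu>"
    using assms by (auto simp: input_dist_def)
  from sets_eq_imp_space_eq[OF s] show "space \<mu> = UNIV" by simp
qed

lemma input_dist_real_distribution: "input_dist \<mu> \<longleftrightarrow> real_distribution \<mu>"
  using input_dist_simps[of \<mu>]
  by (auto simp: input_dist_def real_distribution_def real_distribution_axioms_def)

lemma input_dist_return [simp]: "input_dist (return borel x)"
  by (simp add: input_dist_def prob_space_return)

lemma integrable_phi_input:
  assumes "input_dist \<mu>"
  shows "integrable \<mu> (\<lambda>x. phi (y - x))"
proof -
  note [measurable_cong] = input_dist_simps(1)[OF assms]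
  interpret prob_space \<mu> using assms by (simp add: input_dist_def)
  show ?thesis
    by (rule integrable_const_bound[where B = 1]) (auto simp: phi_le_1)
qed

lemma ennreal_pY:
  assumes "input_dist \<mu>"
  shows "ennreal (pY y \<mu>) = (\<integral>\<^sup>+x. ennreal (phi (y - x)) \<partial>\<mu>)"
  unfolding pY_def using integrable_phi_input[OF assms]
  by (subst nn_integral_eq_integral) auto

lemma pY_nonneg [simp]: "0 \<le> pY y \<mu>"
  by (simp add: pY_def integral_nonneg_AE)

lemma pY_le:
  assumes "input_dist \<mu>"
  shows "pY y \<mu> \<le> 1 / sqrt (2 * pi)"
proof -
  interpret prob_space \<mu> using assms by (simp add: input_dist_def)
  have "pY y \<mu> \<le> (\<integral>x. 1 / sqrt (2 * pi) \<partial>\<mu>)"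
    unfolding pY_def by (intro integral_mono integrable_phi_input assms) (auto simp: phi_le_const)
  then show ?thesis by (simp add: prob_space)
qed

lemma pY_le_1: "input_dist \<mu> \<Longrightarrow> pY y \<mu> \<le> 1"
  using pY_le[of \<mu> y] sqrt_2pi_gt_1 by (smt (verit) divide_le_eq_1_pos)

lemma pY_pos:
  assumes "input_dist \<mu>"
  shows "0 < pY y \<mu>"
proof -
  interpret prob_space \<mu> using assms by (simp add: input_dist_def)
  note [measurable_cong] = input_dist_simps(1)[OF assms]
  have "pY y \<mu> \<noteq> 0"
  proof
    assume "pY y \<mu> = 0"
    then have "AE x in \<mu>. phi (y - x) = 0"
      unfolding pY_def
      by (subst (asm) integral_nonneg_eq_0_iff_AE) (auto intro: integrable_phi_input assms)
    then have "AE x in \<mu>. False"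
      by (rule AE_mp) (use phi_pos in \<open>auto simp: less_le\<close>)
    then show False by (simp add: AE_False)
  qed
  then show ?thesis by (simp add: less_le)
qed

lemma measurable_pY [measurable]:
  assumes "input_dist \<mu>"
  shows "(\<lambda>y. pY y \<mu>) \<in> borel_measurable borel"
proof -
  interpret prob_space \<mu> using assms by (simp add: input_dist_def)
  note [measurable_cong] = input_dist_simps(1)[OF assms]
  show ?thesis unfolding pY_def by measurable
qed

lemma continuous_pY:
  assumes "input_dist \<mu>"
  shows "continuous_on UNIV (\<lambda>y. pY y \<mu>)"
proof -
  interpret prob_space \<mu> using assms by (simp add: input_dist_def)
  note [measurable_cong] = input_dist_simps(1)[OF assms]
  have "(\<lambda>n. pY (u n) \<mu>) \<longlonglongrightarrow> pY y \<mu>" if u: "u \<longlonglongrightarrow> y" for u y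
    unfolding pY_def
  proof (rule integral_dominated_convergence[where w = "\<lambda>_. 1"])
    have "isCont phi t" for t
      using continuous_on_phi[of UNIV "\<lambda>x. x"] by (auto simp: continuous_on_eq_continuous_at)
    then show "AE x in \<mu>. (\<lambda>n. phi (u n - x)) \<longlonglongrightarrow> phi (y - x)"
      by (intro AE_I2 isCont_tendsto_compose[where g = phi] tendsto_intros u)
  qed (auto simp: phi_le_1)
  then show ?thesis
    by (auto simp: continuous_on_sequentially comp_def)
qed

lemma pY_ge_atom:
  assumes "input_dist \<mu>"
  shows "measure \<mu> {0} * phi y \<le> pY y \<mu>"
proof -
  interpret prob_space \<mu> using assms by (simp add: input_dist_def)
  note [measurable_cong] = input_dist_simps(1)[OF assms]
  have "measure \<mu> {0} * phi y = (\<integral>x. indicator {0} x * phi y \<partial>\<mu>)"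
    by simp
  also have "\<dots> \<le> pY y \<mu>"
    unfolding pY_def
  proof (intro integral_mono integrable_phi_input assms)
    show "integrable \<mu> (\<lambda>x. indicator {0} x * phi y)"
      by (intro integrable_mult_left integrable_real_indicator) (auto simp: emeasure_eq_measure)
  qed (auto split: split_indicator)
  finally show ?thesis .
qed

section \<open>The output law\<close>

definition out :: "real measure \<Rightarrow> real measure" where
  "out \<mu> = density lborel (\<lambda>y. ennreal (pY y \<mu>))"

lemma sets_out [simp, measurable_cong]: "sets (out \<mu>) = sets borel"
  and space_out [simp]: "space (out \<mu>) = UNIV"
  by (simp_all add: out_def)

lemma nn_integral_out:
  assumes "input_dist \<mu>" and [measurable]: "f \<in> borel_measurable borel"
  shows "(\<integral>\<^sup>+y. f y \<partial>out \<mu>) = (\<integral>\<^sup>+x. (\<integral>\<^sup>+z. f (x + z) \<partial>gauss) \<partial>\<mu>)"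
proof -
  interpret prob_space \<mu> using assms by (simp add: input_dist_def)
  note [measurable_cong] = input_dist_simps(1)[OF assms(1)]
  note [measurable] = measurable_pY[OF assms(1)]
  interpret P: pair_sigma_finite lborel \<mu> ..
  have "(\<integral>\<^sup>+y. f y \<partial>out \<mu>) = (\<integral>\<^sup>+y. (\<integral>\<^sup>+x. ennreal (phi (y - x)) * f y \<partial>\<mu>) \<partial>lborel)"
    by (simp add: out_def nn_integral_density ennreal_pY[OF assms(1)] nn_integral_multc)
  also have "\<dots> = (\<integral>\<^sup>+x. (\<integral>\<^sup>+y. ennreal (phi (y - x)) * f y \<partial>lborel) \<partial>\<mu>)"
    by (intro P.Fubini'[symmetric]) measurable
  finally show ?thesis by (simp add: nn_integral_phi_shift)
qed

lemma prob_space_out: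
  assumes "input_dist \<mu>"
  shows "prob_space (out \<mu>)"
proof (rule prob_spaceI)
  interpret prob_space \<mu> using assms by (simp add: input_dist_def)
  have "emeasure (out \<mu>) (space (out \<mu>)) = (\<integral>\<^sup>+y. 1 \<partial>out \<mu>)"
    by simp
  also have "\<dots> = 1"
    by (subst nn_integral_out[OF assms])
       (auto simp: emeasure_space_1 gauss.emeasure_space_1[simplified])
  finally show "emeasure (out \<mu>) (space (out \<mu>)) = 1" .
qed

section \<open>Cross entropy and mixtures\<close>

text \<open>Positivity of q belongs to membership, so that ln q is meaningful wherever membership is
  assumed. Power is a separate predicate because the two arguments of \<open>cross_entropy\<close>
  need different conditions: finite power on the left, an atom on the right.\<close>

definition atomic_input :: "real \<Rightarrow> real measure set" where
  "atomic_input q = {\<nu>. input_dist \<nu> \<and> 0 < q \<and> q \<le> measure \<nu> {0}}"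

definition finite_power :: "real measure \<Rightarrow> bool" where
  "finite_power \<mu> \<longleftrightarrow> input_dist \<mu> \<and> integrable \<mu> (\<lambda>x. x\<^sup>2)"

text \<open>This is d(x; \<nu>) up to the additive constant \<open>noise_entropy\<close>: the part
  that depends on \<nu>, which is moreover nonnegative.\<close>

definition cross :: "real \<Rightarrow> real measure \<Rightarrow> real" where
  "cross x \<nu> = (\<integral>z. - ln (pY (x + z) \<nu>) \<partial>gauss)"

definition cross_entropy :: "real measure \<Rightarrow> real measure \<Rightarrow> real" where
  "cross_entropy \<mu> \<nu> = (\<integral>y. - ln (pY y \<nu>) \<partial>out \<mu>)"

definition noise_entropy :: real where
  "noise_entropy = (\<integral>z. - ln (phi z) \<partial>gauss)"

lemma atomic_inputD: "\<nu> \<in> atomic_input q \<Longrightarrow> input_dist \<nu>"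
  by (simp add: atomic_input_def)

lemma finite_powerD: "finite_power \<mu> \<Longrightarrow> input_dist \<mu>"
  by (simp add: finite_power_def)

lemma neg_ln_pY_nonneg: "input_dist \<nu> \<Longrightarrow> 0 \<le> - ln (pY y \<nu>)"
  using pY_le_1[of \<nu> y] pY_pos[of \<nu> y] by simp

lemma pY_ge_phi:
  assumes "\<nu> \<in> atomic_input q"
  shows "q * phi y \<le> pY y \<nu>"
proof -
  have "q * phi y \<le> measure \<nu> {0} * phi y"
    using assms by (intro mult_right_mono) (auto simp: atomic_input_def)
  also have "\<dots> \<le> pY y \<nu>"
    using assms by (intro pY_ge_atom) (simp add: atomic_input_def)
  finally show ?thesis .
qed

text \<open>The atom alone contributes \<open>q * phi y\<close>, so output tails are never lighter
  than Gaussian. This majorant gives the integrability lemmas below and the dominating function in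
  \<open>cross_entropy_mix_tendsto\<close>.\<close>

lemma neg_ln_pY_le:
  assumes "\<nu> \<in> atomic_input q"
  shows "- ln (pY y \<nu>) \<le> y\<^sup>2 / 2 + (ln (sqrt (2 * pi)) - ln q)"
proof -
  have q: "0 < q" using assms by (simp add: atomic_input_def)
  have "ln (q * phi y) \<le> ln (pY y \<nu>)"
    using q pY_ge_phi[OF assms, of y] by (intro ln_mono) auto
  then show ?thesis
    using q phi_pos[of y] by (simp add: ln_mult_pos ln_phi)
qed

lemma integrable_quadratic_bound:
  fixes g :: "real \<Rightarrow> real"
  assumes "integrable M (\<lambda>x. (u x)\<^sup>2)" "finite_measure M" "g \<in> borel_measurable M"
    and "\<And>x. 0 \<le> g x" "\<And>x. g x \<le> (u x)\<^sup>2 / 2 + c"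
  shows "integrable M g"
proof -
  interpret finite_measure M by fact
  have "integrable M (\<lambda>x. (u x)\<^sup>2 / 2 + c)"
    using assms(1) by auto
  then show ?thesis
    by (rule Bochner_Integration.integrable_bound) (use assms(3-5) in \<open>auto intro!: order_trans[OF _ abs_ge_self]\<close>)
qed

lemma integrable_cross:
  assumes "\<nu> \<in> atomic_input q"
  shows "integrable gauss (\<lambda>z. - ln (pY (x + z) \<nu>))"
proof -
  note [measurable] = measurable_pY[OF atomic_inputD[OF assms]]
  show ?thesis
    by (rule integrable_quadratic_bound[where u = "\<lambda>z. x + z"])
       (use assms in \<open>auto intro!: neg_ln_pY_le integrable_gauss_shift_sq neg_ln_pY_nonneg[simplified]
          gauss.finite_measure_axioms atomic_inputD simp del: ln_le_zero_iff\<close>)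
qed

lemma cross_nonneg: "input_dist \<nu> \<Longrightarrow> 0 \<le> cross x \<nu>"
  unfolding cross_def by (intro integral_nonneg_AE AE_I2 neg_ln_pY_nonneg)

lemma cross_le:
  assumes "\<nu> \<in> atomic_input q"
  shows "cross x \<nu> \<le> x\<^sup>2 / 2 + (1 / 2 + ln (sqrt (2 * pi)) - ln q)"
proof -
  have "cross x \<nu> \<le> (\<integral>z. (x + z)\<^sup>2 / 2 + (ln (sqrt (2 * pi)) - ln q) \<partial>gauss)"
    unfolding cross_def
    by (intro integral_mono integrable_cross[OF assms] neg_ln_pY_le[OF assms])
       (auto intro!: integrable_gauss_shift_sq)
  also have "\<dots> = x\<^sup>2 / 2 + (1 / 2 + ln (sqrt (2 * pi)) - ln q)"
    using integrable_gauss_shift_sq[of x] integral_gauss_shift_sq[of x] gauss.prob_space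
    by (simp add: add_divide_distrib)
  finally show ?thesis .
qed

lemma measurable_cross [measurable]:
  assumes "input_dist \<nu>"
  shows "(\<lambda>x. cross x \<nu>) \<in> borel_measurable borel"
proof -
  note [measurable] = measurable_pY[OF assms]
  show ?thesis unfolding cross_def by measurable
qed

lemma integrable_gauss_ln_phi: "integrable gauss (\<lambda>z. ln (phi z))"
  by (simp add: ln_phi)

lemma dens_eq_cross:
  assumes "\<nu> \<in> atomic_input q"
  shows "dens x \<nu> = cross x \<nu> - noise_entropy"
proof -
  note [measurable] = measurable_pY[OF atomic_inputD[OF assms]]
  have "dens x \<nu> = (LBINT y. phi (y - x) * (\<lambda>y. ln (phi (y - x)) - ln (pY y \<nu>)) y)"
    unfolding dens_def
    by (intro Bochner_Integration.integral_cong refl)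
       (simp add: ln_divide_pos pY_pos[OF atomic_inputD[OF assms]])
  also have "\<dots> = (\<integral>z. ln (phi z) + - ln (pY (x + z) \<nu>) \<partial>gauss)"
    by (subst integral_phi_shift) simp_all
  also have "\<dots> = cross x \<nu> - noise_entropy"
    unfolding cross_def noise_entropy_def using integrable_cross[OF assms, of x]
    by (subst Bochner_Integration.integral_add) (auto simp: integrable_gauss_ln_phi)
  finally show ?thesis .
qed

lemma nn_integral_sq_out:
  assumes "finite_power \<mu>"
  shows "(\<integral>\<^sup>+y. ennreal (y\<^sup>2) \<partial>out \<mu>) < \<infinity>"
proof -
  interpret prob_space \<mu> using assms by (simp add: input_dist_def finite_power_def)
  have "(\<integral>\<^sup>+z. ennreal ((x + z)\<^sup>2) \<partial>gauss) = ennreal (x\<^sup>2 + 1)" for x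
    by (subst nn_integral_eq_integral) (auto simp: integrable_gauss_shift_sq integral_gauss_shift_sq)
  then have "(\<integral>\<^sup>+y. ennreal (y\<^sup>2) \<partial>out \<mu>) = (\<integral>\<^sup>+x. ennreal (x\<^sup>2 + 1) \<partial>\<mu>)"
    by (subst nn_integral_out) (use assms in \<open>auto simp: finite_power_def\<close>)
  also have "\<dots> < \<infinity>"
    using assms by (subst nn_integral_eq_integral) (auto simp: finite_power_def)
  finally show ?thesis .
qed

lemma integrable_sq_out:
  assumes "finite_power \<mu>"
  shows "integrable (out \<mu>) (\<lambda>y. y\<^sup>2)"
  by (rule integrableI_nonneg) (use nn_integral_sq_out[OF assms] in auto)

lemma integrable_cross_entropy:
  assumes "finite_power \<mu>" "\<nu> \<in> atomic_input q"
  shows "integrable (out \<mu>) (\<lambda>y. - ln (pY y \<nu>))"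
proof -
  note [measurable] = measurable_pY[OF atomic_inputD[OF assms(2)]]
  interpret out: prob_space "out \<mu>" using assms by (intro prob_space_out finite_powerD)
  show ?thesis
    by (rule integrable_quadratic_bound[OF integrable_sq_out[OF assms(1)] out.finite_measure_axioms])
       (use assms in \<open>auto intro!: neg_ln_pY_le neg_ln_pY_nonneg[simplified] atomic_inputD
         simp del: ln_le_zero_iff\<close>)
qed

lemma integrable_cross_input:
  assumes "finite_power \<mu>" "\<nu> \<in> atomic_input q"
  shows "integrable \<mu> (\<lambda>x. cross x \<nu>)"
proof -
  interpret prob_space \<mu> using assms by (simp add: input_dist_def finite_power_def)
  note [measurable] = measurable_cross[OF atomic_inputD[OF assms(2)]]
  note [measurable_cong] = input_dist_simps(1)[OF finite_powerD[OF assms(1)]]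
  show ?thesis
    by (rule integrable_quadratic_bound[where u = "\<lambda>x. x"])
       (use assms cross_le[OF assms(2)] in \<open>auto intro!: cross_nonneg atomic_inputD simp: finite_power_def finite_measure_axioms\<close>)
qed

text \<open>The integrand is nonnegative, so Tonelli in the form of \<open>nn_integral_out\<close>
  applies, and finiteness of both sides brings the identity back to real integrals.\<close>

lemma integral_cross:
  assumes "finite_power \<mu>" "\<nu> \<in> atomic_input q"
  shows "(\<integral>x. cross x \<nu> \<partial>\<mu>) = cross_entropy \<mu> \<nu>"
proof -
  have i: "input_dist \<mu>" "input_dist \<nu>" using assms by (auto intro: finite_powerD atomic_inputD)
  interpret prob_space \<mu> using i by (simp add: input_dist_def)
  note [measurable] = measurable_cross[OF i(2)] measurable_pY[OF i(2)]
  note [measurable_cong] = input_dist_simps(1)[OF i(1)]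
  have "ennreal (cross_entropy \<mu> \<nu>) = (\<integral>\<^sup>+y. ennreal (- ln (pY y \<nu>)) \<partial>out \<mu>)"
    unfolding cross_entropy_def
    by (intro nn_integral_eq_integral[symmetric] integrable_cross_entropy[OF assms] AE_I2 neg_ln_pY_nonneg i)
  also have "\<dots> = (\<integral>\<^sup>+x. (\<integral>\<^sup>+z. ennreal (- ln (pY (x + z) \<nu>)) \<partial>gauss) \<partial>\<mu>)"
    by (rule nn_integral_out) (simp_all add: i)
  also have "\<dots> = (\<integral>\<^sup>+x. ennreal (cross x \<nu>) \<partial>\<mu>)"
    unfolding cross_def
    by (intro nn_integral_cong nn_integral_eq_integral integrable_cross[OF assms(2)] AE_I2 neg_ln_pY_nonneg i)
  also have "\<dots> = ennreal (\<integral>x. cross x \<nu> \<partial>\<mu>)"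
    by (intro nn_integral_eq_integral integrable_cross_input[OF assms] AE_I2 cross_nonneg i)
  finally show ?thesis
    by (subst (asm) ennreal_inj)
       (auto simp: cross_entropy_def simp del: integral_minus intro!: integral_nonneg_AE AE_I2 cross_nonneg neg_ln_pY_nonneg i)
qed

lemma integral_dens:
  assumes "finite_power \<mu>" "\<nu> \<in> atomic_input q"
  shows "(\<integral>x. dens x \<nu> \<partial>\<mu>) = cross_entropy \<mu> \<nu> - noise_entropy"
proof -
  interpret prob_space \<mu> using assms by (simp add: input_dist_def finite_power_def)
  show ?thesis
    using integrable_cross_input[OF assms] prob_space
    by (simp add: dens_eq_cross[OF assms(2)] integral_cross[OF assms])
qed

lemma MI_eq_cross_entropy:
  assumes "finite_power \<mu>" "\<mu> \<in> atomic_input q"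
  shows "MI \<mu> = cross_entropy \<mu> \<mu> - noise_entropy"
  unfolding MI_def by (rule integral_dens[OF assms])

lemma lborel_cross_entropy:
  assumes "finite_power \<mu>" "\<nu> \<in> atomic_input q"
  shows "integrable lborel (\<lambda>y. pY y \<mu> * - ln (pY y \<nu>))"
    and "cross_entropy \<mu> \<nu> = (LBINT y. pY y \<mu> * - ln (pY y \<nu>))"
proof -
  note [measurable] = measurable_pY[OF atomic_inputD[OF assms(2)]] measurable_pY[OF finite_powerD[OF assms(1)]]
  show "integrable lborel (\<lambda>y. pY y \<mu> * - ln (pY y \<nu>))"
    using integrable_cross_entropy[OF assms] unfolding out_def
    by (subst (asm) integrable_density) auto
  show "cross_entropy \<mu> \<nu> = (LBINT y. pY y \<mu> * - ln (pY y \<nu>))"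
    unfolding cross_entropy_def out_def
    by (subst integral_density) auto
qed

lemma lborel_pY:
  assumes "input_dist \<mu>"
  shows "integrable lborel (\<lambda>y. pY y \<mu>)" "(LBINT y. pY y \<mu>) = 1"
proof -
  note [measurable] = measurable_pY[OF assms]
  interpret out: prob_space "out \<mu>" using assms by (rule prob_space_out)
  have "integrable (out \<mu>) (\<lambda>y. 1 :: real)" by simp
  then show "integrable lborel (\<lambda>y. pY y \<mu>)"
    unfolding out_def by (subst (asm) integrable_density) auto
  have "(\<integral>y. 1 \<partial>out \<mu>) = (1 :: real)" using out.prob_space by simp
  then show "(LBINT y. pY y \<mu>) = 1"
    unfolding out_def by (subst (asm) integral_density) auto
qed

text \<open>The set of disagreement is open and negligible, hence empty.\<close>

lemma continuous_AE_eq_imp_eq: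
  fixes f g :: "real \<Rightarrow> real"
  assumes "continuous_on UNIV f" "continuous_on UNIV g" "AE x in lborel. f x = g x"
  shows "f = g"
proof -
  have "open {x. f x \<noteq> g x}"
    using assms by (simp add: open_Collect_neq)
  moreover have "negligible {x. f x \<noteq> g x}"
  proof -
    have "AE x in lebesgue. f x = g x"
      using assms(3) by (rule AE_completion)
    then show ?thesis
      by (simp add: negligible_iff_null_sets AE_iff_null_sets eventually_ae_filter)
         (metis (mono_tags, lifting) null_sets_completion_subset)
  qed
  ultimately have "{x. f x \<noteq> g x} = {}"
    using open_not_negligible by blast
  then show ?thesis by auto
qed

text \<open>With u = r/p the expression is p (u - 1 - ln u): the integrand of relative entropy, made
  pointwise nonnegative by the correction r - p.\<close>

lemma Gibbs_pointwise:
  fixes p r :: real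
  assumes "0 < p" "0 < r"
  shows "0 \<le> p * - ln r - p * - ln p - p + r"
    and "p * - ln r - p * - ln p - p + r = 0 \<Longrightarrow> p = r"
proof -
  have *: "p * - ln r - p * - ln p - p + r = p * (r / p - 1 - ln (r / p))"
    using assms by (simp add: ln_div field_simps)
  have "ln (r / p) \<le> r / p - 1"
    using assms by (intro ln_le_minus_one) auto
  then show "0 \<le> p * - ln r - p * - ln p - p + r"
    unfolding * using assms by (intro mult_nonneg_nonneg) auto
  assume "p * - ln r - p * - ln p - p + r = 0"
  then have "ln (r / p) = r / p - 1"
    unfolding * using assms by simp
  then have "r / p = 1"
    using assms by (intro ln_eq_minus_one) auto
  then show "p = r" using assms by simp
qed

text \<open>Both output densities have mass 1, so the correction terms of
  \<open>Gibbs_pointwise\<close> integrate to 0. Continuity of output densities turns equality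
  almost everywhere into equality.\<close>

lemma Gibbs_inequality:
  assumes "finite_power \<mu>" "\<mu> \<in> atomic_input q" "\<nu> \<in> atomic_input q'"
  shows "cross_entropy \<mu> \<mu> \<le> cross_entropy \<mu> \<nu>"
    and "cross_entropy \<mu> \<mu> = cross_entropy \<mu> \<nu> \<Longrightarrow> (\<lambda>y. pY y \<mu>) = (\<lambda>y. pY y \<nu>)"
proof -
  have i: "input_dist \<mu>" "input_dist \<nu>" using assms by (auto intro: finite_powerD atomic_inputD)
  let ?f = "\<lambda>y. pY y \<mu> * - ln (pY y \<nu>) - pY y \<mu> * - ln (pY y \<mu>) - pY y \<mu> + pY y \<nu>"
  have int: "integrable lborel ?f"
    by (intro Bochner_Integration.integrable_add Bochner_Integration.integrable_diff
        lborel_cross_entropy(1)[OF assms(1)] lborel_pY i) (rule assms)+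
  have eq: "(LBINT y. ?f y) = cross_entropy \<mu> \<nu> - cross_entropy \<mu> \<mu>"
    using lborel_cross_entropy[OF assms(1,2)] lborel_cross_entropy[OF assms(1,3)] lborel_pY i
    by (simp add: Bochner_Integration.integrable_add Bochner_Integration.integrable_diff
        del: mult_minus_right)
  have nn: "0 \<le> ?f y" for y
    by (rule Gibbs_pointwise(1)) (auto intro: pY_pos i)
  have "0 \<le> (LBINT y. ?f y)"
    using nn by (intro integral_nonneg_AE) auto
  then show "cross_entropy \<mu> \<mu> \<le> cross_entropy \<mu> \<nu>"
    unfolding eq by simp
  assume "cross_entropy \<mu> \<mu> = cross_entropy \<mu> \<nu>"
  then have "(LBINT y. ?f y) = 0" unfolding eq by simp
  then have "AE y in lborel. ?f y = 0"
    using integral_nonneg_eq_0_iff_AE[OF int] nn by blast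
  then have "AE y in lborel. pY y \<mu> = pY y \<nu>"
  proof eventually_elim
    case (elim y)
    then show ?case by (rule Gibbs_pointwise(2)[OF pY_pos[OF i(1)] pY_pos[OF i(2)]])
  qed
  then show "(\<lambda>y. pY y \<mu>) = (\<lambda>y. pY y \<nu>)"
    by (intro continuous_AE_eq_imp_eq continuous_pY i)
qed

text \<open>The parameter is the weight of the second component.\<close>
definition mix :: "real \<Rightarrow> real measure \<Rightarrow> real measure \<Rightarrow> real measure" where
  "mix t \<mu> \<nu> = measure_pmf (bernoulli_pmf t) \<bind> (\<lambda>b. if b then \<nu> else \<mu>)"

section \<open>Laws and densities of mixtures\<close>

context
  fixes t :: real and \<mu> \<nu> :: "real measure"
  assumes t: "0 \<le> t" "t \<le> 1" and i: "input_dist \<mu>" "input_dist \<nu>"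
begin

lemma mix_kernel:
  "(\<lambda>b. if b then \<nu> else \<mu>) \<in> measurable (measure_pmf (bernoulli_pmf t)) (subprob_algebra borel)"
  using i prob_space_imp_subprob_space[of \<mu>] prob_space_imp_subprob_space[of \<nu>]
  unfolding measurable_pmf_measure1 by (simp add: space_subprob_algebra input_dist_def)

lemma nn_integral_mix:
  assumes "f \<in> borel_measurable borel"
  shows "(\<integral>\<^sup>+x. f x \<partial>mix t \<mu> \<nu>)
    = ennreal (1 - t) * (\<integral>\<^sup>+x. f x \<partial>\<mu>) + ennreal t * (\<integral>\<^sup>+x. f x \<partial>\<nu>)"
  unfolding mix_def using t
  by (subst nn_integral_bind[OF assms mix_kernel])
     (simp add: nn_integral_measure_pmf nn_integral_count_space_finite UNIV_bool mult.commute add.commute)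

lemma sets_mix: "sets (mix t \<mu> \<nu>) = sets borel"
  unfolding mix_def by (subst sets_bind[where N = borel]) (use i in \<open>auto simp: input_dist_def\<close>)

lemma emeasure_mix:
  assumes "A \<in> sets borel"
  shows "emeasure (mix t \<mu> \<nu>) A = ennreal (1 - t) * emeasure \<mu> A + ennreal t * emeasure \<nu> A"
  using nn_integral_mix[of "indicator A"] assms
  by (simp add: sets_mix input_dist_simps i)

lemma input_dist_mix: "input_dist (mix t \<mu> \<nu>)"
proof -
  have "emeasure (mix t \<mu> \<nu>) (space (mix t \<mu> \<nu>)) = 1"
    using emeasure_mix[of UNIV] prob_space.emeasure_space_1[OF input_dist_simps(3)[OF i(1)]]
      prob_space.emeasure_space_1[OF input_dist_simps(3)[OF i(2)]] t
    by (simp add: sets_eq_imp_space_eq[OF sets_mix] input_dist_simps i ennreal_plus[symmetric]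
        del: ennreal_plus)
  then show ?thesis
    by (auto simp: input_dist_def sets_mix intro: prob_spaceI)
qed

lemma measure_mix:
  assumes "A \<in> sets borel"
  shows "measure (mix t \<mu> \<nu>) A = (1 - t) * measure \<mu> A + t * measure \<nu> A"
proof -
  interpret m: prob_space \<mu> using i by (simp add: input_dist_def)
  interpret n: prob_space \<nu> using i by (simp add: input_dist_def)
  have "emeasure (mix t \<mu> \<nu>) A = ennreal ((1 - t) * measure \<mu> A + t * measure \<nu> A)"
    unfolding emeasure_mix[OF assms] using t
    by (simp add: m.emeasure_eq_measure n.emeasure_eq_measure ennreal_mult)
  then show ?thesis
    using t by (simp only: measure_def[of "mix t \<mu> \<nu>"]) (simp del: ennreal_plus)
qed

lemma pY_mix: "pY y (mix t \<mu> \<nu>) = (1 - t) * pY y \<mu> + t * pY y \<nu>"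
proof -
  have "ennreal (pY y (mix t \<mu> \<nu>)) = ennreal ((1 - t) * pY y \<mu> + t * pY y \<nu>)"
    using nn_integral_mix[of "\<lambda>x. ennreal (phi (y - x))"] t
    by (simp add: ennreal_pY[symmetric] i input_dist_mix ennreal_mult)
  then show ?thesis
    using t by (subst (asm) ennreal_inj) auto
qed

end

lemma finite_power_iff:
  "finite_power \<mu> \<longleftrightarrow> input_dist \<mu> \<and> (\<integral>\<^sup>+x. ennreal (x\<^sup>2) \<partial>\<mu>) < \<infinity>"
proof (cases "input_dist \<mu>")
  case True
  note [measurable_cong] = input_dist_simps(1)[OF True]
  show ?thesis
    unfolding finite_power_def using True by (simp add: integrable_iff_bounded)
qed (simp add: finite_power_def)

lemma finite_power_mix:
  assumes "0 \<le> t" "t \<le> 1" "finite_power \<mu>" "finite_power \<nu>"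
  shows "finite_power (mix t \<mu> \<nu>)"
  using assms by (auto simp: finite_power_iff nn_integral_mix input_dist_mix ennreal_mult_less_top)

lemma atomic_input_mix:
  assumes "0 \<le> t" "t \<le> 1" "\<mu> \<in> atomic_input q" "\<nu> \<in> atomic_input q"
  shows "mix t \<mu> \<nu> \<in> atomic_input q"
proof -
  have "(1 - t) * q + t * q \<le> (1 - t) * measure \<mu> {0} + t * measure \<nu> {0}"
    using assms by (intro add_mono mult_left_mono) (auto simp: atomic_input_def)
  then show ?thesis
    using assms by (auto simp: atomic_input_def measure_mix input_dist_mix algebra_simps)
qed

lemma cross_entropy_mix:
  assumes "0 \<le> t" "t \<le> 1" "finite_power \<mu>" "finite_power \<mu>'" "\<nu> \<in> atomic_input q"
  shows "cross_entropy (mix t \<mu> \<mu>') \<nu> = (1 - t) * cross_entropy \<mu> \<nu> + t * cross_entropy \<mu>' \<nu>"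
proof -
  have i: "input_dist \<mu>" "input_dist \<mu>'" using assms by (auto intro: finite_powerD)
  have "cross_entropy (mix t \<mu> \<mu>') \<nu>
    = (LBINT y. (1 - t) * (pY y \<mu> * - ln (pY y \<nu>)) + t * (pY y \<mu>' * - ln (pY y \<nu>)))"
    using assms by (simp add: lborel_cross_entropy(2)[OF finite_power_mix] pY_mix i algebra_simps)
  also have "\<dots> = (1 - t) * cross_entropy \<mu> \<nu> + t * cross_entropy \<mu>' \<nu>"
    using lborel_cross_entropy[OF assms(3,5)] lborel_cross_entropy[OF assms(4,5)]
    by (subst Bochner_Integration.integral_add) (auto simp del: mult_minus_right)
  finally show ?thesis .
qed

lemma pY_return: "pY y (return borel x) = phi (y - x)"
  by (simp add: pY_def integral_return)

lemma finite_power_return [simp]: "finite_power (return borel x)"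
  by (simp add: finite_power_iff nn_integral_return)

lemma cross_entropy_return:
  assumes "\<nu> \<in> atomic_input q"
  shows "cross_entropy (return borel x) \<nu> = cross x \<nu>"
proof -
  note [measurable] = measurable_pY[OF atomic_inputD[OF assms]]
  show ?thesis
    unfolding lborel_cross_entropy(2)[OF finite_power_return assms] pY_return cross_def
    by (rule integral_phi_shift) measurable
qed

text \<open>A general weight is allowed because achievability mixes the maximizer with a small
  multiple of the point mass at 0.\<close>

lemma MI_concave:
  assumes "0 \<le> t" "t \<le> 1" "finite_power \<mu>" "finite_power \<nu>" "\<mu> \<in> atomic_input q" "\<nu> \<in> atomic_input q"
  shows "(1 - t) * MI \<mu> + t * MI \<nu> \<le> MI (mix t \<mu> \<nu>)"
proof -
  have m: "finite_power (mix t \<mu> \<nu>)" "mix t \<mu> \<nu> \<in> atomic_input q"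
    using assms by (auto intro: finite_power_mix atomic_input_mix)
  have "(1 - t) * cross_entropy \<mu> \<mu> + t * cross_entropy \<nu> \<nu>
    \<le> (1 - t) * cross_entropy \<mu> (mix t \<mu> \<nu>) + t * cross_entropy \<nu> (mix t \<mu> \<nu>)"
    using assms m by (intro add_mono mult_left_mono Gibbs_inequality(1)) auto
  also have "\<dots> = cross_entropy (mix t \<mu> \<nu>) (mix t \<mu> \<nu>)"
    using assms m by (subst cross_entropy_mix) auto
  finally show ?thesis
    using assms m by (simp add: MI_eq_cross_entropy algebra_simps)
qed

lemma MI_strictly_concave:
  assumes "finite_power \<mu>" "finite_power \<nu>" "\<mu> \<in> atomic_input q" "\<nu> \<in> atomic_input q"
    and "(\<lambda>y. pY y \<mu>) \<noteq> (\<lambda>y. pY y \<nu>)"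
  shows "(MI \<mu> + MI \<nu>) / 2 < MI (mix (1/2) \<mu> \<nu>)"
proof -
  let ?m = "mix (1/2) \<mu> \<nu>"
  have m: "finite_power ?m" "?m \<in> atomic_input q"
    using assms by (auto intro: finite_power_mix atomic_input_mix)
  \<comment> \<open>Strictness in one of the two Gibbs inequalities is enough: the midpoint has the
    output density of \<mu> only if \<mu> and \<nu> have the same one.\<close>
  have "(\<lambda>y. pY y \<mu>) \<noteq> (\<lambda>y. pY y ?m)"
  proof
    assume "(\<lambda>y. pY y \<mu>) = (\<lambda>y. pY y ?m)"
    then have half: "pY y \<mu> = (1 - 1/2) * pY y \<mu> + (1/2) * pY y \<nu>" for y
      using assms(1,2) by (subst pY_mix[symmetric]) (auto simp: finite_power_def dest: fun_cong)
    have "pY y \<mu> = pY y \<nu>" for y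
      using half[of y] by simp
    then show False using assms(5) by auto
  qed
  then have "cross_entropy \<mu> \<mu> < cross_entropy \<mu> ?m"
    using Gibbs_inequality[OF assms(1,3) m(2)] by (auto simp: less_le)
  moreover have "cross_entropy \<nu> \<nu> \<le> cross_entropy \<nu> ?m"
    using assms m by (intro Gibbs_inequality(1)) auto
  moreover have "cross_entropy ?m ?m = (cross_entropy \<mu> ?m + cross_entropy \<nu> ?m) / 2"
    using assms(1,2) m by (subst cross_entropy_mix) auto
  ultimately show ?thesis
    by (simp add: MI_eq_cross_entropy[OF assms(1,3)] MI_eq_cross_entropy[OF assms(2,4)]
        MI_eq_cross_entropy[OF m])
qed

section \<open>Laplace transforms and Gaussian deconvolution\<close>

text \<open>The exponential series is integrated term by term. Since exp |ax| is at most exp(ax) +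
  exp(-ax), real exponential moments of both signs dominate all partial sums of absolute
  values.\<close>

lemma laplace_transform_sums:
  fixes \<nu> :: "real measure" and z :: complex
  assumes "sets \<nu> = sets borel" "\<And>a::real. integrable \<nu> (\<lambda>x. exp (a * x))"
  shows "(\<lambda>n. complex_of_real (\<integral>x. x ^ n / fact n \<partial>\<nu>) * z ^ n) sums (\<integral>x. exp (z * of_real x) \<partial>\<nu>)"
proof -
  note [measurable_cong] = assms(1)
  let ?f = "\<lambda>n x. complex_of_real (x ^ n / fact n) * z ^ n"
  let ?B = "\<lambda>a x. exp (a * x) + exp (- a * x :: real)"
  have le: "exp (\<bar>a * x\<bar>) \<le> ?B a x" for a x :: real
    by (cases "a * x \<ge> 0") (auto simp: abs_if)
  have intB: "integrable \<nu> (?B a)" for a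
    using assms(2)[of a] assms(2)[of "- a"] by (intro Bochner_Integration.integrable_add) auto
  have term_le: "\<bar>a * x\<bar> ^ n / fact n \<le> exp \<bar>a * x\<bar>" for a x :: real and n
  proof -
    have "(\<Sum>i\<in>{n}. \<bar>a * x\<bar> ^ i /\<^sub>R fact i) \<le> (\<Sum>i. \<bar>a * x\<bar> ^ i /\<^sub>R fact i)"
      by (intro sum_le_suminf summable_exp_generic) auto
    then show ?thesis by (simp add: exp_def divide_inverse mult.commute)
  qed
  have int_pow: "integrable \<nu> (\<lambda>x. \<bar>a * x\<bar> ^ n / fact n)" for a n
    by (rule Bochner_Integration.integrable_bound[OF intB[of a]])
       (auto intro!: order_trans[OF term_le] order_trans[OF le])
  have int0: "integrable \<nu> (\<lambda>x. x ^ n / fact n)" for n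
    using int_pow[of 1 n]
    by (rule Bochner_Integration.integrable_bound) (auto simp: power_abs)
  have nf: "norm (?f n x) = \<bar>norm z * x\<bar> ^ n / fact n" for n x
    by (simp add: norm_mult norm_power norm_divide abs_mult power_mult_distrib)
  have "(\<lambda>n. \<integral>x. ?f n x \<partial>\<nu>) sums (\<integral>x. (\<Sum>n. ?f n x) \<partial>\<nu>)"
  proof (rule sums_integral)
    show "integrable \<nu> (?f n)" for n
      by (intro integrable_mult_left integrable_of_real int0)
    have "summable (\<lambda>n. \<bar>norm z * x\<bar> ^ n / fact n)" for x
      using summable_exp_generic[of "\<bar>norm z * x\<bar>"] by (simp add: divide_inverse mult.commute)
    then show "AE x in \<nu>. summable (\<lambda>n. norm (?f n x))"
      unfolding nf by simp
    have "(\<Sum>n<k. \<integral>x. norm (?f n x) \<partial>\<nu>) \<le> (\<integral>x. ?B (norm z) x \<partial>\<nu>)" for k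
    proof -
      have "(\<Sum>n<k. \<integral>x. norm (?f n x) \<partial>\<nu>) = (\<integral>x. (\<Sum>n<k. \<bar>norm z * x\<bar> ^ n / fact n) \<partial>\<nu>)"
        unfolding nf by (subst Bochner_Integration.integral_sum) (auto intro: int_pow)
      also have "\<dots> \<le> (\<integral>x. ?B (norm z) x \<partial>\<nu>)"
      proof (intro integral_mono Bochner_Integration.integrable_sum int_pow intB)
        fix x
        have "(\<Sum>n<k. \<bar>norm z * x\<bar> ^ n /\<^sub>R fact n) \<le> exp \<bar>norm z * x\<bar>"
          unfolding exp_def by (intro sum_le_suminf summable_exp_generic) auto
        then show "(\<Sum>n<k. \<bar>norm z * x\<bar> ^ n / fact n) \<le> ?B (norm z) x"
          using le[of "norm z" x] by (simp add: divide_inverse mult.commute)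
      qed
      finally show ?thesis .
    qed
    then show "summable (\<lambda>n. \<integral>x. norm (?f n x) \<partial>\<nu>)"
      by (intro summableI_nonneg_bounded) (auto intro!: integral_nonneg_AE)
  qed
  moreover have "(\<Sum>n. ?f n x) = exp (z * of_real x)" for x
    by (simp add: exp_def scaleR_conv_of_real divide_inverse mult_ac power_mult_distrib)
  moreover have "(\<integral>x. ?f n x \<partial>\<nu>) = complex_of_real (\<integral>x. x ^ n / fact n \<partial>\<nu>) * z ^ n" for n
    by (simp only: integral_mult_left_zero integral_complex_of_real)
  ultimately show ?thesis by (simp only:)
qed

lemma laplace_transform_entire:
  fixes \<nu> :: "real measure"
  assumes "sets \<nu> = sets borel" "\<And>a::real. integrable \<nu> (\<lambda>x. exp (a * x))"
  shows "(\<lambda>z. \<integral>x. exp (z * complex_of_real x) \<partial>\<nu>) holomorphic_on UNIV"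
proof -
  have "(\<lambda>z. \<integral>x. exp (z * complex_of_real x) \<partial>\<nu>) holomorphic_on ball 0 r" for r
    by (rule power_series_holomorphic[where a = "\<lambda>n. complex_of_real (\<integral>x. x ^ n / fact n \<partial>\<nu>)"])
       (use laplace_transform_sums[OF assms] in auto)
  then have "(\<lambda>z. \<integral>x. exp (z * complex_of_real x) \<partial>\<nu>) holomorphic_on (\<Union>r. ball 0 r)"
    by (intro holomorphic_on_UN_open) auto
  moreover have "(\<Union>r. ball 0 r) = (UNIV :: complex set)"
    by (auto simp: gt_ex)
  ultimately show ?thesis by simp
qed

lemma islimpt_Reals: "complex_of_real x islimpt \<real>"
proof (subst islimpt_approachable, intro allI impI)
  fix e :: real assume "0 < e"
  then show "\<exists>x'\<in>\<real>. x' \<noteq> complex_of_real x \<and> dist x' (complex_of_real x) < e"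
    by (intro bexI[where x = "complex_of_real (x + e / 2)"])
       (auto simp: dist_norm simp flip: of_real_diff of_real_add)
qed

lemma entire_eq_0:
  assumes "f holomorphic_on UNIV" "\<And>x::real. f (of_real x) = 0"
  shows "f z = 0"
proof (rule analytic_continuation[of f UNIV \<real> "complex_of_real 0"])
  show "complex_of_real 0 islimpt \<real>" by (rule islimpt_Reals)
  fix w :: complex assume "w \<in> \<real>"
  then show "f w = 0" using assms(2) by (auto elim: Reals_cases)
qed (use assms in auto)

text \<open>The transforms are entire, so agreement on the real axis spreads to the imaginary axis,
  where they are characteristic functions. Dividing by the common mass m, their value at 0, brings
  in Levy uniqueness; the zero measure has to be split off.\<close>

lemma laplace_transform_unique:
  fixes \<nu> \<nu>' :: "real measure"
  assumes s: "sets \<nu> = sets borel" "sets \<nu>' = sets borel"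
    and int: "\<And>a::real. integrable \<nu> (\<lambda>x. exp (a * x))" "\<And>a::real. integrable \<nu>' (\<lambda>x. exp (a * x))"
    and eq: "\<And>a::real. (\<integral>x. exp (a * x) \<partial>\<nu>) = (\<integral>x. exp (a * x) \<partial>\<nu>')"
  shows "\<nu> = \<nu>'"
proof -
  note [measurable_cong] = s
  have sp: "space \<nu> = UNIV" "space \<nu>' = UNIV"
    using s[THEN sets_eq_imp_space_eq] by auto
  let ?F = "\<lambda>\<nu> z. \<integral>x. exp (z * complex_of_real x) \<partial>(\<nu> :: real measure)"
  have "?F \<nu> z - ?F \<nu>' z = 0" for z
  proof (rule entire_eq_0[where f = "\<lambda>z. ?F \<nu> z - ?F \<nu>' z"])
    show "(\<lambda>z. ?F \<nu> z - ?F \<nu>' z) holomorphic_on UNIV"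
      by (intro holomorphic_intros laplace_transform_entire s int)
    fix x :: real
    have "?F N (of_real x) = complex_of_real (\<integral>y. exp (x * y) \<partial>N)" for N
      by (simp flip: of_real_mult of_real_exp)
    then show "?F \<nu> (of_real x) - ?F \<nu>' (of_real x) = 0"
      by (simp add: eq)
  qed
  then have F: "?F \<nu> z = ?F \<nu>' z" for z by simp
  have "integrable \<nu> (\<lambda>_. 1::real)" "integrable \<nu>' (\<lambda>_. 1::real)"
    using int(1)[of 0] int(2)[of 0] by simp_all
  then have fin: "emeasure \<nu> UNIV < \<infinity>" "emeasure \<nu>' UNIV < \<infinity>"
    by (auto simp: integrable_iff_bounded sp)
  define m where "m = measure \<nu> UNIV"
  have m': "measure \<nu>' UNIV = m"
    using eq[of 0] by (simp add: m_def sp)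
  have em: "emeasure \<nu> UNIV = ennreal m" "emeasure \<nu>' UNIV = ennreal m"
    using fin by (simp_all add: m_def emeasure_eq_ennreal_measure flip: m') (simp add: m' m_def)
  show ?thesis
  proof (cases "m = 0")
    case True
    show ?thesis
    proof (rule measure_eqI)
      fix A assume "A \<in> sets \<nu>"
      have "emeasure \<nu> A \<le> emeasure \<nu> UNIV" "emeasure \<nu>' A \<le> emeasure \<nu>' UNIV"
        by (intro emeasure_mono; simp add: s)+
      then show "emeasure \<nu> A = emeasure \<nu>' A"
        using em True by simp
    qed (simp add: s)
  next
    case False
    then have m: "0 < m" by (simp add: m_def less_le)
    let ?P = "\<lambda>\<nu>. density \<nu> (\<lambda>_. ennreal (1 / m))"
    have P: "real_distribution (?P N)" if "N = \<nu> \<or> N = \<nu>'" for N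
    proof -
      have N: "sets N = sets borel" "space N = UNIV" "emeasure N UNIV = ennreal m"
        using that s sp em by auto
      note [measurable_cong] = N(1)
      have "emeasure (?P N) (space (?P N)) = 1"
        using m by (simp add: emeasure_density_const N ennreal_mult[symmetric])
      then have "prob_space (?P N)" by (rule prob_spaceI)
      then show ?thesis
        by (simp add: real_distribution_def real_distribution_axioms_def N)
    qed
    have char: "char (?P N) t = ?F N (\<i> * of_real t) / of_real m" if "sets N = sets borel" for N t
    proof -
      note [measurable_cong] = that
      have "char (?P N) t = (\<integral>x. (1 / m) *\<^sub>R iexp (t * x) \<partial>N)"
        unfolding char_def using m by (subst integral_density) auto
      also have "\<dots> = (1 / m) *\<^sub>R ?F N (\<i> * of_real t)"
        by (subst integral_scaleR_right) (simp_all add: mult.assoc)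
      finally show ?thesis by (simp add: scaleR_conv_of_real)
    qed
    have "?P \<nu> = ?P \<nu>'"
      by (intro Levy_uniqueness P ext) (auto simp: char s F)
    show ?thesis
    proof (rule measure_eqI)
      fix A assume "A \<in> sets \<nu>"
      then have "emeasure (?P N) A = ennreal (1 / m) * emeasure N A" if "sets N = sets borel" for N
        using that s by (intro emeasure_density_const) simp
      then have "ennreal (1 / m) * emeasure \<nu> A = ennreal (1 / m) * emeasure \<nu>' A"
        using \<open>?P \<nu> = ?P \<nu>'\<close> s by metis
      then have "ennreal m * (ennreal (1 / m) * emeasure \<nu> A) = ennreal m * (ennreal (1 / m) * emeasure \<nu>' A)"
        by simp
      then show "emeasure \<nu> A = emeasure \<nu>' A"
        using m by (simp add: mult.assoc[symmetric] ennreal_mult[symmetric])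
    qed (simp add: s)
  qed
qed

text \<open>The weight exp(-x^2/2) damps every exponential, and the weighted input law has the
  Laplace transform \<open>pY a \<mu> / phi a\<close>. Being positive, the weight is undone by a
  second density.\<close>

lemma pY_inject:
  assumes i: "input_dist \<mu>" "input_dist \<nu>" and eq: "(\<lambda>y. pY y \<mu>) = (\<lambda>y. pY y \<nu>)"
  shows "\<mu> = \<nu>"
proof -
  let ?d = "\<lambda>\<mu>. density \<mu> (\<lambda>x. ennreal (exp (- x\<^sup>2 / 2)))"
  have L: "integrable (?d \<mu>) (\<lambda>x. exp (a * x))" "(\<integral>x. exp (a * x) \<partial>?d \<mu>) = pY a \<mu> / phi a"
    "density (?d \<mu>) (\<lambda>x. ennreal (exp (x\<^sup>2 / 2))) = \<mu>"
    if "input_dist \<mu>" for \<mu> and a :: real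
  proof -
    note [measurable_cong] = input_dist_simps(1)[OF that]
    have *: "exp (- (x\<^sup>2 / 2)) * exp (a * x) = phi (a - x) / phi a" for x
      using phi_pos[of a] by (simp add: phi_shift[of a x] mult_exp_exp algebra_simps)
    show "integrable (?d \<mu>) (\<lambda>x. exp (a * x))"
      by (subst integrable_density) (auto simp: * integrable_phi_input[OF that])
    show "(\<integral>x. exp (a * x) \<partial>?d \<mu>) = pY a \<mu> / phi a"
      by (subst integral_density) (auto simp: * pY_def)
    show "density (?d \<mu>) (\<lambda>x. ennreal (exp (x\<^sup>2 / 2))) = \<mu>"
      by (subst density_density_eq) (auto simp: ennreal_mult[symmetric] mult_exp_exp density_1)
  qed
  have "?d \<mu> = ?d \<nu>"
    by (rule laplace_transform_unique) (use L[OF i(1)] L[OF i(2)] fun_cong[OF eq] i in \<open>auto simp: input_dist_simps\<close>)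
  then show ?thesis
    using L(3)[OF i(1)] L(3)[OF i(2)] by metis
qed

text \<open>The tilting identity read on the output side: Gaussian smoothing of f is exp(-a^2/2)
  times the Laplace transform of the measure with density \<open>phi y * f y\<close>.\<close>

lemma gauss_weighted_laplace:
  fixes f :: "real \<Rightarrow> real"
  assumes [measurable]: "f \<in> borel_measurable borel" and nn: "\<And>y. 0 \<le> f y"
    and int: "\<And>x. integrable gauss (\<lambda>z. f (x + z))"
  defines "\<nu> \<equiv> density lborel (\<lambda>y. ennreal (phi y * f y))"
  shows "integrable \<nu> (\<lambda>x. exp (a * x))"
    and "(\<integral>x. exp (a * x) \<partial>\<nu>) = exp (a\<^sup>2 / 2) * (\<integral>z. f (a + z) \<partial>gauss)"
proof -
  have *: "phi y * f y * exp (a * y) = exp (a\<^sup>2 / 2) * (phi (y - a) * f y)" for y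
    by (simp add: phi_shift[of y a] mult_exp_exp)
  have "integrable lborel (\<lambda>z. phi z * f (a + z))"
    using int[of a] unfolding gauss_def by (subst (asm) integrable_density) auto
  then have "integrable lborel (\<lambda>y. phi (y - a) * f y)"
    using lborel_integrable_real_affine_iff[of 1 "\<lambda>y. phi (y - a) * f y" a] by simp
  then show "integrable \<nu> (\<lambda>x. exp (a * x))"
    unfolding \<nu>_def by (subst integrable_density) (auto simp: nn *)
  show "(\<integral>x. exp (a * x) \<partial>\<nu>) = exp (a\<^sup>2 / 2) * (\<integral>z. f (a + z) \<partial>gauss)"
    unfolding \<nu>_def by (subst integral_density) (auto simp: nn * integral_phi_shift)
qed

lemma gauss_convolution_entire:
  fixes f :: "real \<Rightarrow> real"
  assumes [measurable]: "f \<in> borel_measurable borel" and nn: "\<And>y. 0 \<le> f y"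
    and int: "\<And>x. integrable gauss (\<lambda>z. f (x + z))"
  obtains F where "F holomorphic_on UNIV"
    "\<And>x. F (complex_of_real x) = complex_of_real (\<integral>z. f (x + z) \<partial>gauss)"
proof
  let ?\<nu> = "density lborel (\<lambda>y. ennreal (phi y * f y))"
  let ?F = "\<lambda>z. exp (- (z\<^sup>2) / 2) * (\<integral>x. exp (z * complex_of_real x) \<partial>?\<nu>)"
  show "?F holomorphic_on UNIV"
    by (intro holomorphic_intros laplace_transform_entire gauss_weighted_laplace(1) assms) auto
  fix x :: real
  have "(\<integral>y. exp (complex_of_real x * complex_of_real y) \<partial>?\<nu>) = complex_of_real (\<integral>y. exp (x * y) \<partial>?\<nu>)"
    by (simp flip: of_real_mult of_real_exp)
  also have "\<dots> = complex_of_real (exp (x\<^sup>2 / 2) * (\<integral>z. f (x + z) \<partial>gauss))"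
    by (subst gauss_weighted_laplace(2)) (auto intro: assms)
  finally show "?F (complex_of_real x) = complex_of_real (\<integral>z. f (x + z) \<partial>gauss)"
    by (simp add: exp_minus field_simps flip: exp_of_real)
qed

text \<open>Nonnegativity makes \<open>phi y * f y\<close> and \<open>phi y * g y\<close> densities
  of measures, so that uniqueness of Laplace transforms applies; a function bounded below can first
  be raised by a constant.\<close>

lemma gauss_deconvolution:
  fixes f g :: "real \<Rightarrow> real"
  assumes [measurable]: "f \<in> borel_measurable borel" "g \<in> borel_measurable borel"
    and nn: "\<And>y. 0 \<le> f y" "\<And>y. 0 \<le> g y"
    and int: "\<And>x. integrable gauss (\<lambda>z. f (x + z))" "\<And>x. integrable gauss (\<lambda>z. g (x + z))"
    and eq: "\<And>x. (\<integral>z. f (x + z) \<partial>gauss) = (\<integral>z. g (x + z) \<partial>gauss)"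
  shows "AE y in lborel. f y = g y"
proof -
  let ?\<nu> = "\<lambda>f. density lborel (\<lambda>y. ennreal (phi y * f y))"
  have "?\<nu> f = ?\<nu> g"
    by (rule laplace_transform_unique)
       (simp_all add: gauss_weighted_laplace assms)
  then have "AE y in lborel. ennreal (phi y * f y) = ennreal (phi y * g y)"
    by (intro sigma_finite_measure.density_unique[OF lborel.sigma_finite_measure_axioms]) auto
  then show ?thesis
  proof eventually_elim
    case (elim y)
    then have "phi y * f y = phi y * g y"
      by (subst (asm) ennreal_inj) (auto simp: nn)
    then show ?case using phi_pos[of y] by simp
  qed
qed

section \<open>Existence and uniqueness of the maximizer\<close>

text \<open>The Bochner integral of a non-integrable function is 0, so the power bound in real form
  carries meaning only together with \<open>finite_power\<close>; the bound on the nonnegative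
  integral supplies both.\<close>

lemma Lambda_iff:
  assumes "0 < q" "0 \<le> \<gamma>"
  shows "\<mu> \<in> Lambda \<gamma> q \<longleftrightarrow> \<mu> \<in> atomic_input q \<and> finite_power \<mu> \<and> (\<integral>x. x\<^sup>2 \<partial>\<mu>) \<le> \<gamma>"
proof -
  have "(\<integral>\<^sup>+ x. ennreal (x\<^sup>2) \<partial>\<mu>) \<le> ennreal \<gamma> \<longleftrightarrow> finite_power \<mu> \<and> (\<integral>x. x\<^sup>2 \<partial>\<mu>) \<le> \<gamma>"
    if i: "input_dist \<mu>"
  proof
    assume le: "(\<integral>\<^sup>+ x. ennreal (x\<^sup>2) \<partial>\<mu>) \<le> ennreal \<gamma>"
    then have "(\<integral>\<^sup>+ x. ennreal (x\<^sup>2) \<partial>\<mu>) < \<infinity>"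
      by (rule order_le_less_trans) simp
    then have fp: "finite_power \<mu>" using i by (simp add: finite_power_iff)
    then have "ennreal (\<integral>x. x\<^sup>2 \<partial>\<mu>) \<le> ennreal \<gamma>"
      using le unfolding finite_power_def by (subst (asm) nn_integral_eq_integral) auto
    with fp show "finite_power \<mu> \<and> (\<integral>x. x\<^sup>2 \<partial>\<mu>) \<le> \<gamma>"
      using assms by simp
  next
    assume "finite_power \<mu> \<and> (\<integral>x. x\<^sup>2 \<partial>\<mu>) \<le> \<gamma>"
    then show "(\<integral>\<^sup>+ x. ennreal (x\<^sup>2) \<partial>\<mu>) \<le> ennreal \<gamma>"
      unfolding finite_power_def by (subst nn_integral_eq_integral) (auto intro: ennreal_leI)
  qed
  then show ?thesis
    using assms by (auto simp: Lambda_def atomic_input_def finite_power_def)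
qed

lemma second_moment_mix:
  assumes t: "0 \<le> t" "t \<le> 1" and f: "finite_power \<mu>" "finite_power \<nu>"
  shows "(\<integral>x. x\<^sup>2 \<partial>mix t \<mu> \<nu>) = (1 - t) * (\<integral>x. x\<^sup>2 \<partial>\<mu>) + t * (\<integral>x. x\<^sup>2 \<partial>\<nu>)"
proof -
  have eq: "ennreal (\<integral>x. x\<^sup>2 \<partial>N) = (\<integral>\<^sup>+x. ennreal (x\<^sup>2) \<partial>N)" if "finite_power N" for N
    using that by (intro nn_integral_eq_integral[symmetric]) (auto simp: finite_power_def)
  have "ennreal (\<integral>x. x\<^sup>2 \<partial>mix t \<mu> \<nu>)
    = ennreal (1 - t) * ennreal (\<integral>x. x\<^sup>2 \<partial>\<mu>) + ennreal t * ennreal (\<integral>x. x\<^sup>2 \<partial>\<nu>)"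
    unfolding eq[OF f(1)] eq[OF f(2)] eq[OF finite_power_mix[OF t f]]
    using t f by (intro nn_integral_mix finite_powerD) auto
  also have "\<dots> = ennreal ((1 - t) * (\<integral>x. x\<^sup>2 \<partial>\<mu>) + t * (\<integral>x. x\<^sup>2 \<partial>\<nu>))"
    using t by (simp add: ennreal_mult)
  finally have "ennreal (\<integral>x. x\<^sup>2 \<partial>mix t \<mu> \<nu>) = ennreal ((1 - t) * (\<integral>x. x\<^sup>2 \<partial>\<mu>) + t * (\<integral>x. x\<^sup>2 \<partial>\<nu>))" .
  then show ?thesis
    using t by (subst (asm) ennreal_inj) auto
qed

lemma second_moment_return: "(\<integral>x. x\<^sup>2 \<partial>return borel a) = (a::real)\<^sup>2"
  by (simp add: integral_return)

lemma return_0_in_atomic_input: "0 < q \<Longrightarrow> q \<le> 1 \<Longrightarrow> return borel 0 \<in> atomic_input q"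
  by (simp add: atomic_input_def measure_return)

text \<open>Bounds \<open>MI\<close> above on \<open>Lambda \<gamma> q\<close>, so that the supremum
  in the existence proof is a genuine one.\<close>

lemma MI_le_power:
  assumes "\<mu> \<in> atomic_input q" "finite_power \<mu>"
  shows "MI \<mu> \<le> (\<integral>x. x\<^sup>2 \<partial>\<mu>) / 2 + (1 / 2 + ln (sqrt (2 * pi)) - ln q) - noise_entropy"
proof -
  interpret prob_space \<mu> using assms by (simp add: input_dist_def atomic_input_def)
  have int: "integrable \<mu> (\<lambda>x. x\<^sup>2)" using assms by (simp add: finite_power_def)
  have "cross_entropy \<mu> \<mu> \<le> (\<integral>x. x\<^sup>2 / 2 + (1 / 2 + ln (sqrt (2 * pi)) - ln q) \<partial>\<mu>)"
    unfolding integral_cross[OF assms(2,1), symmetric]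
    by (intro integral_mono integrable_cross_input[OF assms(2,1)] cross_le[OF assms(1)])
       (use int in auto)
  also have "\<dots> = (\<integral>x. x\<^sup>2 \<partial>\<mu>) / 2 + (1 / 2 + ln (sqrt (2 * pi)) - ln q)"
    using int by (subst Bochner_Integration.integral_add) (auto simp: prob_space)
  finally show ?thesis by (simp add: MI_eq_cross_entropy[OF assms(2,1)])
qed

text \<open>Polynomial decay is given away on purpose: the factor 1 + x^2 can be integrated against
  any law of finite power, which yields one tail bound for all admissible outputs.\<close>

lemma phi_decay: "phi (y - x) \<le> 4 * (1 + x\<^sup>2) / (1 + y\<^sup>2)"
proof -
  define t where "t = y - x"
  have "1 + t\<^sup>2 / 2 \<le> exp (t\<^sup>2 / 2)" by (rule exp_ge_add_one_self)
  then have "exp (- (t\<^sup>2) / 2) \<le> 1 / (1 + t\<^sup>2 / 2)"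
    by (simp add: exp_minus field_simps add_pos_nonneg)
  also have "\<dots> \<le> 2 / (1 + t\<^sup>2)"
    by (simp add: divide_simps add_pos_nonneg)
  finally have "exp (- (t\<^sup>2) / 2) \<le> 2 / (1 + t\<^sup>2)" .
  moreover have "phi t \<le> exp (- (t\<^sup>2) / 2)"
    unfolding phi_def using sqrt_2pi_gt_1
    by (smt (verit) divide_le_eq_1_pos exp_gt_zero mult_left_le divide_inverse inverse_eq_divide)
  moreover have "2 / (1 + t\<^sup>2) \<le> 4 * (1 + x\<^sup>2) / (1 + y\<^sup>2)"
  proof -
    \<comment> \<open>As y = x + t, this square yields y^2 \<le> 2 x^2 + 2 t^2.\<close>
    have "0 \<le> (x - t)\<^sup>2" by simp
    then have "1 + y\<^sup>2 \<le> 1 + 2 * x\<^sup>2 + 2 * t\<^sup>2"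
      by (simp add: t_def power2_eq_square algebra_simps)
    also have "\<dots> \<le> 2 * ((1 + x\<^sup>2) * (1 + t\<^sup>2))"
      by (simp add: algebra_simps)
    finally have "2 * (1 + y\<^sup>2) \<le> 4 * (1 + x\<^sup>2) * (1 + t\<^sup>2)"
      by (simp add: algebra_simps)
    then show ?thesis by (simp add: divide_simps add_pos_nonneg)
  qed
  ultimately show ?thesis by (simp add: t_def)
qed

lemma pY_decay:
  assumes "finite_power \<mu>"
  shows "pY y \<mu> \<le> 4 * (1 + (\<integral>x. x\<^sup>2 \<partial>\<mu>)) / (1 + y\<^sup>2)"
proof -
  interpret prob_space \<mu> using assms by (simp add: input_dist_def finite_power_def)
  have int: "integrable \<mu> (\<lambda>x. x\<^sup>2)" using assms by (simp add: finite_power_def)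
  have "pY y \<mu> \<le> (\<integral>x. 4 / (1 + y\<^sup>2) * (1 + x\<^sup>2) \<partial>\<mu>)"
    unfolding pY_def
    by (intro integral_mono integrable_phi_input finite_powerD assms)
       (use int phi_decay in auto)
  also have "\<dots> = 4 / (1 + y\<^sup>2) * (1 + (\<integral>x. x\<^sup>2 \<partial>\<mu>))"
    using int by (simp add: prob_space)
  finally show ?thesis by simp
qed

text \<open>From - ln p \<le> 4 p^(-1/4) the entropy integrand is at most 4 p^(3/4). The loss of 1/4
  is affordable because (1 + y^2)^(-s) is integrable for every s > 1/2.\<close>

lemma entropy_term_bound:
  fixes p K y :: real
  assumes "0 < p" "p \<le> K / (1 + y\<^sup>2)"
  shows "p * - ln p \<le> 4 * K powr (3/4) * (1 + y\<^sup>2) powr (-3/4)"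
proof -
  have y: "0 < 1 + y\<^sup>2" by (simp add: add_pos_nonneg)
  have "0 < K / (1 + y\<^sup>2)" using assms by linarith
  then have K: "0 < K" using y by (simp add: zero_less_divide_iff)
  have "ln (p powr (- 1/4)) \<le> p powr (- 1/4) - 1"
    using assms by (intro ln_le_minus_one) auto
  then have "- ln p \<le> 4 * p powr (- 1/4)"
    using assms by (simp add: ln_powr)
  then have "p * - ln p \<le> p * (4 * p powr (- 1/4))"
    using assms by (intro mult_left_mono) auto
  also have "\<dots> = 4 * (p powr 1 * p powr (- 1/4))"
    using assms by simp
  also have "\<dots> = 4 * p powr (3/4)"
    unfolding powr_add[symmetric] by simp
  also have "\<dots> \<le> 4 * (K / (1 + y\<^sup>2)) powr (3/4)"
    using assms by (intro mult_left_mono powr_mono2) auto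
  also have "\<dots> = 4 * K powr (3/4) * (1 + y\<^sup>2) powr (-3/4)"
  proof -
    have "(K / (1 + y\<^sup>2)) powr (3/4) = K powr (3/4) / (1 + y\<^sup>2) powr (3/4)"
      by (rule powr_divide)
    moreover have "(1 + y\<^sup>2) powr (-3/4) = inverse ((1 + y\<^sup>2) powr (3/4))"
      using powr_minus[of "1 + y\<^sup>2" "3/4"] by simp
    ultimately show ?thesis by (simp only: divide_inverse mult.assoc)
  qed
  finally show ?thesis .
qed

text \<open>Since (1 + |y|)^2 \<le> 2 (1 + y^2), comparison is with (1 + y)^(-3/2) on a half line,
  whose primitive is -2 (1 + y)^(-1/2); the other half is its mirror image.\<close>

lemma integrable_power_decay: "integrable lborel (\<lambda>y::real. (1 + y\<^sup>2) powr (-3/4))"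
proof (rule integrableI_nonneg)
  let ?f = "\<lambda>y::real. (1 + y) powr (-3/2)"
  have "(\<integral>\<^sup>+y. ennreal (?f y) * indicator {0..} y \<partial>lborel)
      = ennreal (0 - (- 2 * (1 + 0) powr (- 1/2)))"
  proof (rule nn_integral_FTC_atLeast)
    show "((\<lambda>y. - 2 * (1 + y) powr (- 1/2)) has_real_derivative ?f x) (at x)" if "0 \<le> x" for x :: real
      using that by (auto intro!: derivative_eq_intros)
    show "((\<lambda>y::real. - 2 * (1 + y) powr (- 1/2)) \<longlongrightarrow> 0) at_top"
    proof -
      have "((\<lambda>y::real. (1 + y) powr (- 1/2)) \<longlongrightarrow> 0) at_top"
        by (intro tendsto_neg_powr filterlim_tendsto_add_at_top[OF tendsto_const] filterlim_ident) simp
      from tendsto_mult[OF tendsto_const this, of "- 2"] show ?thesis by simp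
    qed
  qed auto
  then have half: "(\<integral>\<^sup>+y. ennreal (?f y) * indicator {0..} y \<partial>lborel) < \<infinity>"
    by simp
  have half': "(\<integral>\<^sup>+y. ennreal (?f (- y)) * indicator {0..} (- y) \<partial>lborel) < \<infinity>"
    using half by (subst (asm) nn_integral_real_affine[where c = "- 1" and t = 0]) auto
  have bound: "ennreal ((1 + y\<^sup>2) powr (-3/4))
      \<le> 2 * (ennreal (?f y) * indicator {0..} y) + 2 * (ennreal (?f (- y)) * indicator {0..} (- y))" for y :: real
  proof -
    have "0 \<le> (1 - \<bar>y\<bar>)\<^sup>2" by simp
    then have "(1 + \<bar>y\<bar>)\<^sup>2 / 2 \<le> 1 + y\<^sup>2"
      by (simp add: power2_eq_square algebra_simps abs_mult_self_eq)
    then have "(1 + y\<^sup>2) powr (-3/4) \<le> ((1 + \<bar>y\<bar>)\<^sup>2 / 2) powr (-3/4)"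
      by (intro powr_mono2') auto
    also have "\<dots> = 2 powr (3/4) * ((1 + \<bar>y\<bar>) powr 2) powr (-3/4)"
    proof -
      have "((1 + \<bar>y\<bar>)\<^sup>2 / 2) powr (-3/4) = ((1 + \<bar>y\<bar>)\<^sup>2) powr (-3/4) / 2 powr (-3/4)"
        by (rule powr_divide)
      moreover have "(2::real) powr (-3/4) = inverse (2 powr (3/4))"
        using powr_minus[of "2::real" "3/4"] by simp
      moreover have "(1 + \<bar>y\<bar>)\<^sup>2 = (1 + \<bar>y\<bar>) powr 2"
        by simp
      ultimately show ?thesis by (simp only: divide_inverse inverse_inverse_eq mult.commute)
    qed
    also have "\<dots> = 2 powr (3/4) * ?f \<bar>y\<bar>"
      unfolding powr_powr by simp
    also have "\<dots> \<le> 2 powr 1 * ?f \<bar>y\<bar>"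
      by (intro mult_right_mono powr_mono) auto
    finally have "(1 + y\<^sup>2) powr (-3/4) \<le> 2 * ?f \<bar>y\<bar>" by simp
    then have "ennreal ((1 + y\<^sup>2) powr (-3/4)) \<le> ennreal (2 * ?f \<bar>y\<bar>)"
      by (rule ennreal_leI)
    also have "\<dots> = 2 * ennreal (?f \<bar>y\<bar>)"
      by (simp add: ennreal_mult)
    also have "\<dots> \<le> 2 * (ennreal (?f y) * indicator {0..} y) + 2 * (ennreal (?f (- y)) * indicator {0..} (- y))"
      by (cases "y \<ge> 0") (auto simp: indicator_def)
    finally show ?thesis .
  qed
  have "(\<integral>\<^sup>+y. ennreal ((1 + y\<^sup>2) powr (-3/4)) \<partial>lborel)
    \<le> (\<integral>\<^sup>+y. 2 * (ennreal (?f y) * indicator {0..} y) + 2 * (ennreal (?f (- y)) * indicator {0..} (- y)) \<partial>lborel)"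
    by (intro nn_integral_mono bound)
  also have "\<dots> = 2 * (\<integral>\<^sup>+y. ennreal (?f y) * indicator {0..} y \<partial>lborel)
      + 2 * (\<integral>\<^sup>+y. ennreal (?f (- y)) * indicator {0..} (- y) \<partial>lborel)"
    by (subst nn_integral_add) (auto simp: nn_integral_cmult)
  also have "\<dots> < \<infinity>"
    using half half' by (auto simp: ennreal_mult_less_top)
  finally show "(\<integral>\<^sup>+y. ennreal ((1 + y\<^sup>2) powr (-3/4)) \<partial>lborel) < \<infinity>" .
qed auto

section \<open>Weak limits of admissible laws\<close>

context
  fixes \<gamma> q :: real and M :: "nat \<Rightarrow> real measure" and \<mu> :: "real measure"
  assumes \<gamma>: "0 \<le> \<gamma>" and q: "0 < q"
    and M: "\<And>n. M n \<in> Lambda \<gamma> q" and \<mu>: "input_dist \<mu>" and conv: "weak_conv_m M \<mu>"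
begin

lemma weak_conv_integral:
  fixes f :: "real \<Rightarrow> real"
  assumes "continuous_on UNIV f" "\<And>x. \<bar>f x\<bar> \<le> B"
  shows "(\<lambda>n. \<integral>x. f x \<partial>M n) \<longlonglongrightarrow> (\<integral>x. f x \<partial>\<mu>)"
proof (rule weak_conv_imp_integral_bdd_continuous_conv[where B = B])
  show "real_distribution (M n)" for n
    using M[of n] by (simp add: Lambda_def input_dist_real_distribution)
qed (use assms \<mu> conv in \<open>auto simp: input_dist_real_distribution continuous_on_eq_continuous_at\<close>)

text \<open>In a weak limit mass cannot leave the closed set {0}, and power can only be lost. Both
  facts are read off from bounded continuous test functions.\<close>

lemma weak_limit_in_Lambda: "\<mu> \<in> Lambda \<gamma> q"
proof -
  note [measurable_cong] = input_dist_simps(1)[OF \<mu>]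
  interpret prob_space \<mu> using \<mu> by (simp add: input_dist_def)
  have atom: "q \<le> measure \<mu> {0}"
  proof -
    \<comment> \<open>Continuous tents above the indicator of {0} that shrink to it: each has mean
      at least q under every \<open>M n\<close>, hence under the limit.\<close>
    let ?f = "\<lambda>(k::nat) x::real. max 0 (1 - real k * \<bar>x\<bar>)"
    have "q \<le> (\<integral>x. ?f k x \<partial>\<mu>)" for k
    proof (rule LIMSEQ_le_const)
      show "(\<lambda>n. \<integral>x. ?f k x \<partial>M n) \<longlonglongrightarrow> (\<integral>x. ?f k x \<partial>\<mu>)"
        by (rule weak_conv_integral[where B = 1]) (auto intro!: continuous_intros)
      have "q \<le> (\<integral>x. ?f k x \<partial>M n)" for n
      proof -
        have i: "input_dist (M n)" "q \<le> measure (M n) {0}" using M[of n] by (auto simp: Lambda_def)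
        note [measurable_cong] = input_dist_simps(1)[OF i(1)]
        interpret Mn: prob_space "M n" using i by (simp add: input_dist_def)
        have "q \<le> (\<integral>x. indicator {0} x \<partial>M n)" using i by simp
        also have "\<dots> \<le> (\<integral>x. ?f k x \<partial>M n)"
        proof (rule integral_mono)
          show "integrable (M n) (?f k)"
            by (rule Mn.integrable_const_bound[where B = 1]) auto
        qed (auto simp: Mn.emeasure_eq_measure split: split_indicator intro!: integrable_real_indicator)
        finally show ?thesis .
      qed
      then show "\<exists>N. \<forall>n\<ge>N. q \<le> (\<integral>x. ?f k x \<partial>M n)" by blast
    qed
    moreover have "(\<lambda>k. \<integral>x. ?f k x \<partial>\<mu>) \<longlonglongrightarrow> (\<integral>x. indicator {0} x \<partial>\<mu>)"
    proof (rule integral_dominated_convergence[where w = "\<lambda>_. 1"])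
      have "(\<lambda>k. ?f k x) \<longlonglongrightarrow> indicator {0} x" for x :: real
      proof (cases "x = 0")
        case False
        obtain N :: nat where N: "1 / \<bar>x\<bar> < real N" using reals_Archimedean2 by blast
        have "\<forall>k\<ge>N. ?f k x = 0"
        proof (intro allI impI)
          fix k assume "N \<le> k"
          then have "1 / \<bar>x\<bar> < real k" using N by (meson less_le_trans of_nat_le_iff)
          then show "?f k x = 0" using False by (simp add: field_simps)
        qed
        then have "eventually (\<lambda>k. ?f k x = 0) sequentially"
          by (auto simp: eventually_sequentially)
        then show ?thesis using False by (simp add: tendsto_eventually)
      qed simp
      then show "AE x in \<mu>. (\<lambda>k. ?f k x) \<longlonglongrightarrow> indicator {0} x" by simp
    qed auto
    ultimately show ?thesis
      by (intro LIMSEQ_le_const[where X = "\<lambda>k. \<integral>x. ?f k x \<partial>\<mu>"]) auto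
  qed
  have pow: "(\<integral>\<^sup>+ x. ennreal (x\<^sup>2) \<partial>\<mu>) \<le> ennreal \<gamma>"
  proof -
    \<comment> \<open>Bounded truncations of x^2. The limit in n is taken for fixed k, and k grows
      afterwards by monotone convergence.\<close>
    let ?f = "\<lambda>(k::nat) x::real. min (real k) (x\<^sup>2)"
    have intf: "integrable N (?f k)" if "input_dist N" for N k
    proof -
      note [measurable_cong] = input_dist_simps(1)[OF that]
      interpret N: prob_space N using that by (simp add: input_dist_def)
      show ?thesis by (rule N.integrable_const_bound[where B = "real k"]) auto
    qed
    have "(\<integral>x. ?f k x \<partial>\<mu>) \<le> \<gamma>" for k
    proof (rule LIMSEQ_le_const2)
      show "(\<lambda>n. \<integral>x. ?f k x \<partial>M n) \<longlonglongrightarrow> (\<integral>x. ?f k x \<partial>\<mu>)"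
        by (rule weak_conv_integral[where B = "real k"]) (auto intro!: continuous_intros)
      have "(\<integral>x. ?f k x \<partial>M n) \<le> \<gamma>" for n
      proof -
        have "finite_power (M n)" "(\<integral>x. x\<^sup>2 \<partial>M n) \<le> \<gamma>"
          using M[of n] Lambda_iff[OF q \<gamma>] by auto
        then show ?thesis
          by (intro order_trans[OF integral_mono[OF intf]]) (auto simp: finite_power_def)
      qed
      then show "\<exists>N. \<forall>n\<ge>N. (\<integral>x. ?f k x \<partial>M n) \<le> \<gamma>" by blast
    qed
    then have le: "(\<integral>\<^sup>+x. ennreal (?f k x) \<partial>\<mu>) \<le> ennreal \<gamma>" for k
      by (subst nn_integral_eq_integral[OF intf[OF \<mu>]]) (auto intro: ennreal_leI)
    have "(\<integral>\<^sup>+ x. ennreal (x\<^sup>2) \<partial>\<mu>) = (\<integral>\<^sup>+ x. (SUP k. ennreal (?f k x)) \<partial>\<mu>)"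
    proof (intro nn_integral_cong antisym)
      fix x :: real
      obtain k :: nat where "x\<^sup>2 < real k" using reals_Archimedean2 by blast
      then have "ennreal (x\<^sup>2) = ennreal (?f k x)" by simp
      also have "\<dots> \<le> (SUP k. ennreal (?f k x))" by (rule SUP_upper) simp
      finally show "ennreal (x\<^sup>2) \<le> (SUP k. ennreal (?f k x))" .
      show "(SUP k. ennreal (?f k x)) \<le> ennreal (x\<^sup>2)"
        by (intro SUP_least ennreal_leI) simp
    qed
    also have "\<dots> = (SUP k. \<integral>\<^sup>+x. ennreal (?f k x) \<partial>\<mu>)"
      by (rule nn_integral_monotone_convergence_SUP)
         (auto simp: incseq_def le_fun_def intro!: ennreal_leI min.mono)
    also have "\<dots> \<le> ennreal \<gamma>"
      by (intro SUP_least le)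
    finally show ?thesis .
  qed
  show ?thesis
    using \<mu> atom pow by (simp add: Lambda_def)
qed

text \<open>Output densities converge pointwise because x \<mapsto> phi(y - x) is bounded and
  continuous. The common power bound makes the majorant of \<open>entropy_term_bound\<close>
  independent of n.\<close>

lemma MI_weak_continuous: "(\<lambda>n. MI (M n)) \<longlonglongrightarrow> MI \<mu>"
proof -
  have N: "N \<in> atomic_input q" "finite_power N" "(\<integral>x. x\<^sup>2 \<partial>N) \<le> \<gamma>" if "N \<in> Lambda \<gamma> q" for N
    using that Lambda_iff[OF q \<gamma>] by auto
  note \<mu>' = N[OF weak_limit_in_Lambda]
  note M' = N[OF M]
  note [measurable] = measurable_pY[OF \<mu>] measurable_pY[OF finite_powerD[OF M'(2)]]
  have p: "(\<lambda>n. pY y (M n)) \<longlonglongrightarrow> pY y \<mu>" for y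
    unfolding pY_def
    by (rule weak_conv_integral[where B = 1]) (auto intro!: continuous_intros simp: phi_le_1)
  have "(\<lambda>n. LBINT y. pY y (M n) * - ln (pY y (M n))) \<longlonglongrightarrow> (LBINT y. pY y \<mu> * - ln (pY y \<mu>))"
  proof (rule integral_dominated_convergence[where w = "\<lambda>y. 4 * (4 * (1 + \<gamma>)) powr (3/4) * (1 + y\<^sup>2) powr (-3/4)"])
    show "AE y in lborel. (\<lambda>n. pY y (M n) * - ln (pY y (M n))) \<longlonglongrightarrow> pY y \<mu> * - ln (pY y \<mu>)"
      by (intro AE_I2 tendsto_intros p pY_pos[OF \<mu>, THEN less_imp_neq, symmetric])
    show "AE y in lborel. norm (pY y (M n) * - ln (pY y (M n))) \<le> 4 * (4 * (1 + \<gamma>)) powr (3/4) * (1 + y\<^sup>2) powr (-3/4)" for n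
    proof (rule AE_I2)
      fix y :: real
      have i: "input_dist (M n)" using M' by (auto intro: finite_powerD)
      have "pY y (M n) \<le> 4 * (1 + (\<integral>x. x\<^sup>2 \<partial>M n)) / (1 + y\<^sup>2)" by (rule pY_decay[OF M'(2)])
      also have "\<dots> \<le> 4 * (1 + \<gamma>) / (1 + y\<^sup>2)"
        using M'(3)[of n] by (intro divide_right_mono mult_left_mono) auto
      finally have "pY y (M n) * - ln (pY y (M n)) \<le> 4 * (4 * (1 + \<gamma>)) powr (3/4) * (1 + y\<^sup>2) powr (-3/4)"
        by (rule entropy_term_bound[OF pY_pos[OF i]])
      moreover have "0 \<le> pY y (M n) * - ln (pY y (M n))"
        by (intro mult_nonneg_nonneg pY_nonneg neg_ln_pY_nonneg i)
      ultimately show "norm (pY y (M n) * - ln (pY y (M n))) \<le> 4 * (4 * (1 + \<gamma>)) powr (3/4) * (1 + y\<^sup>2) powr (-3/4)"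
        by simp
    qed
  qed (use integrable_power_decay in auto)
  then have "(\<lambda>n. cross_entropy (M n) (M n) - noise_entropy) \<longlonglongrightarrow> cross_entropy \<mu> \<mu> - noise_entropy"
    unfolding lborel_cross_entropy(2)[OF M'(2) M'(1)] lborel_cross_entropy(2)[OF \<mu>'(2,1)]
    by (intro tendsto_intros)
  then show ?thesis
    by (simp add: MI_eq_cross_entropy[OF M'(2,1)] MI_eq_cross_entropy[OF \<mu>'(2,1)])
qed

end

lemma tight_Lambda:
  assumes "0 \<le> \<gamma>" "0 < q" "\<And>n. M n \<in> Lambda \<gamma> q"
  shows "tight M"
  unfolding tight_def
proof (intro conjI allI impI)
  have M: "input_dist (M n)" "integrable (M n) (\<lambda>x. x\<^sup>2)" "(\<integral>x. x\<^sup>2 \<partial>M n) \<le> \<gamma>" for n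
    using assms(3)[of n] Lambda_iff[OF assms(2,1)] by (auto simp: finite_power_def)
  show "real_distribution (M n)" for n
    using M(1) by (simp add: input_dist_real_distribution)
  fix e :: real assume e: "0 < e"
  \<comment> \<open>The constants are those of Chebyshev's inequality; the added 1 makes e a^2
    exceed \<gamma> strictly and keeps a positive when \<gamma> = 0.\<close>
  define a where "a = sqrt (\<gamma> / e + 1)"
  have a2: "a\<^sup>2 = \<gamma> / e + 1" and a: "0 < a"
    using assms(1) e by (auto simp: a_def add_nonneg_pos)
  have "1 - e < measure (M n) {-a<..a}" for n
  proof -
    note [measurable_cong] = input_dist_simps(1)[OF M(1)[of n]]
    interpret prob_space "M n" using M(1)[of n] by (simp add: input_dist_def)
    have "measure (M n) (UNIV - {-a<..a}) * a\<^sup>2 = (\<integral>x. indicator (UNIV - {-a<..a}) x * a\<^sup>2 \<partial>M n)"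
      using input_dist_simps(2)[OF M(1)[of n]] by simp
    also have "\<dots> \<le> (\<integral>x. x\<^sup>2 \<partial>M n)"
    proof (rule integral_mono)
      show "integrable (M n) (\<lambda>x. indicator (UNIV - {-a<..a}) x * a\<^sup>2)"
        by (intro integrable_mult_left integrable_real_indicator) (auto simp: emeasure_eq_measure)
      fix x
      show "indicator (UNIV - {-a<..a}) x * a\<^sup>2 \<le> x\<^sup>2"
        using a by (auto simp: abs_le_square_iff[symmetric] split: split_indicator)
    qed (rule M)
    also have "\<dots> \<le> \<gamma>" by (rule M)
    finally have "measure (M n) (UNIV - {-a<..a}) * a\<^sup>2 \<le> \<gamma>" .
    moreover have "\<gamma> < e * a\<^sup>2" using e by (simp add: a2 field_simps)
    ultimately have "measure (M n) (UNIV - {-a<..a}) * a\<^sup>2 < e * a\<^sup>2" by simp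
    then have "measure (M n) (UNIV - {-a<..a}) < e" using a by simp
    then show ?thesis
      using prob_compl[of "{-a<..a}"] input_dist_simps(2)[OF M(1)[of n]] by simp
  qed
  then show "\<exists>a b. a < b \<and> (\<forall>n. 1 - e < measure (M n) {a<..b})"
    using a by (intro exI[of _ "- a"] exI[of _ a]) auto
qed

lemma MI_maximizer_exists:
  assumes "0 \<le> \<gamma>" "0 < q" "q \<le> 1"
  obtains \<mu> where "\<mu> \<in> Lambda \<gamma> q" "\<And>\<nu>. \<nu> \<in> Lambda \<gamma> q \<Longrightarrow> MI \<nu> \<le> MI \<mu>"
proof -
  let ?S = "MI ` Lambda \<gamma> q"
  have ne: "?S \<noteq> {}"
  proof -
    have "return borel 0 \<in> Lambda \<gamma> q"
      using assms return_0_in_atomic_input[of q] second_moment_return[of 0] by (simp add: Lambda_iff)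
    then show ?thesis by blast
  qed
  have bdd: "bdd_above ?S"
  proof (rule bdd_aboveI2)
    fix \<mu> assume "\<mu> \<in> Lambda \<gamma> q"
    then show "MI \<mu> \<le> \<gamma> / 2 + (1 / 2 + ln (sqrt (2 * pi)) - ln q) - noise_entropy"
      using MI_le_power[of \<mu> q] assms by (auto simp: Lambda_iff)
  qed
  have "\<exists>\<mu>. \<mu> \<in> Lambda \<gamma> q \<and> Sup ?S - 1 / real (Suc n) < MI \<mu>" for n
  proof -
    have "Sup ?S - 1 / real (Suc n) < Sup ?S" by simp
    then show ?thesis using less_cSupD[OF ne] by blast
  qed
  then obtain M where M: "\<And>n. M n \<in> Lambda \<gamma> q" "\<And>n. Sup ?S - 1 / real (Suc n) < MI (M n)"
    by metis
  have "tight M" using assms M by (intro tight_Lambda) auto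
  from tight_imp_convergent_subsubsequence[OF this strict_mono_id] obtain r \<mu> where
    r: "strict_mono (r :: nat \<Rightarrow> nat)" "real_distribution \<mu>" "weak_conv_m (M \<circ> id \<circ> r) \<mu>"
    by blast
  have \<mu>: "input_dist \<mu>" using r by (simp add: input_dist_real_distribution)
  have w: "weak_conv_m (\<lambda>n. M (r n)) \<mu>" using r(3) by (simp add: comp_def)
  have lim: "(\<lambda>n. MI (M (r n))) \<longlonglongrightarrow> MI \<mu>"
    by (rule MI_weak_continuous[OF assms(1,2) M(1) \<mu> w])
  have "Sup ?S \<le> MI \<mu>"
  proof (rule LIMSEQ_le[OF _ lim])
    have "(\<lambda>n. Sup ?S - 1 / real (Suc (r n))) \<longlonglongrightarrow> Sup ?S - 0"
      by (intro tendsto_diff tendsto_const LIMSEQ_subseq_LIMSEQ[OF _ r(1), unfolded comp_def]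
          LIMSEQ_inverse_real_of_nat[unfolded inverse_eq_divide])
    then show "(\<lambda>n. Sup ?S - 1 / real (Suc (r n))) \<longlonglongrightarrow> Sup ?S" by simp
    show "\<exists>N. \<forall>n\<ge>N. Sup ?S - 1 / real (Suc (r n)) \<le> MI (M (r n))"
      using M(2) less_imp_le by blast
  qed
  moreover have "MI \<nu> \<le> Sup ?S" if "\<nu> \<in> Lambda \<gamma> q" for \<nu>
    using that bdd by (intro cSup_upper) auto
  ultimately show ?thesis
    using that[OF weak_limit_in_Lambda[OF assms(1,2) M(1) \<mu> w]] by (meson order_trans)
qed

lemma Lambda_mix:
  assumes "0 < q" "0 \<le> \<gamma>" "0 \<le> t" "t \<le> 1" "\<mu> \<in> Lambda \<gamma> q" "\<nu> \<in> Lambda \<gamma> q"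
  shows "mix t \<mu> \<nu> \<in> Lambda \<gamma> q"
proof -
  have "(1 - t) * (\<integral>x. x\<^sup>2 \<partial>\<mu>) + t * (\<integral>x. x\<^sup>2 \<partial>\<nu>) \<le> (1 - t) * \<gamma> + t * \<gamma>"
    using assms by (intro add_mono mult_left_mono) (auto simp: Lambda_iff)
  then show ?thesis
    using assms by (auto simp: Lambda_iff atomic_input_mix finite_power_mix second_moment_mix algebra_simps)
qed

lemma MI_maximizer_unique:
  assumes "0 < q" "0 \<le> \<gamma>" "\<mu> \<in> Lambda \<gamma> q" "\<nu> \<in> Lambda \<gamma> q" "MI \<nu> = MI \<mu>"
    and max: "\<And>\<nu>. \<nu> \<in> Lambda \<gamma> q \<Longrightarrow> MI \<nu> \<le> MI \<mu>"
  shows "\<nu> = \<mu>"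
proof (rule ccontr)
  assume "\<nu> \<noteq> \<mu>"
  have a: "finite_power \<nu>" "finite_power \<mu>" "\<nu> \<in> atomic_input q" "\<mu> \<in> atomic_input q"
    using assms by (auto simp: Lambda_iff)
  have "(\<lambda>y. pY y \<nu>) \<noteq> (\<lambda>y. pY y \<mu>)"
    using pY_inject[of \<nu> \<mu>] a \<open>\<nu> \<noteq> \<mu>\<close> by (auto intro: finite_powerD)
  from MI_strictly_concave[OF a this] have "MI \<mu> < MI (mix (1/2) \<nu> \<mu>)"
    using assms by simp
  moreover have "MI (mix (1/2) \<nu> \<mu>) \<le> MI \<mu>"
    using assms by (intro max Lambda_mix) auto
  ultimately show False by simp
qed

section \<open>Optimality conditions and the support of the maximizer\<close>

text \<open>Stands in for differentiating \<open>MI\<close> along a segment: after Gibbs'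
  inequality, the one-sided derivative only requires this limit as the mixture collapses to
  \<mu>.\<close>

lemma cross_entropy_mix_tendsto:
  assumes "finite_power \<rho>" "\<mu> \<in> atomic_input q" "\<nu> \<in> atomic_input q"
  shows "(\<lambda>n. cross_entropy \<rho> (mix (1 / real (Suc n)) \<mu> \<nu>)) \<longlonglongrightarrow> cross_entropy \<rho> \<mu>"
proof -
  let ?m = "\<lambda>n. mix (1 / real (Suc n)) \<mu> \<nu>"
  have i: "input_dist \<mu>" "input_dist \<nu>" using assms by (auto intro: atomic_inputD)
  have m: "?m n \<in> atomic_input q" for n
    using assms by (intro atomic_input_mix) auto
  note [measurable] = measurable_pY[OF i(1)] measurable_pY[OF atomic_inputD[OF m]]
  interpret out: prob_space "out \<rho>" using assms by (intro prob_space_out finite_powerD)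
  show ?thesis
    unfolding cross_entropy_def
  proof (rule integral_dominated_convergence[where w = "\<lambda>y. y\<^sup>2 / 2 + (ln (sqrt (2 * pi)) - ln q)"])
    have "(\<lambda>n. - ln (pY y (?m n))) \<longlonglongrightarrow> - ln (pY y \<mu>)" for y
    proof -
      have t: "(\<lambda>n. 1 / real (Suc n)) \<longlonglongrightarrow> 0"
        using LIMSEQ_inverse_real_of_nat by (simp add: inverse_eq_divide)
      have "(\<lambda>n. (1 - 1 / real (Suc n)) * pY y \<mu> + 1 / real (Suc n) * pY y \<nu>)
          \<longlonglongrightarrow> (1 - 0) * pY y \<mu> + 0 * pY y \<nu>"
        by (intro tendsto_intros t)
      moreover have "pY y (?m n) = (1 - 1 / real (Suc n)) * pY y \<mu> + 1 / real (Suc n) * pY y \<nu>" for n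
        by (rule pY_mix) (use i in auto)
      ultimately have "(\<lambda>n. pY y (?m n)) \<longlonglongrightarrow> pY y \<mu>" by simp
      then show ?thesis
        using pY_pos[OF i(1), of y] by (intro tendsto_intros) auto
    qed
    then show "AE y in out \<rho>. (\<lambda>n. - ln (pY y (?m n))) \<longlonglongrightarrow> - ln (pY y \<mu>)" by simp
    show "AE y in out \<rho>. norm (- ln (pY y (?m n))) \<le> y\<^sup>2 / 2 + (ln (sqrt (2 * pi)) - ln q)" for n
    proof (rule AE_I2)
      fix y
      show "norm (- ln (pY y (?m n))) \<le> y\<^sup>2 / 2 + (ln (sqrt (2 * pi)) - ln q)"
        using neg_ln_pY_le[OF m[of n], of y] neg_ln_pY_nonneg[OF atomic_inputD[OF m[of n]], of y] by simp
    qed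
    show "integrable (out \<rho>) (\<lambda>y. y\<^sup>2 / 2 + (ln (sqrt (2 * pi)) - ln q))"
      using integrable_sq_out[OF assms(1)] by simp
  qed measurable
qed

lemma gauss_measure_unit_interval: "0 < measure gauss {0..1}"
proof -
  have "ennreal (phi 1) = (\<integral>\<^sup>+z. ennreal (phi 1) * indicator {0..1::real} z \<partial>lborel)"
    by (subst nn_integral_cmult_indicator) auto
  also have "\<dots> \<le> (\<integral>\<^sup>+z. ennreal (phi z) * indicator {0..1} z \<partial>lborel)"
    by (intro nn_integral_mono)
       (auto split: split_indicator simp: phi_def power_le_one intro!: ennreal_leI divide_right_mono)
  also have "\<dots> = emeasure gauss {0..1}"
    by (simp add: gauss_def emeasure_density)
  finally have "phi 1 \<le> measure gauss {0..1}"
    by (simp add: gauss.emeasure_eq_measure)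
  then show ?thesis using phi_pos[of 1] by linarith
qed

text \<open>Far out the output density is small on a whole unit interval, which the noise hits with
  fixed probability. Unboundedness is what makes the power constraint bind and its multiplier
  positive.\<close>

lemma cross_unbounded:
  assumes "\<mu> \<in> atomic_input q" "finite_power \<mu>"
  shows "\<exists>x. B < cross x \<mu>"
proof -
  have i: "input_dist \<mu>" using assms by (intro finite_powerD)
  define K where "K = 4 * (1 + (\<integral>x. x\<^sup>2 \<partial>\<mu>))"
  have K: "0 < K" unfolding K_def by (simp add: add_pos_nonneg)
  define c where "c = measure gauss {0..1}"
  have c: "0 < c" using gauss_measure_unit_interval by (simp add: c_def)
  \<comment> \<open>Solves K / x^2 = exp(-(|B| + 1) / c), so that the event z \<in> [0, 1], of
    probability c, already contributes |B| + 1.\<close>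
  define x where "x = sqrt (K * exp ((\<bar>B\<bar> + 1) / c))"
  have x: "0 \<le> x" "x\<^sup>2 = K * exp ((\<bar>B\<bar> + 1) / c)" using K by (auto simp: x_def)
  have "c * ((\<bar>B\<bar> + 1) / c) = (\<integral>z. indicator {0..1} z * ((\<bar>B\<bar> + 1) / c) \<partial>gauss)"
    by (simp add: c_def)
  also have "\<dots> \<le> cross x \<mu>"
    unfolding cross_def
  proof (intro integral_mono integrable_cross[OF assms(1)])
    show "integrable gauss (\<lambda>z. indicator {0..1} z * ((\<bar>B\<bar> + 1) / c))"
      by (intro integrable_mult_left integrable_real_indicator) (auto simp: gauss.emeasure_eq_measure)
    fix z :: real
    show "indicator {0..1} z * ((\<bar>B\<bar> + 1) / c) \<le> - ln (pY (x + z) \<mu>)"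
    proof (cases "z \<in> {0..1}")
      case True
      have "pY (x + z) \<mu> \<le> K / (1 + (x + z)\<^sup>2)"
        unfolding K_def by (rule pY_decay[OF assms(2)])
      also have "\<dots> \<le> K / x\<^sup>2"
      proof -
        have "x\<^sup>2 \<le> (x + z)\<^sup>2" using True x by (intro power_mono) auto
        then show ?thesis using K x by (intro divide_left_mono) (auto intro!: mult_pos_pos add_pos_nonneg)
      qed
      also have "\<dots> = exp (- ((\<bar>B\<bar> + 1) / c))"
        using K x by (simp add: exp_minus field_simps)
      finally have "ln (pY (x + z) \<mu>) \<le> ln (exp (- ((\<bar>B\<bar> + 1) / c)))"
        using pY_pos[OF i] by (intro ln_mono) auto
      then show ?thesis using True by simp
    qed (use neg_ln_pY_nonneg[OF i, of "x + z"] in simp)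
  qed
  finally have "\<bar>B\<bar> + 1 \<le> cross x \<mu>" using c by simp
  then show ?thesis by (intro exI[of _ x]) linarith
qed

lemma pY_distr_uminus:
  assumes "input_dist \<mu>"
  shows "pY y (distr \<mu> borel uminus) = pY (- y) \<mu>"
proof -
  note [measurable_cong] = input_dist_simps(1)[OF assms]
  have "phi (y + x) = phi (- y - x)" for x
    using phi_uminus[of "y + x"] by simp
  then show ?thesis
    unfolding pY_def by (subst integral_distr) auto
qed

lemma reflected_Lambda:
  assumes "0 < q" "0 \<le> \<gamma>" "\<mu> \<in> Lambda \<gamma> q"
  defines "\<nu> \<equiv> distr \<mu> borel uminus"
  shows "\<nu> \<in> Lambda \<gamma> q" "MI \<nu> = MI \<mu>"
proof -
  have i: "input_dist \<mu>" using assms by (simp add: Lambda_def)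
  note [measurable_cong] = input_dist_simps(1)[OF i]
  interpret prob_space \<mu> using i by (simp add: input_dist_def)
  have "input_dist \<nu>"
    unfolding input_dist_def \<nu>_def by (auto intro!: prob_space_distr)
  moreover have "measure \<nu> {0} = measure \<mu> {0}"
    unfolding \<nu>_def by (subst measure_distr) (auto simp: vimage_def input_dist_simps[OF i])
  moreover have "(\<integral>\<^sup>+ x. ennreal (x\<^sup>2) \<partial>\<nu>) = (\<integral>\<^sup>+ x. ennreal (x\<^sup>2) \<partial>\<mu>)"
    unfolding \<nu>_def by (subst nn_integral_distr) auto
  ultimately show \<nu>: "\<nu> \<in> Lambda \<gamma> q" using assms by (simp add: Lambda_def)
  have a: "finite_power \<mu>" "\<mu> \<in> atomic_input q" "finite_power \<nu>" "\<nu> \<in> atomic_input q"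
    using assms \<nu> by (auto simp: Lambda_iff)
  have "cross_entropy \<mu> \<mu> = (LBINT y. pY (- y) \<mu> * - ln (pY (- y) \<mu>))"
    unfolding lborel_cross_entropy(2)[OF a(1,2)]
    by (subst lborel_integral_real_affine[where c = "- 1" and t = 0]) auto
  also have "\<dots> = cross_entropy \<nu> \<nu>"
    unfolding lborel_cross_entropy(2)[OF a(3,4)] by (simp add: \<nu>_def pY_distr_uminus[OF i])
  finally show "MI \<nu> = MI \<mu>"
    using a by (simp add: MI_eq_cross_entropy)
qed

text \<open>Supplies the Gaussian inputs with which \<open>cross_not_quadratic\<close> identifies a
  maximizer of Gaussian output; variances add under convolution.\<close>

lemma pY_normal:
  assumes "0 < \<tau>"
  shows "input_dist (density lborel (normal_density 0 \<tau>))"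
    and "pY y (density lborel (normal_density 0 \<tau>)) = normal_density 0 (sqrt (1 + \<tau>\<^sup>2)) y"
proof -
  show i: "input_dist (density lborel (normal_density 0 \<tau>))"
    using prob_space_normal_density[OF assms, of 0] by (simp add: input_dist_def)
  have "ennreal (pY y (density lborel (normal_density 0 \<tau>)))
    = (\<integral>\<^sup>+x. ennreal (normal_density 0 1 (y - x) * normal_density 0 \<tau> x) \<partial>lborel)"
    unfolding ennreal_pY[OF i]
    by (subst nn_integral_density) (auto simp: phi_eq_std_normal ennreal_mult mult.commute)
  also have "\<dots> = ennreal (normal_density 0 (sqrt (1 + \<tau>\<^sup>2)) y)"
    using fun_cong[OF conv_normal_density_zero_mean[OF zero_less_one assms], of y] by simp
  finally show "pY y (density lborel (normal_density 0 \<tau>)) = normal_density 0 (sqrt (1 + \<tau>\<^sup>2)) y"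
    by (subst (asm) ennreal_inj) auto
qed

text \<open>Midpoint convexity of ln p(y) + y^2/2, the logarithm of a Laplace transform up to a
  constant.\<close>

lemma ln_pY_midpoint:
  assumes "input_dist \<mu>"
  shows "ln (pY y \<mu>) \<le> h\<^sup>2 / 2 + (ln (pY (y + h) \<mu>) + ln (pY (y - h) \<mu>)) / 2"
proof -
  interpret prob_space \<mu> using assms by (simp add: input_dist_def)
  define P Q where "P = pY (y + h) \<mu>" and "Q = pY (y - h) \<mu>"
  have PQ: "0 < P" "0 < Q" using pY_pos[OF assms] by (auto simp: P_def Q_def)
  define E where "E = exp (h\<^sup>2 / 2)"
  \<comment> \<open>Exactly phi(y-x)^2 = E^2 phi(y+h-x) phi(y-h-x). Before the arithmetic-geometric
    mean inequality the factors are divided by P and Q, so that each integrates to 1 over x.\<close>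
  have pt: "phi (y - x) \<le> E * sqrt (P * Q) / 2 * (phi (y + h - x) / P + phi (y - h - x) / Q)" for x
  proof -
    let ?a = "phi (y + h - x)" and ?b = "phi (y - h - x)"
    have "- ((y - x)\<^sup>2) / 2 + - ((y - x)\<^sup>2) / 2
      = h\<^sup>2 / 2 + h\<^sup>2 / 2 + (- ((y + h - x)\<^sup>2) / 2 + - ((y - h - x)\<^sup>2) / 2)"
      by (simp add: power2_eq_square field_simps)
    then have "exp (- ((y - x)\<^sup>2) / 2 + - ((y - x)\<^sup>2) / 2)
      = exp (h\<^sup>2 / 2 + h\<^sup>2 / 2 + (- ((y + h - x)\<^sup>2) / 2 + - ((y - h - x)\<^sup>2) / 2))"
      by simp
    then have "(phi (y - x))\<^sup>2 = E\<^sup>2 * (?a * ?b)"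
      unfolding exp_add phi_def E_def power2_eq_square by simp
    then have "phi (y - x) = E * sqrt (?a * ?b)"
      by (metis E_def exp_ge_zero phi_nonneg real_sqrt_mult real_sqrt_unique)
    also have "sqrt (?a * ?b) = sqrt (P * Q) * sqrt (?a / P * (?b / Q))"
      using PQ by (simp flip: real_sqrt_mult)
    also have "sqrt (?a / P * (?b / Q)) \<le> (?a / P + ?b / Q) / 2"
      using PQ by (intro arith_geo_mean_sqrt) auto
    finally show ?thesis
      using PQ by (simp add: E_def mult_left_mono field_simps)
  qed
  have int: "integrable \<mu> (\<lambda>x. phi (u - x))" for u by (rule integrable_phi_input[OF assms])
  have "pY y \<mu> \<le> (\<integral>x. E * sqrt (P * Q) / 2 * (phi (y + h - x) / P + phi (y - h - x) / Q) \<partial>\<mu>)"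
    unfolding pY_def by (intro integral_mono int pt) (use int in auto)
  also have "\<dots> = E * sqrt (P * Q) / 2 * ((\<integral>x. phi (y + h - x) \<partial>\<mu>) / P + (\<integral>x. phi (y - h - x) \<partial>\<mu>) / Q)"
    using int by simp
  also have "\<dots> = E * sqrt (P * Q)"
    using PQ by (simp add: P_def Q_def pY_def[symmetric])
  finally have "ln (pY y \<mu>) \<le> ln (E * sqrt (P * Q))"
    using pY_pos[OF assms] by (intro ln_mono) auto
  also have "\<dots> = h\<^sup>2 / 2 + (ln P + ln Q) / 2"
    using PQ by (simp add: E_def ln_mult_pos ln_sqrt)
  finally show ?thesis by (simp add: P_def Q_def)
qed

text \<open>For inputs in [-A, A] the tilting factor is at most exp(A |y|), so output tails are
  Gaussian up to that factor and c grows like x^2/2 with a linear error.\<close>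

lemma cross_ge_bounded_support:
  assumes a: "\<mu> \<in> atomic_input q" "0 \<le> A" and supp: "AE x in \<mu>. \<bar>x\<bar> \<le> A"
  shows "x\<^sup>2 / 2 - A * \<bar>x\<bar> - A \<le> cross x \<mu>"
proof -
  have i: "input_dist \<mu>" using a by (intro atomic_inputD)
  note [measurable_cong] = input_dist_simps(1)[OF i]
  interpret prob_space \<mu> using i by (simp add: input_dist_def)
  have "ln (pY y \<mu>) \<le> A * \<bar>y\<bar> - y\<^sup>2 / 2" for y
  proof -
    have "pY y \<mu> \<le> (\<integral>x. exp (A * \<bar>y\<bar>) * phi y \<partial>\<mu>)"
      unfolding pY_def
    proof (rule integral_mono_AE[OF integrable_phi_input[OF i]])
      show "AE x in \<mu>. phi (y - x) \<le> exp (A * \<bar>y\<bar>) * phi y"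
        using supp
      proof eventually_elim
        case (elim x)
        have "x * y \<le> \<bar>x\<bar> * \<bar>y\<bar>" by (metis abs_ge_self abs_mult)
        also have "\<dots> \<le> A * \<bar>y\<bar>" using elim by (intro mult_right_mono) auto
        finally have "x * y - x\<^sup>2 / 2 \<le> A * \<bar>y\<bar>"
          using zero_le_power2[of x] by linarith
        then show ?case by (simp add: phi_shift[of y x])
      qed
    qed simp
    then have "pY y \<mu> \<le> exp (A * \<bar>y\<bar>) * phi y" by (simp add: prob_space)
    then have "ln (pY y \<mu>) \<le> ln (exp (A * \<bar>y\<bar>) * phi y)"
      using pY_pos[OF i] by (intro ln_mono) auto
    also have "\<dots> \<le> A * \<bar>y\<bar> - y\<^sup>2 / 2"
      using sqrt_2pi_gt_1 by (simp add: ln_mult_pos ln_phi)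
    finally show ?thesis .
  qed
  \<comment> \<open>The bound |z| \<le> (1 + z^2)/2 replaces the first absolute moment of the noise
    by its variance.\<close>
  then have pt: "(x + z)\<^sup>2 / 2 - (A * \<bar>x\<bar> + A * ((1 + z\<^sup>2) / 2)) \<le> - ln (pY (x + z) \<mu>)" for z
  proof -
    have "A * \<bar>x + z\<bar> \<le> A * (\<bar>x\<bar> + (1 + z\<^sup>2) / 2)"
    proof (intro mult_left_mono a)
      have "0 \<le> (1 - \<bar>z\<bar>)\<^sup>2" by simp
      then have "\<bar>z\<bar> \<le> (1 + z\<^sup>2) / 2" by (simp add: power2_eq_square algebra_simps abs_mult_self_eq)
      then show "\<bar>x + z\<bar> \<le> \<bar>x\<bar> + (1 + z\<^sup>2) / 2" by linarith
    qed
    moreover have "ln (pY (x + z) \<mu>) \<le> A * \<bar>x + z\<bar> - (x + z)\<^sup>2 / 2" by fact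
    ultimately show ?thesis by (simp add: algebra_simps)
  qed
  have "x\<^sup>2 / 2 - A * \<bar>x\<bar> - A \<le> (x\<^sup>2 + 1) / 2 - (A * \<bar>x\<bar> + A * ((1 + 1) / 2))"
    by simp
  also have "\<dots> = (\<integral>z. (x + z)\<^sup>2 / 2 - (A * \<bar>x\<bar> + A * ((1 + z\<^sup>2) / 2)) \<partial>gauss)"
    using integrable_gauss_shift_sq[of x] integral_gauss_shift_sq[of x] gauss.prob_space
    by simp
  also have "\<dots> \<le> cross x \<mu>"
    unfolding cross_def
    by (intro integral_mono integrable_cross[OF a(1)] pt) (use integrable_gauss_shift_sq[of x] in auto)
  finally show ?thesis .
qed

section \<open>Multipliers for the maximizer\<close>

locale optimal_input =
  fixes \<gamma> q :: real and \<mu> :: "real measure"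
  assumes \<gamma>: "0 < \<gamma>" and q: "0 < q" "q < 1" and in_Lambda: "\<mu> \<in> Lambda \<gamma> q"
    and max: "\<And>\<nu>. \<nu> \<in> Lambda \<gamma> q \<Longrightarrow> MI \<nu> \<le> MI \<mu>"
begin

lemma optimal_simps: "finite_power \<mu>" "\<mu> \<in> atomic_input q" "input_dist \<mu>"
  using in_Lambda Lambda_iff[of q \<gamma>] \<gamma> q by (auto intro: finite_powerD)

lemma second_moment_le: "(\<integral>x. x\<^sup>2 \<partial>\<mu>) \<le> \<gamma>"
  using in_Lambda Lambda_iff[of q \<gamma>] \<gamma> q by auto

sublocale prob_space \<mu>
  using optimal_simps by (simp add: input_dist_def)

abbreviation "H \<equiv> cross_entropy \<mu> \<mu>"
abbreviation "c \<equiv> \<lambda>x. cross x \<mu>"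

text \<open>First-order condition: moving from \<mu> towards \<nu> by t, Gibbs' inequality bounds
  the share of \<mu> below by (1 - t) H, so optimality can be divided by t; then t tends to
  0.\<close>

lemma cross_entropy_optimal:
  assumes "\<nu> \<in> Lambda \<gamma> q"
  shows "cross_entropy \<nu> \<mu> \<le> H"
proof (rule LIMSEQ_le_const2)
  have \<nu>: "finite_power \<nu>" "\<nu> \<in> atomic_input q"
    using assms Lambda_iff[of q \<gamma>] \<gamma> q by auto
  let ?m = "\<lambda>n. mix (1 / real (Suc n)) \<mu> \<nu>"
  show "(\<lambda>n. cross_entropy \<nu> (?m n)) \<longlonglongrightarrow> cross_entropy \<nu> \<mu>"
    by (rule cross_entropy_mix_tendsto[OF \<nu>(1) optimal_simps(2) \<nu>(2)])
  have "cross_entropy \<nu> (?m n) \<le> H" for n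
  proof -
    define t where "t = 1 / real (Suc n)"
    have t: "0 < t" "t \<le> 1" by (auto simp: t_def)
    let ?m = "mix t \<mu> \<nu>"
    have m: "?m \<in> Lambda \<gamma> q"
      using assms in_Lambda \<gamma> q t by (intro Lambda_mix) auto
    then have m': "finite_power ?m" "?m \<in> atomic_input q"
      using Lambda_iff[of q \<gamma>] \<gamma> q by auto
    have "(1 - t) * H + t * cross_entropy \<nu> ?m \<le> (1 - t) * cross_entropy \<mu> ?m + t * cross_entropy \<nu> ?m"
      using Gibbs_inequality(1)[OF optimal_simps(1,2) m'(2)] t by (intro add_mono mult_left_mono) auto
    also have "\<dots> = cross_entropy ?m ?m"
      using t \<nu> m' optimal_simps by (subst cross_entropy_mix) auto
    also have "\<dots> \<le> H"
      using max[OF m] by (simp add: MI_eq_cross_entropy[OF m'] MI_eq_cross_entropy[OF optimal_simps(1,2)])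
    finally have "t * cross_entropy \<nu> ?m \<le> t * H" by (simp add: algebra_simps)
    then have "cross_entropy \<nu> ?m \<le> H" using t by simp
    then show ?thesis unfolding t_def .
  qed
  then show "\<exists>N. \<forall>n\<ge>N. cross_entropy \<nu> (?m n) \<le> H" by blast
qed

text \<open>For x \<noteq> 0 the atom at 0 has exactly the minimal mass q and all freedom sits at
  one point: these extreme competitors suffice to find the multipliers.\<close>

definition two_point :: "real \<Rightarrow> real measure" where
  "two_point x = mix (1 - q) (return borel 0) (return borel x)"

lemma two_point_simps:
  "finite_power (two_point x)" "two_point x \<in> atomic_input q"
  "(\<integral>u. u\<^sup>2 \<partial>two_point x) = (1 - q) * x\<^sup>2"
  "cross_entropy (two_point x) \<mu> = q * c 0 + (1 - q) * c x"
proof -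
  show "finite_power (two_point x)"
    unfolding two_point_def using q by (intro finite_power_mix) auto
  have "measure (two_point x) {0} = q * 1 + (1 - q) * indicator {0} x"
    unfolding two_point_def using q by (subst measure_mix) (auto simp: measure_return)
  moreover have "input_dist (two_point x)"
    unfolding two_point_def using q by (intro input_dist_mix) auto
  ultimately show "two_point x \<in> atomic_input q"
    using q by (simp add: atomic_input_def)
  show "(\<integral>u. u\<^sup>2 \<partial>two_point x) = (1 - q) * x\<^sup>2"
    unfolding two_point_def using q by (subst second_moment_mix) (auto simp: second_moment_return)
  show "cross_entropy (two_point x) \<mu> = q * c 0 + (1 - q) * c x"
    unfolding two_point_def using q optimal_simps(2)
    by (subst cross_entropy_mix) (auto simp: cross_entropy_return)
qed

text \<open>Spare power would admit a small admixture of \<open>two_point x\<close> for every x, and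
  the first-order condition would then bound c, against \<open>cross_unbounded\<close>.\<close>

lemma second_moment_eq: "(\<integral>x. x\<^sup>2 \<partial>\<mu>) = \<gamma>"
proof (rule ccontr)
  define s where "s = (\<integral>x. x\<^sup>2 \<partial>\<mu>)"
  assume "(\<integral>x. x\<^sup>2 \<partial>\<mu>) \<noteq> \<gamma>"
  then have s: "s < \<gamma>" using second_moment_le by (simp add: s_def)
  have s0: "0 \<le> s" by (simp add: s_def)
  have bound: "c x \<le> H / (1 - q)" for x
  proof -
    define a where "a = (1 - q) * x\<^sup>2"
    have a: "0 \<le> a" using q by (simp add: a_def)
    \<comment> \<open>Small enough for s + t (a - s) \<le> \<gamma>. Using a + \<gamma> instead of a
      - s keeps the denominator positive and t \<le> 1 for every x.\<close>
    define t where "t = (\<gamma> - s) / (a + \<gamma>)"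
    have t: "0 < t" "t \<le> 1" "t * (a + \<gamma>) = \<gamma> - s"
      using s s0 a \<gamma> by (auto simp: t_def divide_simps)
    have "0 \<le> t * \<gamma>" "0 \<le> t * s" using t \<gamma> s0 by auto
    then have "(1 - t) * s + t * a \<le> \<gamma>"
      using t(3) by (simp add: algebra_simps)
    then have "mix t \<mu> (two_point x) \<in> Lambda \<gamma> q"
      using t \<gamma> q optimal_simps two_point_simps[of x]
      by (subst Lambda_iff) (auto simp: atomic_input_mix finite_power_mix second_moment_mix s_def a_def)
    from cross_entropy_optimal[OF this]
    have "(1 - t) * H + t * (q * c 0 + (1 - q) * c x) \<le> H"
      using t optimal_simps two_point_simps[of x] by (simp add: cross_entropy_mix)
    then have "t * (q * c 0 + (1 - q) * c x) \<le> t * H" by (simp add: algebra_simps)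
    then have "q * c 0 + (1 - q) * c x \<le> H" using t by simp
    moreover have "0 \<le> q * c 0" using q cross_nonneg[OF optimal_simps(3)] by simp
    ultimately have "(1 - q) * c x \<le> H" by linarith
    then show ?thesis using q by (simp add: field_simps)
  qed
  obtain x where "H / (1 - q) < c x"
    using cross_unbounded[OF optimal_simps(2,1)] by blast
  with bound[of x] show False by linarith
qed

text \<open>The multiplier l is the slope of a supporting line at (\<gamma>, 0) for the pairs
  (power, gain) of the competitors \<open>two_point x\<close>. It is positive because large values
  of c must be paid for with power.\<close>

lemma KKT_obtain:
  obtains l k where "0 < l" "\<And>x. c x \<le> l * x\<^sup>2 + k" "(1 - q) * k = H - l * \<gamma> - q * c 0"
proof -
  define f where "f x = q * c 0 + (1 - q) * c x - H" for x
  define s where "s x = (1 - q) * x\<^sup>2" for x :: real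
  have f_le: "f x \<le> 0" if "s x \<le> \<gamma>" for x
  proof -
    have "two_point x \<in> Lambda \<gamma> q"
      using that two_point_simps[of x] q \<gamma> by (subst Lambda_iff) (auto simp: s_def)
    from cross_entropy_optimal[OF this] show ?thesis
      by (simp add: two_point_simps f_def)
  qed
  have two: "f x * (s y - \<gamma>) + f y * (\<gamma> - s x) \<le> 0" if xy: "s x < \<gamma>" "\<gamma> < s y" for x y
  proof -
    \<comment> \<open>The weight at which a competitor of too little power and one of too much power
      mix to power exactly \<gamma>.\<close>
    define w where "w = (\<gamma> - s x) / (s y - s x)"
    have w: "0 \<le> w" "w \<le> 1" "w * (s y - s x) = \<gamma> - s x"
      using xy by (auto simp: w_def divide_simps)
    have "(\<integral>u. u\<^sup>2 \<partial>mix w (two_point x) (two_point y)) = (1 - w) * s x + w * s y"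
      unfolding s_def by (subst second_moment_mix[OF w(1,2)]) (simp_all only: two_point_simps)
    also have "\<dots> = \<gamma>" using w(3) by (simp add: algebra_simps)
    finally have "mix w (two_point x) (two_point y) \<in> Lambda \<gamma> q"
      unfolding Lambda_iff[OF q(1) less_imp_le[OF \<gamma>]]
      using atomic_input_mix[OF w(1,2) two_point_simps(2) two_point_simps(2)]
        finite_power_mix[OF w(1,2) two_point_simps(1) two_point_simps(1)] by simp
    from cross_entropy_optimal[OF this]
    have "(1 - w) * f x + w * f y \<le> 0"
      using w optimal_simps two_point_simps[of x] two_point_simps[of y]
      by (simp add: cross_entropy_mix f_def algebra_simps)
    then have "(s y - s x) * ((1 - w) * f x + w * f y) \<le> 0"
      using xy by (intro mult_nonneg_nonpos) auto
    also have "(s y - s x) * ((1 - w) * f x + w * f y)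
      = f x * ((s y - s x) - w * (s y - s x)) + f y * (w * (s y - s x))"
      by (simp add: algebra_simps)
    also have "\<dots> = f x * (s y - \<gamma>) + f y * (\<gamma> - s x)"
      unfolding w(3) by simp
    finally show ?thesis .
  qed
  \<comment> \<open>Slopes of the gain seen from (\<gamma>, 0) to the right. By \<open>two\<close>
    they lie below all slopes to the left, so their supremum is a supporting slope.\<close>
  define S where "S = (\<lambda>y. f y / (s y - \<gamma>)) ` {y. \<gamma> < s y}"
  have ratio: "r \<le> f x / (s x - \<gamma>)" if xr: "s x < \<gamma>" "r \<in> S" for x r
  proof -
    obtain y where y: "\<gamma> < s y" "r = f y / (s y - \<gamma>)" using xr(2) unfolding S_def by blast
    have fy: "f y = r * (s y - \<gamma>)" using y by simp
    have "f x * (s y - \<gamma>) + r * (s y - \<gamma>) * (\<gamma> - s x) \<le> 0"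
      using two[OF xr(1) y(1)] unfolding fy .
    then have "(s y - \<gamma>) * (f x - r * (s x - \<gamma>)) \<le> 0"
      by (simp add: algebra_simps)
    then have "f x \<le> r * (s x - \<gamma>)" using y(1) by (simp add: mult_le_0_iff)
    then show ?thesis using xr(1) neg_le_divide_eq[of "s x - \<gamma>" r "f x"] by simp
  qed
  have s0: "s 0 < \<gamma>" using \<gamma> by (simp add: s_def)
  have ne: "S \<noteq> {}"
  proof -
    have "\<gamma> < s (sqrt ((\<gamma> + 1) / (1 - q)))" using q \<gamma> by (simp add: s_def)
    then show ?thesis by (auto simp: S_def)
  qed
  have bdd: "bdd_above S"
    using ratio[OF s0] by (intro bdd_aboveI) auto
  define l where "l = Sup S"
  have fl: "f x \<le> l * (s x - \<gamma>)" for x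
  proof (cases "s x" \<gamma> rule: linorder_cases)
    case less
    have "l \<le> f x / (s x - \<gamma>)"
      unfolding l_def using ratio[OF less] ne by (intro cSup_least) auto
    then show ?thesis using less neg_le_divide_eq[of "s x - \<gamma>" l "f x"] by simp
  next
    case equal
    then show ?thesis using f_le[of x] by simp
  next
    case greater
    have "f x / (s x - \<gamma>) \<le> l"
      unfolding l_def using greater bdd by (intro cSup_upper) (auto simp: S_def)
    then show ?thesis using greater pos_divide_le_eq[of "s x - \<gamma>" "f x" l] by simp
  qed
  have "0 < l"
  proof -
    obtain x where x: "H / (1 - q) < c x"
      using cross_unbounded[OF optimal_simps(2,1)] by blast
    have "0 \<le> q * c 0" using q cross_nonneg[OF optimal_simps(3)] by simp
    moreover have "H < (1 - q) * c x" using x q by (simp add: field_simps)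
    ultimately have "0 < f x" by (simp add: f_def)
    moreover from this have "\<gamma> < s x" using f_le[of x] by linarith
    ultimately have "0 < l * (s x - \<gamma>)" "0 < s x - \<gamma>" using fl[of x] by auto
    then show ?thesis by (simp add: zero_less_mult_iff)
  qed
  moreover define k where "k = (H - l * \<gamma> - q * c 0) / (1 - q)"
  have k: "(1 - q) * k = H - l * \<gamma> - q * c 0" using q by (simp add: k_def)
  moreover have "c x \<le> l * x\<^sup>2 + k" for x
  proof -
    have "(1 - q) * c x \<le> (1 - q) * (l * x\<^sup>2 + k)"
      using fl[of x] k by (simp add: f_def s_def algebra_simps)
    then show ?thesis using q by simp
  qed
  ultimately show ?thesis using that by blast
qed

text \<open>The last equation is the vanishing duality gap q c(0) + (1 - q) k + l \<gamma> = H;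
  \<open>k - c 0\<close> is the multiplier of the duty cycle constraint.\<close>

definition KKT :: "real \<Rightarrow> real \<Rightarrow> bool" where
  "KKT l k \<longleftrightarrow> 0 < l \<and> (\<forall>x. c x \<le> l * x\<^sup>2 + k) \<and> (1 - q) * k = H - l * \<gamma> - q * c 0"

lemma KKT_exists: obtains l k where "KKT l k"
  using KKT_obtain unfolding KKT_def by metis

text \<open>By the duality equation the nonnegative gap D has mean q D(0), which is at most what the
  atom at 0 carries, so no gap is left elsewhere. The value at 0 itself stays undetermined.\<close>

lemma KKT_equality:
  assumes "KKT l k"
  shows "AE x in \<mu>. x \<noteq> 0 \<longrightarrow> c x = l * x\<^sup>2 + k"
proof -
  note [measurable_cong] = input_dist_simps(1)[OF optimal_simps(3)]
  note [measurable] = measurable_cross[OF optimal_simps(3)]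
  let ?D = "\<lambda>x. l * x\<^sup>2 + k - c x"
  have D: "0 \<le> ?D x" for x using assms by (simp add: KKT_def)
  have sq: "integrable \<mu> (\<lambda>x. x\<^sup>2)" using optimal_simps by (simp add: finite_power_def)
  have cint: "integrable \<mu> c" by (rule integrable_cross_input[OF optimal_simps(1,2)])
  have int: "integrable \<mu> ?D" using sq cint by auto
  have "(\<integral>x. ?D x \<partial>\<mu>) = l * \<gamma> + k - H"
    using sq cint by (simp add: second_moment_eq integral_cross[OF optimal_simps(1,2)] prob_space)
  also have "\<dots> = q * ?D 0"
    using assms by (simp add: KKT_def algebra_simps)
  also have "\<dots> \<le> measure \<mu> {0} * ?D 0"
    using optimal_simps(2) D[of 0] by (intro mult_right_mono) (auto simp: atomic_input_def)
  also have "\<dots> = (\<integral>x. indicator {0} x * ?D 0 \<partial>\<mu>)"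
    by simp
  finally have le: "(\<integral>x. ?D x \<partial>\<mu>) \<le> (\<integral>x. indicator {0} x * ?D 0 \<partial>\<mu>)" .
  have int0: "integrable \<mu> (\<lambda>x. indicator {0} x * ?D 0)"
    by (intro integrable_mult_left integrable_real_indicator) (auto simp: emeasure_eq_measure)
  let ?E = "\<lambda>x. ?D x - indicator {0} x * ?D 0"
  have E: "0 \<le> ?E x" for x using D[of x] by (auto split: split_indicator)
  have "(\<integral>x. ?E x \<partial>\<mu>) = (\<integral>x. ?D x \<partial>\<mu>) - (\<integral>x. indicator {0} x * ?D 0 \<partial>\<mu>)"
    by (rule Bochner_Integration.integral_diff[OF int int0])
  moreover have "0 \<le> (\<integral>x. ?E x \<partial>\<mu>)" using E by (intro integral_nonneg_AE) auto
  ultimately have "(\<integral>x. ?E x \<partial>\<mu>) = 0" using le by linarith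
  then have "AE x in \<mu>. ?E x = 0"
    using integral_nonneg_eq_0_iff_AE[OF Bochner_Integration.integrable_diff[OF int int0]] E by blast
  then show ?thesis
    by eventually_elim (auto split: split_indicator_asm)
qed

lemma cross_not_quadratic:
  assumes l: "0 < l" and eq: "\<And>x. c x = l * x\<^sup>2 + k"
  shows False
proof -
  note [measurable] = measurable_pY[OF optimal_simps(3)]
  \<comment> \<open>Raising both functions by C makes them nonnegative, as deconvolution requires.
    In the next line b = k - l because smoothing l y^2 with unit noise adds l.\<close>
  define C where "C = \<bar>k - l\<bar>"
  define b where "b = k - l"
  have "AE y in lborel. - ln (pY y \<mu>) + C = l * y\<^sup>2 + b + C"
  proof (rule gauss_deconvolution)
    fix x y :: real
    show "0 \<le> - ln (pY y \<mu>) + C"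
      using neg_ln_pY_nonneg[OF optimal_simps(3), of y] by (simp add: C_def)
    have "0 \<le> l * y\<^sup>2" using l by simp
    then show "0 \<le> l * y\<^sup>2 + b + C" unfolding b_def C_def by linarith
    have i1: "integrable gauss (\<lambda>z. - ln (pY (x + z) \<mu>))"
      by (rule integrable_cross[OF optimal_simps(2)])
    then show "integrable gauss (\<lambda>z. - ln (pY (x + z) \<mu>) + C)"
      by (intro Bochner_Integration.integrable_add) auto
    show "integrable gauss (\<lambda>z. l * (x + z)\<^sup>2 + b + C)"
      using integrable_gauss_shift_sq[of x] by auto
    have "(\<integral>z. - ln (pY (x + z) \<mu>) + C \<partial>gauss) = c x + C"
      unfolding cross_def using i1 gauss.prob_space
      by (subst Bochner_Integration.integral_add) (auto simp del: integral_minus)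
    also have "\<dots> = l * (x\<^sup>2 + 1) + b + C" by (simp add: eq b_def algebra_simps)
    also have "\<dots> = (\<integral>z. l * (x + z)\<^sup>2 + b + C \<partial>gauss)"
      using integrable_gauss_shift_sq[of x] integral_gauss_shift_sq[of x] gauss.prob_space by simp
    finally show "(\<integral>z. - ln (pY (x + z) \<mu>) + C \<partial>gauss) = (\<integral>z. l * (x + z)\<^sup>2 + b + C \<partial>gauss)" .
  qed measurable
  then have "(\<lambda>y. - ln (pY y \<mu>) + C) = (\<lambda>y. l * y\<^sup>2 + b + C)"
    using pY_pos[OF optimal_simps(3)]
    by (intro continuous_AE_eq_imp_eq)
       (auto intro!: continuous_intros continuous_pY[OF optimal_simps(3)] simp: less_imp_neq[symmetric])
  then have ln_eq: "- ln (pY y \<mu>) = l * y\<^sup>2 + b" for y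
    by (metis (no_types, lifting) add_right_imp_eq)
  \<comment> \<open>With l > 1/2 the output tail would be lighter than \<open>q * phi y\<close>,
    which the atom forbids.\<close>
  have l_le: "l \<le> 1/2"
  proof (rule ccontr)
    assume "\<not> l \<le> 1/2"
    then have l: "0 < l - 1/2" by simp
    define d where "d = ln (sqrt (2 * pi)) - ln q - b"
    define y where "y = sqrt ((\<bar>d\<bar> + 1) / (l - 1/2))"
    have "y\<^sup>2 * (l - 1/2) = \<bar>d\<bar> + 1" using l by (simp add: y_def)
    moreover have "l * y\<^sup>2 + b \<le> y\<^sup>2 / 2 + (ln (sqrt (2 * pi)) - ln q)"
      using neg_ln_pY_le[OF optimal_simps(2), of y] ln_eq[of y] by simp
    ultimately show False by (simp add: d_def algebra_simps)
  qed
  define s where "s = sqrt (1 / (2 * l))"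
  have s2: "s\<^sup>2 = 1 / (2 * l)" and s: "0 < s" using l by (auto simp: s_def)
  define r where "r = 1 / sqrt (2 * pi * s\<^sup>2)"
  have r: "0 < r" using s by (simp add: r_def)
  have nd: "normal_density 0 s y = r * exp (- (l * y\<^sup>2))" for y
    using l by (simp add: normal_density_def r_def s2)
  have p: "pY y \<mu> = exp (- b) / r * normal_density 0 s y" for y
  proof -
    have "ln (pY y \<mu>) = - b + - (l * y\<^sup>2)" using ln_eq[of y] by simp
    then have "pY y \<mu> = exp (- b + - (l * y\<^sup>2))"
      using pY_pos[OF optimal_simps(3), of y] by (metis exp_ln)
    then show ?thesis unfolding nd exp_add using r by simp
  qed
  \<comment> \<open>Total mass 1 determines the remaining constant factor.\<close>
  have "1 = (LBINT y. exp (- b) / r * normal_density 0 s y)"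
    unfolding p[symmetric] by (simp only: lborel_pY(2)[OF optimal_simps(3)])
  also have "\<dots> = exp (- b) / r"
    by (simp only: integral_mult_right_zero integral_normal_density[OF s] mult_1_right)
  finally have p: "pY y \<mu> = normal_density 0 s y" for y using p[of y] by simp
  show False
  \<comment> \<open>Output variance 1 is the noise alone, so the input is the point mass at 0 and
    has no power; a larger variance forces a Gaussian input, which has no atom.\<close>
  proof (cases "l = 1/2")
    case True
    then have "s = 1" by (simp add: s_def)
    then have "(\<lambda>y. pY y \<mu>) = (\<lambda>y. pY y (return borel 0))"
      by (simp add: p pY_return phi_eq_std_normal)
    then have "\<mu> = return borel 0"
      by (intro pY_inject optimal_simps) auto
    then show False using second_moment_eq second_moment_return[of 0] \<gamma> by simp
  next
    case False
    then have "1 < s\<^sup>2" using l l_le by (simp add: s2)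
    define \<tau> where "\<tau> = sqrt (s\<^sup>2 - 1)"
    have \<tau>: "0 < \<tau>" "\<tau>\<^sup>2 = s\<^sup>2 - 1" using \<open>1 < s\<^sup>2\<close> by (auto simp: \<tau>_def)
    let ?\<nu> = "density lborel (normal_density 0 \<tau>)"
    have "sqrt (1 + \<tau>\<^sup>2) = s" using s by (simp add: \<tau>)
    then have "(\<lambda>y. pY y \<mu>) = (\<lambda>y. pY y ?\<nu>)"
      by (simp add: p pY_normal(2)[OF \<tau>(1)])
    then have "\<mu> = ?\<nu>"
      by (intro pY_inject optimal_simps pY_normal(1) \<tau>)
    moreover have "emeasure ?\<nu> {0} = 0"
      by (subst emeasure_density) (auto simp: nn_integral_null_set)
    ultimately have "measure \<mu> {0} = 0" by (simp add: measure_def)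
    then show False using optimal_simps(2) by (auto simp: atomic_input_def)
  qed
qed

lemma KKT_zeros_finite:
  assumes "KKT l k"
  shows "finite {x \<in> {a..b}. c x = l * x\<^sup>2 + k}"
proof (rule ccontr)
  let ?Z = "{x \<in> {a..b}. c x = l * x\<^sup>2 + k}"
  assume "infinite ?Z"
  moreover have "?Z \<subseteq> {a..b}" by auto
  ultimately obtain \<xi> where \<xi>: "\<xi> islimpt ?Z"
    using Heine_Borel_imp_Bolzano_Weierstrass[OF compact_Icc] by blast
  note [measurable] = measurable_pY[OF optimal_simps(3)]
  have "(\<lambda>y. - ln (pY y \<mu>)) \<in> borel_measurable borel" by measurable
  from gauss_convolution_entire[OF this neg_ln_pY_nonneg[OF optimal_simps(3)] integrable_cross[OF optimal_simps(2)]]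
  obtain F where F: "F holomorphic_on UNIV" "\<And>x. F (complex_of_real x) = complex_of_real (c x)"
    unfolding cross_def by blast
  define G where "G z = of_real l * z\<^sup>2 + of_real k - F z" for z
  have G: "G (complex_of_real x) = complex_of_real (l * x\<^sup>2 + k - c x)" for x
    by (simp add: G_def F(2))
  have "G w = 0" for w
  proof (rule analytic_continuation[of G UNIV "complex_of_real ` ?Z" "complex_of_real \<xi>"])
    show "G holomorphic_on UNIV"
      unfolding G_def by (intro holomorphic_intros F)
    show "complex_of_real \<xi> islimpt complex_of_real ` ?Z"
    proof (subst islimpt_approachable, intro allI impI)
      fix e :: real assume "0 < e"
      then obtain x where "x \<in> ?Z" "x \<noteq> \<xi>" "dist x \<xi> < e"
        using \<xi> unfolding islimpt_approachable by blast
      then show "\<exists>x'\<in>complex_of_real ` ?Z. x' \<noteq> complex_of_real \<xi> \<and> dist x' (complex_of_real \<xi>) < e"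
        by (intro bexI[of _ "complex_of_real x"]) (auto simp: dist_norm simp flip: of_real_diff)
    qed
  qed (auto simp: G simp del: of_real_add of_real_mult of_real_power of_real_diff)
  then have "c x = l * x\<^sup>2 + k" for x
    using G[of x] by (simp del: of_real_add of_real_mult of_real_power of_real_diff)
  then show False
    using assms cross_not_quadratic[of l k] by (simp add: KKT_def)
qed

section \<open>Symmetry and mass points of the maximizer\<close>

lemma symmetric:
  assumes "A \<in> sets borel"
  shows "emeasure \<mu> (uminus ` A) = emeasure \<mu> A"
proof -
  note [measurable_cong] = input_dist_simps(1)[OF optimal_simps(3)]
  let ?\<nu> = "distr \<mu> borel uminus"
  have "?\<nu> = \<mu>"
    by (rule MI_maximizer_unique[of q \<gamma> \<mu>])
       (use q \<gamma> in_Lambda max reflected_Lambda[of q \<gamma> \<mu>] in auto)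
  have "emeasure \<mu> (uminus ` A) = emeasure \<mu> (uminus -` A)"
    by (rule arg_cong[where f = "emeasure \<mu>"]) (force simp: image_iff)
  also have "\<dots> = emeasure ?\<nu> A"
    using assms by (subst emeasure_distr) (auto simp: input_dist_simps[OF optimal_simps(3)])
  finally show ?thesis using \<open>?\<nu> = \<mu>\<close> by simp
qed

text \<open>An identity that holds almost surely holds at every point of positive mass.\<close>

lemma KKT_mass_point:
  assumes "KKT l k" "0 < measure \<mu> {x}" "x \<noteq> 0"
  shows "c x = l * x\<^sup>2 + k"
proof (rule ccontr)
  note [measurable_cong] = input_dist_simps(1)[OF optimal_simps(3)]
  assume ne: "c x \<noteq> l * x\<^sup>2 + k"
  have "AE u in \<mu>. u \<noteq> x"
    using KKT_equality[OF assms(1)] by eventually_elim (use ne assms(3) in auto)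
  then have "AE u in \<mu>. u \<notin> {x}" by simp
  then have "{x} \<in> null_sets \<mu>"
    by (subst (asm) AE_iff_null_sets[symmetric]) (auto simp: input_dist_simps[OF optimal_simps(3)])
  then have "emeasure \<mu> {x} = 0" by auto
  then show False using assms(2) by (simp add: measure_def)
qed

lemma mass_points_locally_finite: "finite {x \<in> {a..b}. 0 < measure \<mu> {x}}"
proof -
  obtain l k where lk: "KKT l k" by (rule KKT_exists)
  have "{x \<in> {a..b}. 0 < measure \<mu> {x}} \<subseteq> insert 0 {x \<in> {a..b}. c x = l * x\<^sup>2 + k}"
    using KKT_mass_point[OF lk] by auto
  then show ?thesis
    using KKT_zeros_finite[OF lk] by (meson finite_insert finite_subset)
qed

lemma mass_points_countable: "countable {x. 0 < measure \<mu> {x}}"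
proof -
  have "{x. 0 < measure \<mu> {x}} \<subseteq> (\<Union>n::nat. {x \<in> {- real n..real n}. 0 < measure \<mu> {x}})"
  proof
    fix x assume "x \<in> {x. 0 < measure \<mu> {x}}"
    moreover obtain n :: nat where "\<bar>x\<bar> \<le> real n" using real_arch_simple by blast
    ultimately show "x \<in> (\<Union>n::nat. {x \<in> {- real n..real n}. 0 < measure \<mu> {x}})"
      by (auto intro!: exI[of _ n])
  qed
  then show ?thesis
    using mass_points_locally_finite by (meson countable_UN countable_finite countable_subset countableI_type)
qed

text \<open>Off 0 the law lives on the equality set, which is finite in each bounded interval and so
  countable; its points without mass form a null set together.\<close>

lemma AE_mass_point: "AE x in \<mu>. 0 < measure \<mu> {x}"
proof -
  note [measurable_cong] = input_dist_simps(1)[OF optimal_simps(3)]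
  obtain l k where lk: "KKT l k" by (rule KKT_exists)
  define Z where "Z = insert 0 (\<Union>n::nat. {x \<in> {- real n..real n}. c x = l * x\<^sup>2 + k})"
  have "countable (\<Union>n::nat. {x \<in> {- real n..real n}. c x = l * x\<^sup>2 + k})"
    by (rule countable_UN[OF countableI_type]) (rule countable_finite[OF KKT_zeros_finite[OF lk]])
  then have cZ: "countable Z" unfolding Z_def by (rule countable_insert)
  have inZ: "AE x in \<mu>. x \<in> Z"
    using KKT_equality[OF lk]
  proof eventually_elim
    case (elim x)
    obtain n :: nat where "\<bar>x\<bar> \<le> real n" using real_arch_simple by blast
    then show ?case using elim by (auto simp: Z_def intro!: exI[of _ n])
  qed
  have "(\<Union>x\<in>{x\<in>Z. measure \<mu> {x} = 0}. {x}) \<in> null_sets \<mu>"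
    using cZ by (intro null_sets_UN') (auto simp: emeasure_eq_measure input_dist_simps[OF optimal_simps(3)] intro: countable_subset)
  then have "AE x in \<mu>. x \<notin> (\<Union>x\<in>{x\<in>Z. measure \<mu> {x} = 0}. {x})"
    by (rule AE_not_in)
  then show ?thesis
    using inZ by eventually_elim (auto simp: less_le)
qed

lemma emeasure_mass_points: "emeasure \<mu> {x. 0 < measure \<mu> {x}} = 1"
proof -
  have "{x. 0 < measure \<mu> {x}} \<in> sets \<mu>"
    by (rule sets.countable[OF _ mass_points_countable]) (simp add: input_dist_simps[OF optimal_simps(3)])
  then show ?thesis
    using AE_mass_point by (intro emeasure_eq_1_AE) simp_all
qed

text \<open>\<open>ln_pY_midpoint\<close> averaged over the noise: x^2/2 - c(x) is midpoint
  convex.\<close>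

lemma cross_midpoint:
  "(c u + c v) / 2 \<le> ((u - v) / 2)\<^sup>2 / 2 + c ((u + v) / 2)"
proof -
  define m h where "m = (u + v) / 2" and "h = (u - v) / 2"
  have uv: "u = m + h" "v = m - h" by (auto simp: m_def h_def field_simps)
  have int: "integrable gauss (\<lambda>z. - ln (pY (x + z) \<mu>))" for x
    by (rule integrable_cross[OF optimal_simps(2)])
  have "(c u + c v) / 2 = (\<integral>z. (- ln (pY (u + z) \<mu>) + - ln (pY (v + z) \<mu>)) / 2 \<partial>gauss)"
    unfolding cross_def
    by (subst Bochner_Integration.integral_divide_zero, subst Bochner_Integration.integral_add)
       (use int in auto)
  also have "\<dots> \<le> (\<integral>z. h\<^sup>2 / 2 + - ln (pY (m + z) \<mu>) \<partial>gauss)"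
  proof (rule integral_mono)
    fix z
    have e: "u + z = m + z + h" "v + z = m + z - h" by (auto simp: uv)
    have "ln (pY (m + z) \<mu>) \<le> h\<^sup>2 / 2 + (ln (pY (u + z) \<mu>) + ln (pY (v + z) \<mu>)) / 2"
      unfolding e by (rule ln_pY_midpoint[OF optimal_simps(3)])
    then show "(- ln (pY (u + z) \<mu>) + - ln (pY (v + z) \<mu>)) / 2 \<le> h\<^sup>2 / 2 + - ln (pY (m + z) \<mu>)"
      by argo
    show "integrable gauss (\<lambda>z. (- ln (pY (u + z) \<mu>) + - ln (pY (v + z) \<mu>)) / 2)"
      by (intro integrable_divide Bochner_Integration.integrable_add int)
    show "integrable gauss (\<lambda>z. h\<^sup>2 / 2 + - ln (pY (m + z) \<mu>))"
      by (intro Bochner_Integration.integrable_add int) auto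
  qed
  also have "\<dots> = h\<^sup>2 / 2 + c m"
    unfolding cross_def using int[of m] gauss.prob_space
    by (subst Bochner_Integration.integral_add) (auto simp del: integral_minus)
  finally show ?thesis by (simp add: m_def h_def)
qed

lemma mass_points_infinite: "infinite {x. 0 < measure \<mu> {x}}"
proof
  note [measurable_cong] = input_dist_simps(1)[OF optimal_simps(3)]
  assume fin: "finite {x. 0 < measure \<mu> {x}}"
  obtain l k where lk: "KKT l k" by (rule KKT_exists)
  \<comment> \<open>A crude radius for the support: the sum of all absolute values bounds each of
    them.\<close>
  define A where "A = (\<Sum>x | 0 < measure \<mu> {x}. \<bar>x\<bar>)"
  have A0: "0 \<le> A" by (simp add: A_def sum_nonneg)
  have "AE x in \<mu>. \<bar>x\<bar> \<le> A"
    using AE_mass_point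
  proof eventually_elim
    case (elim x)
    then show ?case unfolding A_def using fin by (intro member_le_sum) auto
  qed
  note lower = cross_ge_bounded_support[OF optimal_simps(2) A0 this]
  have l: "1/2 \<le> l"
  proof (rule ccontr)
    assume "\<not> 1/2 \<le> l"
    then have e: "0 < 1/2 - l" by simp
    \<comment> \<open>For x \<ge> 1 the linear and constant errors are less than B x, and the next
      line takes x so large that (1/2 - l) x^2 \<ge> B x.\<close>
    define B where "B = 2 * A + \<bar>k\<bar> + 1"
    define x where "x = B / (1/2 - l) + 1"
    have B: "1 \<le> B" using A0 by (simp add: B_def)
    have x: "1 \<le> x" using e B by (simp add: x_def)
    have "(1/2 - l) * x = (1/2 - l) * (B / (1/2 - l)) + (1/2 - l)"
      by (simp only: x_def distrib_left mult_1_right)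
    also have "(1/2 - l) * (B / (1/2 - l)) = B" using e by simp
    finally have "B \<le> (1/2 - l) * x" using e by linarith
    then have "B * x \<le> (1/2 - l) * x * x" using x by (intro mult_right_mono) auto
    moreover have "x\<^sup>2 / 2 - A * \<bar>x\<bar> - A \<le> l * x\<^sup>2 + k"
      using lower[of x] lk unfolding KKT_def by (meson order_trans)
    ultimately have "B * x \<le> A * x + A + k"
      using x by (simp add: power2_eq_square algebra_simps)
    moreover have "A + \<bar>k\<bar> + 1 \<le> (A + \<bar>k\<bar> + 1) * x"
      using x A0 mult_left_mono[of 1 x "A + \<bar>k\<bar> + 1"] by simp
    ultimately show False by (simp add: B_def algebra_simps)
  qed
  define D where "D x = l * x\<^sup>2 + k - c x" for x
  have D0: "0 \<le> D x" for x using lk by (simp add: D_def KKT_def)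
  have mid: "D ((u + v) / 2) \<le> (D u + D v) / 2" for u v
  proof -
    have "((u - v) / 2)\<^sup>2 * (1/2) \<le> ((u - v) / 2)\<^sup>2 * l" using l by (intro mult_left_mono) auto
    moreover have "l * ((u + v) / 2)\<^sup>2 + ((u - v) / 2)\<^sup>2 * l = (l * u\<^sup>2 + l * v\<^sup>2) / 2"
      by (simp add: power2_eq_square field_simps)
    ultimately show ?thesis
      using cross_midpoint[of u v] by (simp add: D_def field_simps)
  qed
  have "\<exists>x. 0 < measure \<mu> {x} \<and> x \<noteq> 0"
  proof (rule ccontr)
    assume none: "\<not> ?thesis"
    have "AE x in \<mu>. x\<^sup>2 = 0"
      using AE_mass_point
    proof eventually_elim
      case (elim x)
      then show ?case using none by auto
    qed
    then have "(\<integral>x. x\<^sup>2 \<partial>\<mu>) = (\<integral>x. 0 \<partial>\<mu>)" by (intro integral_cong_AE) auto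
    then show False using second_moment_eq \<gamma> by simp
  qed
  then obtain x where x: "0 < measure \<mu> {x}" "x \<noteq> 0" by blast
  have "measure \<mu> {- x} = measure \<mu> {x}"
    using symmetric[of "{x}"] by (simp add: measure_def)
  then have Dx: "D x = 0" "D (- x) = 0"
    using KKT_mass_point[OF lk, of x] KKT_mass_point[OF lk, of "- x"] x by (auto simp: D_def)
  \<comment> \<open>The origin, about which \<open>KKT_equality\<close> is silent, is the midpoint
    of the zeros x and -x given by symmetry.\<close>
  have D00: "D 0 = 0"
    using mid[of x "- x"] D0[of 0] Dx by simp
  have Dn: "D (x / 2 ^ n) = 0" for n
  proof (induction n)
    case (Suc n)
    have "D (x / 2 ^ Suc n) \<le> 0"
      using mid[of "x / 2 ^ n" 0] Suc D00 by (simp add: field_simps)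
    then show ?case using D0[of "x / 2 ^ Suc n"] by simp
  qed (use Dx in simp)
  have "range (\<lambda>n::nat. x / 2 ^ n) \<subseteq> {y \<in> {- \<bar>x\<bar>..\<bar>x\<bar>}. c y = l * y\<^sup>2 + k}"
  proof safe
    fix n :: nat
    have "\<bar>x / 2 ^ n\<bar> \<le> \<bar>x\<bar>" by (simp add: divide_le_eq mult_le_cancel_left1)
    then show "x / 2 ^ n \<in> {- \<bar>x\<bar>..\<bar>x\<bar>}"
      unfolding atLeastAtMost_iff abs_le_iff by (intro conjI; linarith)
    show "c (x / 2 ^ n) = l * (x / 2 ^ n)\<^sup>2 + k" using Dn[of n] by (simp add: D_def)
  qed
  then have "finite (range (\<lambda>n::nat. x / 2 ^ n))"
    using KKT_zeros_finite[OF lk] finite_subset by blast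
  moreover have "inj (\<lambda>n::nat. x / 2 ^ n)"
    using x by (auto simp: inj_def)
  ultimately show False using finite_imageD infinite_UNIV_nat by blast
qed

end

section \<open>Product measures and the weak law of large numbers\<close>

lemma indicator_PiE_restrict:
  assumes "finite I"
  shows "indicator (Pi\<^sub>E I A) (restrict h I) = (\<Prod>i\<in>I. indicator (A i) (h i) :: ennreal)"
proof (cases "\<forall>i\<in>I. h i \<in> A i")
  case True
  then show ?thesis by (auto simp: indicator_def PiE_iff intro!: prod.neutral[symmetric])
next
  case False
  then obtain i where "i \<in> I" "h i \<notin> A i" by blast
  then have "(\<Prod>i\<in>I. indicator (A i) (h i) :: ennreal) = 0"
    using assms by (intro prod_zero) (auto intro!: bexI[of _ i])
  moreover have "restrict h I \<notin> Pi\<^sub>E I A" using False by (auto simp: PiE_iff)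
  ultimately show ?thesis by simp
qed

text \<open>Checked on boxes, where both sides factorize. It lets statements on one i.i.d. sequence
  be applied to codeword and noise, which are kept as separate product spaces so that the noise can
  be integrated with the codeword fixed.\<close>

lemma PiM_distr_pair:
  fixes M1 :: "'a measure" and M2 :: "'b measure" and I :: "'i set"
  assumes p: "prob_space M1" "prob_space M2" and I: "finite I"
    and g [measurable]: "g \<in> measurable (M1 \<Otimes>\<^sub>M M2) N"
  shows "PiM I (\<lambda>_. distr (M1 \<Otimes>\<^sub>M M2) N g)
    = distr (PiM I (\<lambda>_. M1) \<Otimes>\<^sub>M PiM I (\<lambda>_. M2)) (PiM I (\<lambda>_. N)) (\<lambda>p. \<lambda>i\<in>I. g (fst p i, snd p i))"
proof -
  interpret M1: prob_space M1 by fact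
  interpret M2: prob_space M2 by fact
  interpret M12: pair_prob_space M1 M2 ..
  let ?K = "distr (M1 \<Otimes>\<^sub>M M2) N g"
  interpret K: prob_space ?K by (rule M12.prob_space_distr) measurable
  interpret S1: product_sigma_finite "\<lambda>_::'i. M1" by standard
  interpret S2: product_sigma_finite "\<lambda>_::'i. M2" by standard
  interpret SK: product_sigma_finite "\<lambda>_::'i. ?K" by standard
  interpret P1: prob_space "PiM I (\<lambda>_. M1)" by (intro prob_space_PiM p)
  interpret P2: prob_space "PiM I (\<lambda>_. M2)" by (intro prob_space_PiM p)
  let ?T = "\<lambda>p. \<lambda>i\<in>I. g (fst p i, snd p i)"
  have T [measurable]: "?T \<in> measurable (PiM I (\<lambda>_. M1) \<Otimes>\<^sub>M PiM I (\<lambda>_. M2)) (PiM I (\<lambda>_. N))"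
    by measurable
  show ?thesis
  proof (rule SK.PiM_eqI[OF I, symmetric])
    show "sets (distr (PiM I (\<lambda>_. M1) \<Otimes>\<^sub>M PiM I (\<lambda>_. M2)) (PiM I (\<lambda>_. N)) ?T)
      = sets (PiM I (\<lambda>_. ?K))"
      by (simp cong: sets_PiM_cong)
    fix A assume "\<And>i. i \<in> I \<Longrightarrow> A i \<in> sets ?K"
    then have A [measurable]: "\<And>i. i \<in> I \<Longrightarrow> A i \<in> sets N" by simp
    have box: "Pi\<^sub>E I A \<in> sets (PiM I (\<lambda>_. N))"
      using I A by (intro sets_PiM_I_finite) auto
    let ?f = "\<lambda>i q. indicator (A i) (g q) :: ennreal"
    have f [measurable]: "?f i \<in> borel_measurable (M1 \<Otimes>\<^sub>M M2)" if "i \<in> I" for i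
      using A[OF that] by measurable
    have "emeasure (distr (PiM I (\<lambda>_. M1) \<Otimes>\<^sub>M PiM I (\<lambda>_. M2)) (PiM I (\<lambda>_. N)) ?T) (Pi\<^sub>E I A)
      = (\<integral>\<^sup>+p. indicator (Pi\<^sub>E I A) (?T p) \<partial>(PiM I (\<lambda>_. M1) \<Otimes>\<^sub>M PiM I (\<lambda>_. M2)))"
      using box by (subst nn_integral_indicator[symmetric], simp, subst nn_integral_distr) auto
    also have "\<dots> = (\<integral>\<^sup>+p. (\<Prod>i\<in>I. ?f i (fst p i, snd p i)) \<partial>(PiM I (\<lambda>_. M1) \<Otimes>\<^sub>M PiM I (\<lambda>_. M2)))"
      by (simp only: indicator_PiE_restrict[OF I])
    also have "\<dots> = (\<integral>\<^sup>+x. \<integral>\<^sup>+z. (\<Prod>i\<in>I. ?f i (x i, z i)) \<partial>PiM I (\<lambda>_. M2) \<partial>PiM I (\<lambda>_. M1))"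
      by (subst P2.nn_integral_fst[symmetric]) (auto intro!: borel_measurable_prod_ennreal)
    also have "\<dots> = (\<integral>\<^sup>+x. (\<Prod>i\<in>I. \<integral>\<^sup>+z. ?f i (x i, z) \<partial>M2) \<partial>PiM I (\<lambda>_. M1))"
    proof (rule nn_integral_cong)
      fix x assume "x \<in> space (PiM I (\<lambda>_. M1))"
      then have x: "\<And>i. i \<in> I \<Longrightarrow> x i \<in> space M1" by (auto simp: space_PiM PiE_iff)
      show "(\<integral>\<^sup>+z. (\<Prod>i\<in>I. ?f i (x i, z i)) \<partial>PiM I (\<lambda>_. M2)) = (\<Prod>i\<in>I. \<integral>\<^sup>+z. ?f i (x i, z) \<partial>M2)"
      proof (rule S2.product_nn_integral_prod[OF I, of "\<lambda>i z. ?f i (x i, z)"])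
        fix i assume i: "i \<in> I"
        show "(\<lambda>z. ?f i (x i, z)) \<in> borel_measurable M2"
          by (rule measurable_compose[OF measurable_Pair1'[OF x[OF i]] f[OF i]])
      qed
    qed
    also have "\<dots> = (\<Prod>i\<in>I. \<integral>\<^sup>+x. \<integral>\<^sup>+z. ?f i (x, z) \<partial>M2 \<partial>M1)"
      by (rule S1.product_nn_integral_prod[OF I]) (intro M2.borel_measurable_nn_integral_fst f)
    also have "\<dots> = (\<Prod>i\<in>I. emeasure ?K (A i))"
    proof (rule prod.cong[OF refl])
      fix i assume i: "i \<in> I"
      have "(\<integral>\<^sup>+x. \<integral>\<^sup>+z. ?f i (x, z) \<partial>M2 \<partial>M1) = (\<integral>\<^sup>+q. ?f i q \<partial>(M1 \<Otimes>\<^sub>M M2))"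
        by (rule M2.nn_integral_fst[OF f[OF i]])
      also have "\<dots> = (\<integral>\<^sup>+y. indicator (A i) y \<partial>?K)"
        using A[OF i] by (subst nn_integral_distr) auto
      finally show "(\<integral>\<^sup>+x. \<integral>\<^sup>+z. ?f i (x, z) \<partial>M2 \<partial>M1) = emeasure ?K (A i)"
        using A[OF i] by simp
    qed
    finally show "emeasure (distr (PiM I (\<lambda>_. M1) \<Otimes>\<^sub>M PiM I (\<lambda>_. M2)) (PiM I (\<lambda>_. N)) ?T) (Pi\<^sub>E I A)
      = (\<Prod>i\<in>I. emeasure ?K (A i))" .
  qed
qed

text \<open>Change of measure, coordinate by coordinate: translating the noise by x and weighting it
  with the likelihood ratio gives the product output law, whatever x is.\<close>

lemma nn_integral_PiM_out_shift:
  fixes x :: "'i \<Rightarrow> real"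
  assumes \<mu>: "input_dist \<mu>" and I: "finite I" and f [measurable]: "f \<in> borel_measurable (PiM I (\<lambda>_. borel))"
  shows "(\<integral>\<^sup>+y. f y \<partial>PiM I (\<lambda>_. out \<mu>))
    = (\<integral>\<^sup>+z. (\<Prod>i\<in>I. ennreal (pY (x i + z i) \<mu> / phi (z i))) * f (\<lambda>i\<in>I. x i + z i) \<partial>PiM I (\<lambda>_. gauss))"
proof -
  note [measurable] = measurable_pY[OF \<mu>]
  interpret O: prob_space "out \<mu>" by (rule prob_space_out[OF \<mu>])
  interpret SO: product_sigma_finite "\<lambda>_::'i. out \<mu>" by standard
  interpret SG: product_sigma_finite "\<lambda>_::'i. gauss" by standard
  have [measurable_cong]: "sets (PiM I (\<lambda>_. gauss)) = sets (PiM I (\<lambda>_. borel))"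
    by (intro sets_PiM_cong) auto
  let ?w = "\<lambda>i z. ennreal (pY (x i + z) \<mu> / phi z)"
  let ?W = "\<lambda>z. \<Prod>i\<in>I. ?w i (z i)"
  let ?T = "\<lambda>z. \<lambda>i\<in>I. x i + z i"
  have W [measurable]: "?W \<in> borel_measurable (PiM I (\<lambda>_. gauss))"
    by (intro borel_measurable_prod_ennreal) measurable
  have T [measurable]: "?T \<in> measurable (PiM I (\<lambda>_. gauss)) (PiM I (\<lambda>_. borel))"
    by measurable
  have "distr (density (PiM I (\<lambda>_. gauss)) ?W) (PiM I (\<lambda>_. borel)) ?T = PiM I (\<lambda>_. out \<mu>)"
  proof (rule SO.PiM_eqI[OF I])
    show "sets (distr (density (PiM I (\<lambda>_. gauss)) ?W) (PiM I (\<lambda>_. borel)) ?T) = sets (PiM I (\<lambda>_. out \<mu>))"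
      by (simp cong: sets_PiM_cong)
    fix A assume "\<And>i. i \<in> I \<Longrightarrow> A i \<in> sets (out \<mu>)"
    then have A: "\<And>i. i \<in> I \<Longrightarrow> A i \<in> sets borel" by simp
    have box [measurable]: "Pi\<^sub>E I A \<in> sets (PiM I (\<lambda>_. borel))"
      using I A by (intro sets_PiM_I_finite) auto
    have "emeasure (distr (density (PiM I (\<lambda>_. gauss)) ?W) (PiM I (\<lambda>_. borel)) ?T) (Pi\<^sub>E I A)
      = (\<integral>\<^sup>+z. indicator (Pi\<^sub>E I A) (?T z) \<partial>density (PiM I (\<lambda>_. gauss)) ?W)"
      using box by (subst nn_integral_indicator[symmetric], simp, subst nn_integral_distr) auto
    also have "\<dots> = (\<integral>\<^sup>+z. ?W z * indicator (Pi\<^sub>E I A) (?T z) \<partial>PiM I (\<lambda>_. gauss))"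
      by (rule nn_integral_density) measurable
    also have "\<dots> = (\<integral>\<^sup>+z. (\<Prod>i\<in>I. ?w i (z i) * indicator (A i) (x i + z i)) \<partial>PiM I (\<lambda>_. gauss))"
      by (simp only: indicator_PiE_restrict[OF I] prod.distrib)
    also have "\<dots> = (\<Prod>i\<in>I. \<integral>\<^sup>+z. ?w i z * indicator (A i) (x i + z) \<partial>gauss)"
    proof (rule SG.product_nn_integral_prod[OF I, of "\<lambda>i z. ?w i z * indicator (A i) (x i + z)"])
      fix i assume "i \<in> I"
      note [measurable] = A[OF this]
      show "(\<lambda>z. ?w i z * indicator (A i) (x i + z)) \<in> borel_measurable gauss" by measurable
    qed
    also have "\<dots> = (\<Prod>i\<in>I. emeasure (out \<mu>) (A i))"
    proof (rule prod.cong[OF refl])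
      fix i assume "i \<in> I"
      note [measurable] = A[OF this]
      have "(\<integral>\<^sup>+z. ?w i z * indicator (A i) (x i + z) \<partial>gauss)
        = (\<integral>\<^sup>+z. ennreal (phi z) * (?w i z * indicator (A i) (x i + z)) \<partial>lborel)"
        unfolding gauss_def by (rule nn_integral_density) measurable
      also have "\<dots> = (\<integral>\<^sup>+z. ennreal (pY (x i + z) \<mu>) * indicator (A i) (x i + z) \<partial>lborel)"
        by (intro nn_integral_cong)
           (auto simp: mult.assoc[symmetric] ennreal_mult[symmetric] less_imp_neq[OF phi_pos, symmetric])
      also have "\<dots> = (\<integral>\<^sup>+y. ennreal (pY y \<mu>) * indicator (A i) y \<partial>lborel)"
        by (subst nn_integral_real_affine[where c = 1 and t = "x i"]) auto
      also have "\<dots> = emeasure (out \<mu>) (A i)"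
        unfolding out_def by (rule emeasure_density[symmetric]) measurable
      finally show "(\<integral>\<^sup>+z. ?w i z * indicator (A i) (x i + z) \<partial>gauss) = emeasure (out \<mu>) (A i)" .
    qed
    finally show "emeasure (distr (density (PiM I (\<lambda>_. gauss)) ?W) (PiM I (\<lambda>_. borel)) ?T) (Pi\<^sub>E I A)
      = (\<Prod>i\<in>I. emeasure (out \<mu>) (A i))" .
  qed
  then have "(\<integral>\<^sup>+y. f y \<partial>PiM I (\<lambda>_. out \<mu>))
    = (\<integral>\<^sup>+y. f y \<partial>distr (density (PiM I (\<lambda>_. gauss)) ?W) (PiM I (\<lambda>_. borel)) ?T)" by simp
  also have "\<dots> = (\<integral>\<^sup>+z. f (?T z) \<partial>density (PiM I (\<lambda>_. gauss)) ?W)"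
    by (rule nn_integral_distr) measurable
  also have "\<dots> = (\<integral>\<^sup>+z. ?W z * f (?T z) \<partial>PiM I (\<lambda>_. gauss))"
    by (rule nn_integral_density) measurable
  finally show ?thesis .
qed

lemma out_eq_distr:
  assumes "input_dist \<mu>"
  shows "out \<mu> = distr (\<mu> \<Otimes>\<^sub>M gauss) borel (\<lambda>p. fst p + snd p)"
proof (rule measure_eqI)
  note [measurable_cong] = input_dist_simps(1)[OF assms]
  interpret prob_space \<mu> using assms by (simp add: input_dist_def)
  fix A assume "A \<in> sets (out \<mu>)"
  then have [measurable]: "A \<in> sets borel" by simp
  have "emeasure (out \<mu>) A = (\<integral>\<^sup>+y. indicator A y \<partial>out \<mu>)" by simp
  also have "\<dots> = (\<integral>\<^sup>+x. \<integral>\<^sup>+z. indicator A (x + z) \<partial>gauss \<partial>\<mu>)"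
    by (rule nn_integral_out[OF assms]) simp
  also have "\<dots> = (\<integral>\<^sup>+p. indicator A (fst p + snd p) \<partial>(\<mu> \<Otimes>\<^sub>M gauss))"
    by (subst gauss.nn_integral_fst[symmetric]) auto
  also have "\<dots> = (\<integral>\<^sup>+y. indicator A y \<partial>distr (\<mu> \<Otimes>\<^sub>M gauss) borel (\<lambda>p. fst p + snd p))"
    by (rule nn_integral_distr[symmetric]) measurable
  finally show "emeasure (out \<mu>) A = emeasure (distr (\<mu> \<Otimes>\<^sub>M gauss) borel (\<lambda>p. fst p + snd p)) A"
    by simp
qed simp

lemma PiM_component_integral:
  fixes h :: "'a \<Rightarrow> real"
  assumes "prob_space K" "i \<in> I" "integrable K h"
  shows "integrable (PiM I (\<lambda>_. K)) (\<lambda>\<omega>. h (\<omega> i))" "(\<integral>\<omega>. h (\<omega> i) \<partial>PiM I (\<lambda>_. K)) = (\<integral>x. h x \<partial>K)"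
proof -
  interpret K: prob_space K by fact
  interpret product_prob_space "\<lambda>_. K" I by standard
  have eq: "distr (PiM I (\<lambda>_. K)) K (\<lambda>\<omega>. \<omega> i) = K"
    by (rule PiM_component[OF assms(2)])
  have m: "(\<lambda>\<omega>. \<omega> i) \<in> measurable (PiM I (\<lambda>_. K)) K"
    using assms(2) by (rule measurable_component_singleton)
  have h: "h \<in> borel_measurable K" using assms(3) by auto
  show "integrable (PiM I (\<lambda>_. K)) (\<lambda>\<omega>. h (\<omega> i))"
    using integrable_distr_eq[OF m h] assms(3) by (simp add: eq)
  show "(\<integral>\<omega>. h (\<omega> i) \<partial>PiM I (\<lambda>_. K)) = (\<integral>x. h x \<partial>K)"
    using integral_distr[OF m h] by (simp add: eq)
qed

text \<open>Chebyshev's inequality: mixed terms vanish by independence, which leaves a second moment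
  of at most n B^2.\<close>

lemma weak_law_bounded:
  fixes g :: "'a \<Rightarrow> real"
  assumes K: "prob_space K" and [measurable]: "g \<in> borel_measurable K" and B: "\<And>x. \<bar>g x\<bar> \<le> B"
    and mean: "(\<integral>x. g x \<partial>K) = 0" and \<delta>: "0 < \<delta>" and n: "0 < n"
  shows "measure (PiM {..<n} (\<lambda>_. K)) {\<omega> \<in> space (PiM {..<n} (\<lambda>_. K)). real n * \<delta> \<le> \<bar>\<Sum>i<n. g (\<omega> i)\<bar>}
    \<le> B\<^sup>2 / (real n * \<delta>\<^sup>2)"
proof -
  interpret K: prob_space K by fact
  interpret S: product_sigma_finite "\<lambda>_::nat. K" by standard
  interpret P: prob_space "PiM {..<n} (\<lambda>_. K)" by (intro prob_space_PiM K)
  let ?P = "PiM {..<n} (\<lambda>_. K)"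
  have m: "(\<lambda>\<omega>. g (\<omega> i)) \<in> borel_measurable ?P" if "i < n" for i
    by (rule measurable_compose[OF measurable_component_singleton]) (use that in auto)
  have intg: "integrable K g" by (rule K.integrable_const_bound[where B = B]) (auto simp: B)
  have B0: "0 \<le> B" using B[of undefined] by linarith
  have bb: "\<bar>g x * g y\<bar> \<le> B * B" for x y
    unfolding abs_mult using B B0 by (intro mult_mono) auto
  have int2: "integrable ?P (\<lambda>\<omega>. g (\<omega> i) * g (\<omega> j))" if "i < n" "j < n" for i j
    by (rule P.integrable_const_bound[where B = "B * B"]) (use m that bb in auto)
  have cov: "(\<integral>\<omega>. g (\<omega> i) * g (\<omega> j) \<partial>?P) \<le> (if i = j then B\<^sup>2 else 0)" if ij: "i < n" "j < n" for i j
  proof (cases "i = j")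
    case True
    have "(\<integral>\<omega>. g (\<omega> i) * g (\<omega> j) \<partial>?P) \<le> (\<integral>\<omega>. B * B \<partial>?P)"
      using bb by (intro integral_mono int2 ij) (auto intro: order_trans[OF abs_ge_self])
    then show ?thesis using True P.prob_space by (simp add: power2_eq_square)
  next
    case False
    \<comment> \<open>The product of two distinct coordinates is written over all coordinates with 1
      elsewhere; its integral then factorizes and contains a zero mean.\<close>
    let ?h = "\<lambda>k. if k \<in> {i, j} then g else (\<lambda>_. 1)"
    have "(\<integral>\<omega>. g (\<omega> i) * g (\<omega> j) \<partial>?P) = (\<integral>\<omega>. (\<Prod>k<n. ?h k (\<omega> k)) \<partial>?P)"
    proof (intro Bochner_Integration.integral_cong refl)
      fix \<omega>
      have "(\<Prod>k<n. ?h k (\<omega> k)) = (\<Prod>k<n. if k \<in> {i, j} then g (\<omega> k) else 1)"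
        by (intro prod.cong) auto
      also have "\<dots> = (\<Prod>k\<in>{..<n} \<inter> {i, j}. g (\<omega> k))"
        by (rule prod.inter_restrict[symmetric]) simp
      also have "{..<n} \<inter> {i, j} = {i, j}" using ij by auto
      finally show "g (\<omega> i) * g (\<omega> j) = (\<Prod>k<n. ?h k (\<omega> k))" using False by simp
    qed
    also have "\<dots> = (\<Prod>k<n. \<integral>x. ?h k x \<partial>K)"
      by (rule S.product_integral_prod) (use intg in auto)
    also have "\<dots> = 0"
      using ij mean by (intro prod_zero) (auto intro!: bexI[of _ i])
    finally show ?thesis using False by simp
  qed
  let ?S = "\<lambda>\<omega>. \<Sum>i<n. g (\<omega> i)"
  have sq: "(?S \<omega>)\<^sup>2 = (\<Sum>i<n. \<Sum>j<n. g (\<omega> i) * g (\<omega> j))" for \<omega>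
    by (simp add: power2_eq_square sum_product)
  have intS: "integrable ?P (\<lambda>\<omega>. (?S \<omega>)\<^sup>2)"
    unfolding sq by (intro Bochner_Integration.integrable_sum int2) auto
  have "(\<integral>\<omega>. (?S \<omega>)\<^sup>2 \<partial>?P) = (\<Sum>i<n. \<Sum>j<n. \<integral>\<omega>. g (\<omega> i) * g (\<omega> j) \<partial>?P)"
  proof -
    have "(\<integral>\<omega>. (?S \<omega>)\<^sup>2 \<partial>?P) = (\<Sum>i<n. \<integral>\<omega>. (\<Sum>j<n. g (\<omega> i) * g (\<omega> j)) \<partial>?P)"
      unfolding sq
      by (rule Bochner_Integration.integral_sum, rule Bochner_Integration.integrable_sum, rule int2) auto
    also have "\<dots> = (\<Sum>i<n. \<Sum>j<n. \<integral>\<omega>. g (\<omega> i) * g (\<omega> j) \<partial>?P)"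
      by (rule sum.cong[OF refl], rule Bochner_Integration.integral_sum, rule int2) auto
    finally show ?thesis .
  qed
  also have "\<dots> \<le> (\<Sum>i<n. \<Sum>j<n. if i = j then B\<^sup>2 else 0)"
    by (intro sum_mono cov) auto
  also have "\<dots> = real n * B\<^sup>2" by simp
  finally have le: "(\<integral>\<omega>. (?S \<omega>)\<^sup>2 \<partial>?P) \<le> real n * B\<^sup>2" .
  have "{\<omega> \<in> space ?P. real n * \<delta> \<le> \<bar>?S \<omega>\<bar>} = {\<omega> \<in> space ?P. (real n * \<delta>)\<^sup>2 \<le> (?S \<omega>)\<^sup>2}"
    using n \<delta> by (auto simp: abs_le_square_iff[symmetric])
  then have "measure ?P {\<omega> \<in> space ?P. real n * \<delta> \<le> \<bar>?S \<omega>\<bar>} \<le> (\<integral>\<omega>. (?S \<omega>)\<^sup>2 \<partial>?P) / (real n * \<delta>)\<^sup>2"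
    using integral_Markov_inequality_measure[OF intS sets.empty_sets, of "(real n * \<delta>)\<^sup>2"] n \<delta> by simp
  also have "\<dots> \<le> real n * B\<^sup>2 / (real n * \<delta>)\<^sup>2"
    by (intro divide_right_mono le) simp
  also have "\<dots> = B\<^sup>2 / (real n * \<delta>\<^sup>2)"
    using n \<delta> by (simp add: power2_eq_square field_simps)
  finally show ?thesis .
qed

text \<open>Truncation reduces the case of a finite first moment to the bounded case.\<close>
lemma weak_law:
  fixes K :: "real measure"
  assumes K: "prob_space K" and sets [measurable_cong]: "sets K = sets borel"
    and int: "integrable K (\<lambda>x. x)" and \<delta>: "0 < \<delta>"
  shows "(\<lambda>n. measure (PiM {..<n} (\<lambda>_. K)) {\<omega> \<in> space (PiM {..<n} (\<lambda>_. K)).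
           real n * \<delta> \<le> \<bar>(\<Sum>i<n. \<omega> i) - real n * (\<integral>x. x \<partial>K)\<bar>}) \<longlonglongrightarrow> 0"
proof (rule LIMSEQ_I)
  interpret K: prob_space K by fact
  fix \<epsilon> :: real assume \<epsilon>: "0 < \<epsilon>"
  \<comment> \<open>The bound \<delta>/3 controls the shift of the mean caused by truncation;
    \<delta>\<epsilon>/6 makes Markov's inequality for the tails give \<epsilon>/2.\<close>
  define \<eta> where "\<eta> = min (\<delta> / 3) (\<delta> * \<epsilon> / 6)"
  have \<eta>: "0 < \<eta>" "\<eta> \<le> \<delta> / 3" "\<eta> \<le> \<delta> * \<epsilon> / 6" using \<delta> \<epsilon> by (auto simp: \<eta>_def)
  let ?tail = "\<lambda>b x::real. if \<bar>x\<bar> \<le> real b then 0 else x"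
  have "(\<lambda>b. \<integral>x. \<bar>?tail b x\<bar> \<partial>K) \<longlonglongrightarrow> (\<integral>x. 0 \<partial>K)"
  proof (rule integral_dominated_convergence[where w = "\<lambda>x. \<bar>x\<bar>"])
    have "(\<lambda>b. \<bar>?tail b x\<bar>) \<longlonglongrightarrow> 0" for x :: real
    proof (rule tendsto_eventually)
      obtain b0 :: nat where "\<bar>x\<bar> \<le> real b0" using real_arch_simple by blast
      then have "\<forall>b\<ge>b0. \<bar>?tail b x\<bar> = 0" by (auto dest: order_trans simp: of_nat_le_iff)
      then show "eventually (\<lambda>b. \<bar>?tail b x\<bar> = 0) sequentially" 
        unfolding eventually_sequentially by blast
    qed
    then show "AE x in K. (\<lambda>b. \<bar>?tail b x\<bar>) \<longlonglongrightarrow> 0" by simp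
    show "AE x in K. norm \<bar>?tail b x\<bar> \<le> \<bar>x\<bar>" for b by simp
    show "(\<lambda>x. \<bar>?tail b x\<bar>) \<in> borel_measurable K" for b by measurable
    show "integrable K (\<lambda>x. \<bar>x\<bar>)" by (rule integrable_abs[OF int])
  qed simp
  from order_tendstoD(2)[OF this, of \<eta>] \<eta>(1)
  have "eventually (\<lambda>b. (\<integral>x. \<bar>?tail b x\<bar> \<partial>K) < \<eta>) sequentially" by simp
  then obtain b where b: "(\<integral>x. \<bar>?tail b x\<bar> \<partial>K) < \<eta>"
    unfolding eventually_sequentially by blast
  \<comment> \<open>The tail, to be controlled in mean; g below is the truncated remainder, centered
    and bounded by 2b.\<close>
  define h where "h x = ?tail b x" for x
  have [measurable]: "h \<in> borel_measurable borel" unfolding h_def by measurable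
  have inth: "integrable K h"
    by (rule Bochner_Integration.integrable_bound[OF int]) (auto simp: h_def)
  define m where "m = (\<integral>x. x - h x \<partial>K)"
  define g where "g x = x - h x - m" for x
  have gb: "\<bar>x - h x\<bar> \<le> real b" for x by (auto simp: h_def)
  have "\<bar>m\<bar> \<le> (\<integral>x. \<bar>x - h x\<bar> \<partial>K)" unfolding m_def by (rule integral_abs_bound)
  also have "\<dots> \<le> (\<integral>x. real b \<partial>K)"
    using int inth by (intro integral_mono gb) auto
  finally have mb: "\<bar>m\<bar> \<le> real b" by (simp add: K.prob_space)
  define B where "B = 2 * real b"
  have B: "\<bar>g x\<bar> \<le> B" for x using gb[of x] mb by (simp add: g_def B_def)
  have g0: "(\<integral>x. g x \<partial>K) = 0"
    using int inth by (simp add: g_def m_def K.prob_space)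
  have mh: "\<bar>(\<integral>x. x \<partial>K) - m\<bar> \<le> \<eta>"
  proof -
    have "(\<integral>x. x \<partial>K) - m = (\<integral>x. h x \<partial>K)" using int inth by (simp add: m_def)
    also have "\<bar>\<dots>\<bar> \<le> (\<integral>x. \<bar>h x\<bar> \<partial>K)" by (rule integral_abs_bound)
    also have "\<dots> < \<eta>" using b by (simp add: h_def)
    finally show ?thesis by simp
  qed
  \<comment> \<open>Makes the variance term 9 B^2 / (n \<delta>^2) smaller than
    \<epsilon>/2.\<close>
  obtain N :: nat where N: "2 * B\<^sup>2 * 9 / (\<delta>\<^sup>2 * \<epsilon>) < real N" using reals_Archimedean2 by blast
  have "measure (PiM {..<n} (\<lambda>_. K)) {\<omega> \<in> space (PiM {..<n} (\<lambda>_. K)).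
           real n * \<delta> \<le> \<bar>(\<Sum>i<n. \<omega> i) - real n * (\<integral>x. x \<partial>K)\<bar>} < \<epsilon>" if n: "Suc N \<le> n" for n
  proof -
    let ?P = "PiM {..<n} (\<lambda>_. K)"
    interpret P: prob_space ?P by (intro prob_space_PiM K)
    have n0: "0 < n" using n by simp
    let ?A = "{\<omega> \<in> space ?P. real n * (\<delta> / 3) \<le> \<bar>\<Sum>i<n. g (\<omega> i)\<bar>}"
    let ?C = "{\<omega> \<in> space ?P. real n * (\<delta> / 3) \<le> (\<Sum>i<n. \<bar>h (\<omega> i)\<bar>)}"
    have gm [measurable]: "g \<in> borel_measurable borel" unfolding g_def by measurable
    have mg: "(\<lambda>\<omega>. g (\<omega> i)) \<in> borel_measurable ?P" "(\<lambda>\<omega>. \<bar>h (\<omega> i)\<bar>) \<in> borel_measurable ?P" if "i < n" for i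
      using that by (auto intro!: measurable_compose[OF measurable_component_singleton] simp: measurable_cong_sets[OF sets refl])
    have AC: "?A \<in> sets ?P" "?C \<in> sets ?P"
    proof -
      have "(\<lambda>\<omega>. \<bar>\<Sum>i<n. g (\<omega> i)\<bar>) \<in> borel_measurable ?P" "(\<lambda>\<omega>. \<Sum>i<n. \<bar>h (\<omega> i)\<bar>) \<in> borel_measurable ?P"
        using mg by (auto intro!: borel_measurable_sum borel_measurable_abs)
      then show "?A \<in> sets ?P" "?C \<in> sets ?P" by measurable
    qed
    \<comment> \<open>The deviation splits into truncated part, tail part and shift of the mean. The
      last takes at most a third of n \<delta>, so one of the others must reach a third.\<close>
    have "{\<omega> \<in> space ?P. real n * \<delta> \<le> \<bar>(\<Sum>i<n. \<omega> i) - real n * (\<integral>x. x \<partial>K)\<bar>} \<subseteq> ?A \<union> ?C"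
    proof
      fix \<omega> assume *: "\<omega> \<in> {\<omega> \<in> space ?P. real n * \<delta> \<le> \<bar>(\<Sum>i<n. \<omega> i) - real n * (\<integral>x. x \<partial>K)\<bar>}"
      have "(\<Sum>i<n. \<omega> i) - real n * (\<integral>x. x \<partial>K)
        = (\<Sum>i<n. g (\<omega> i)) + (\<Sum>i<n. h (\<omega> i)) - real n * ((\<integral>x. x \<partial>K) - m)"
        by (simp add: g_def sum_subtractf sum.distrib algebra_simps)
      moreover have "\<bar>\<Sum>i<n. h (\<omega> i)\<bar> \<le> (\<Sum>i<n. \<bar>h (\<omega> i)\<bar>)" by (rule sum_abs)
      moreover have "\<bar>real n * ((\<integral>x. x \<partial>K) - m)\<bar> \<le> real n * (\<delta> / 3)"
        unfolding abs_mult using mh \<eta>(2) by (intro mult_mono) auto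
      moreover have "real n * \<delta> \<le> \<bar>(\<Sum>i<n. \<omega> i) - real n * (\<integral>x. x \<partial>K)\<bar>" using * by simp
      ultimately have "real n * \<delta> \<le> \<bar>\<Sum>i<n. g (\<omega> i)\<bar> + (\<Sum>i<n. \<bar>h (\<omega> i)\<bar>) + real n * (\<delta> / 3)"
        by linarith
      moreover have "real n * \<delta> = 3 * (real n * (\<delta> / 3))" by simp
      ultimately have "real n * (\<delta> / 3) \<le> \<bar>\<Sum>i<n. g (\<omega> i)\<bar> \<or> real n * (\<delta> / 3) \<le> (\<Sum>i<n. \<bar>h (\<omega> i)\<bar>)"
        by linarith
      then show "\<omega> \<in> ?A \<union> ?C" using * by blast
    qed
    then have "measure ?P {\<omega> \<in> space ?P. real n * \<delta> \<le> \<bar>(\<Sum>i<n. \<omega> i) - real n * (\<integral>x. x \<partial>K)\<bar>}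
      \<le> measure ?P (?A \<union> ?C)"
      using AC by (intro P.finite_measure_mono) auto
    also have "\<dots> \<le> measure ?P ?A + measure ?P ?C"
      by (rule measure_Un_le[OF AC])
    also have "measure ?P ?A \<le> B\<^sup>2 / (real n * (\<delta> / 3)\<^sup>2)"
      by (rule weak_law_bounded[OF K _ B g0 _ n0]) (use \<delta> in auto)
    also have "B\<^sup>2 / (real n * (\<delta> / 3)\<^sup>2) < \<epsilon> / 2"
    proof -
      have "2 * B\<^sup>2 * 9 / (\<delta>\<^sup>2 * \<epsilon>) < real n" using N n by linarith
      then have "2 * B\<^sup>2 * 9 < real n * (\<delta>\<^sup>2 * \<epsilon>)"
        using \<delta> \<epsilon> by (simp add: pos_divide_less_eq)
      then show ?thesis using \<delta> n0 by (simp add: power_divide field_simps)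
    qed
    also have "measure ?P ?C \<le> \<epsilon> / 2"
    proof -
      have hi: "integrable K (\<lambda>x. \<bar>h x\<bar>)" using inth by simp
      note comp = PiM_component_integral[OF K _ hi, of _ "{..<n}"]
      have "measure ?P ?C \<le> (\<integral>\<omega>. (\<Sum>i<n. \<bar>h (\<omega> i)\<bar>) \<partial>?P) / (real n * (\<delta> / 3))"
        by (rule integral_Markov_inequality_measure[OF _ sets.empty_sets])
           (use \<delta> n0 comp in \<open>auto intro!: Bochner_Integration.integrable_sum sum_nonneg\<close>)
      also have "(\<integral>\<omega>. (\<Sum>i<n. \<bar>h (\<omega> i)\<bar>) \<partial>?P) = real n * (\<integral>x. \<bar>h x\<bar> \<partial>K)"
        using comp by (subst Bochner_Integration.integral_sum) auto
      also have "real n * (\<integral>x. \<bar>h x\<bar> \<partial>K) / (real n * (\<delta> / 3)) = (\<integral>x. \<bar>h x\<bar> \<partial>K) / (\<delta> / 3)"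
        using n0 by simp
      also have "\<dots> \<le> \<eta> / (\<delta> / 3)"
        using b \<delta> by (intro divide_right_mono) (auto simp: h_def)
      also have "\<dots> \<le> \<epsilon> / 2"
        using \<eta>(3) \<delta> by (simp add: field_simps)
      finally show ?thesis .
    qed
    finally show ?thesis by simp
  qed
  then show "\<exists>no. \<forall>n\<ge>no. norm (measure (PiM {..<n} (\<lambda>_. K)) {\<omega> \<in> space (PiM {..<n} (\<lambda>_. K)).
           real n * \<delta> \<le> \<bar>(\<Sum>i<n. \<omega> i) - real n * (\<integral>x. x \<partial>K)\<bar>} - 0) < \<epsilon>"
    by (intro exI[of _ "Suc N"]) auto
qed

section \<open>Converse\<close>

lemma noise_eq_PiM: "noise n = PiM {..<n} (\<lambda>_. gauss)"
  by (simp add: noise_def gauss_def)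

lemma prob_space_noise: "prob_space (noise n)"
  unfolding noise_eq_PiM by (intro prob_space_PiM gauss.prob_space_axioms)

lemma sets_noise [measurable_cong]: "sets (noise n) = sets (PiM {..<n} (\<lambda>_. borel))"
  unfolding noise_eq_PiM by (intro sets_PiM_cong) auto

abbreviation shift :: "nat \<Rightarrow> (nat \<Rightarrow> real) \<Rightarrow> (nat \<Rightarrow> real) \<Rightarrow> nat \<Rightarrow> real" where
  "shift n x z \<equiv> \<lambda>i\<in>{..<n}. x i + z i"

text \<open>The information density of codeword and output against the product output law, as a
  function of the noise z.\<close>

definition info :: "nat \<Rightarrow> real measure \<Rightarrow> (nat \<Rightarrow> real) \<Rightarrow> (nat \<Rightarrow> real) \<Rightarrow> real" where
  "info n \<mu> x z = (\<Sum>i<n. ln (phi (z i) / pY (x i + z i) \<mu>))"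

lemma measurable_shift [measurable]: "shift n x \<in> measurable (noise n) (PiM {..<n} (\<lambda>_. borel))"
  by measurable

lemma measurable_info [measurable]:
  assumes "input_dist \<mu>"
  shows "info n \<mu> x \<in> borel_measurable (noise n)"
proof -
  note [measurable] = measurable_pY[OF assms]
  show ?thesis unfolding info_def by measurable
qed

lemma prod_likelihood_ratio:
  assumes "input_dist \<mu>"
  shows "(\<Prod>i<n. pY (x i + z i) \<mu> / phi (z i)) = exp (- info n \<mu> x z)"
proof -
  have "exp (- info n \<mu> x z) = (\<Prod>i<n. exp (- ln (phi (z i) / pY (x i + z i) \<mu>)))"
    unfolding info_def by (simp add: exp_sum flip: sum_negf)
  also have "\<dots> = (\<Prod>i<n. pY (x i + z i) \<mu> / phi (z i))"
    by (intro prod.cong refl) (simp add: exp_minus pY_pos[OF assms])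
  finally show ?thesis by simp
qed

text \<open>With f = 1 this says that exp(-info) has mean 1 under the noise; with an indicator it
  expresses output probabilities through any chosen codeword.\<close>

lemma nn_integral_out_noise:
  assumes "input_dist \<mu>" "f \<in> borel_measurable (PiM {..<n} (\<lambda>_. borel))"
  shows "(\<integral>\<^sup>+y. f y \<partial>PiM {..<n} (\<lambda>_. out \<mu>)) = (\<integral>\<^sup>+z. ennreal (exp (- info n \<mu> x z)) * f (shift n x z) \<partial>noise n)"
  unfolding nn_integral_PiM_out_shift[OF assms(1) finite_lessThan assms(2), of x] noise_eq_PiM
  by (intro nn_integral_cong arg_cong2[where f = "(*)"] refl)
     (simp add: prod_ennreal prod_likelihood_ratio[OF assms(1)] less_imp_le[OF phi_pos])

lemma prob_space_PiM_out: "input_dist \<mu> \<Longrightarrow> prob_space (PiM I (\<lambda>_. out \<mu>))"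
  by (intro prob_space_PiM prob_space_out)

lemma sets_PiM_out [measurable_cong]: "sets (PiM I (\<lambda>_. out \<mu>)) = sets (PiM I (\<lambda>_. borel))"
  by (intro sets_PiM_cong) auto

lemma space_PiM_out: "space (PiM I (\<lambda>_. out \<mu>)) = space (PiM I (\<lambda>_. borel))"
  by (rule sets_eq_imp_space_eq[OF sets_PiM_out])

lemma integral_info_density:
  assumes "\<nu> \<in> atomic_input q"
  shows "integrable gauss (\<lambda>z. ln (phi z / pY (x + z) \<nu>))"
    and "(\<integral>z. ln (phi z / pY (x + z) \<nu>) \<partial>gauss) = dens x \<nu>"
proof -
  have eq: "ln (phi z / pY (x + z) \<nu>) = ln (phi z) + - ln (pY (x + z) \<nu>)" for z
    using pY_pos[OF atomic_inputD[OF assms]] by (simp add: ln_divide_pos)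
  show "integrable gauss (\<lambda>z. ln (phi z / pY (x + z) \<nu>))"
    unfolding eq by (intro Bochner_Integration.integrable_add integrable_gauss_ln_phi integrable_cross[OF assms])
  show "(\<integral>z. ln (phi z / pY (x + z) \<nu>) \<partial>gauss) = dens x \<nu>"
    unfolding eq dens_eq_cross[OF assms] cross_def noise_entropy_def
    by (subst Bochner_Integration.integral_add[OF integrable_gauss_ln_phi integrable_cross[OF assms]]) simp
qed

lemma integral_info:
  assumes "\<nu> \<in> atomic_input q"
  shows "integrable (noise n) (info n \<nu> x)" "(\<integral>z. info n \<nu> x z \<partial>noise n) = (\<Sum>i<n. dens (x i) \<nu>)"
proof -
  note comp = PiM_component_integral[OF gauss.prob_space_axioms _ integral_info_density(1)[OF assms]]
  have int: "integrable (noise n) (\<lambda>z. ln (phi (z i) / pY (x i + z i) \<nu>))" if "i < n" for i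
    unfolding noise_eq_PiM using comp(1)[of i "{..<n}" "x i"] that by simp
  show "integrable (noise n) (info n \<nu> x)"
    unfolding info_def by (intro Bochner_Integration.integrable_sum int) simp
  have "(\<integral>z. info n \<nu> x z \<partial>noise n) = (\<Sum>i<n. \<integral>z. ln (phi (z i) / pY (x i + z i) \<nu>) \<partial>noise n)"
    unfolding info_def by (rule Bochner_Integration.integral_sum) (simp add: int)
  also have "\<dots> = (\<Sum>i<n. dens (x i) \<nu>)"
    unfolding noise_eq_PiM
  proof (intro sum.cong refl)
    fix i assume "i \<in> {..<n}"
    then show "(\<integral>z. ln (phi (z i) / pY (x i + z i) \<nu>) \<partial>PiM {..<n} (\<lambda>_. gauss)) = dens (x i) \<nu>"
      using comp(2)[of i "{..<n}" "x i"] integral_info_density(2)[OF assms] by simp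
  qed
  finally show "(\<integral>z. info n \<nu> x z \<partial>noise n) = (\<Sum>i<n. dens (x i) \<nu>)" .
qed

lemma card_eq_sum_if: "real (card {i. i < (n::nat) \<and> P i}) = (\<Sum>i<n. if P i then 1 else 0 :: real)"
proof -
  have "{i. i < n \<and> P i} = {..<n} \<inter> {i. P i}" by auto
  then have "real (card {i. i < n \<and> P i}) = (\<Sum>i\<in>{..<n} \<inter> {i. P i}. 1)" by simp
  also have "\<dots> = (\<Sum>i<n. if P i then 1 else 0)"
    by (subst sum.inter_restrict) auto
  finally show ?thesis .
qed

section \<open>Converse against the optimal output law\<close>

context optimal_input
begin

text \<open>The KKT conditions bound the divergence from every admissible codeword to the optimal output law,
  which replaces the chain rule for mutual information in the converse.\<close>
lemma codeword_dens_le: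
  assumes "real (card {i. i < n \<and> x i \<noteq> 0}) \<le> (1 - q) * real n" "(\<Sum>i<n. (x i)\<^sup>2) \<le> \<gamma> * real n"
  shows "(\<Sum>i<n. dens (x i) \<mu>) \<le> real n * MI \<mu>"
proof -
  obtain l k where lk: "KKT l k" by (rule KKT_exists)
  have k0: "0 \<le> k - c 0" and l: "0 < l" and keq: "(1 - q) * k = H - l * \<gamma> - q * c 0"
    using lk unfolding KKT_def by (auto dest: spec[of _ 0])
  let ?N = "\<Sum>i<n. if x i \<noteq> 0 then 1 else 0 :: real"
  \<comment> \<open>At letters equal to 0 the sharper value c(0) is kept, so that k - c(0) prices a
    nonzero letter and l prices power. Both prices are nonnegative, so both codeword constraints can
    be inserted.\<close>
  have "(\<Sum>i<n. c (x i)) \<le> (\<Sum>i<n. c 0 + (k - c 0) * (if x i \<noteq> 0 then 1 else 0) + l * (x i)\<^sup>2)"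
  proof (rule sum_mono)
    fix i
    have "c (x i) \<le> l * (x i)\<^sup>2 + k" using lk unfolding KKT_def by blast
    then show "c (x i) \<le> c 0 + (k - c 0) * (if x i \<noteq> 0 then 1 else 0) + l * (x i)\<^sup>2" by simp
  qed
  also have "\<dots> = real n * c 0 + (k - c 0) * ?N + l * (\<Sum>i<n. (x i)\<^sup>2)"
    by (simp only: sum.distrib sum_distrib_left[symmetric] sum_constant card_lessThan)
  also have "\<dots> \<le> real n * c 0 + (k - c 0) * ((1 - q) * real n) + l * (\<gamma> * real n)"
    using assms k0 l unfolding card_eq_sum_if by (intro add_mono mult_left_mono order_refl) auto
  also have "\<dots> = real n * (q * c 0 + (1 - q) * k + l * \<gamma>)" by (simp add: algebra_simps)
  also have "\<dots> = real n * H" by (simp add: keq)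
  finally show ?thesis
    by (simp add: dens_eq_cross[OF optimal_simps(2)] sum_subtractf
        MI_eq_cross_entropy[OF optimal_simps(1,2)] right_diff_distrib)
qed

text \<open>Integrates e^u \<ge> 1 + u, with u = ln M - info on correct decoding and u = -info
  otherwise. The means of the exponentials are known by change of measure: M times the output
  probability of decoding m, and at most 1.\<close>

lemma converse_bound_message:
  assumes code: "valid_code \<gamma> q n M enc dec" and m: "m < M" and err: "err_prob n enc dec m \<le> \<epsilon>"
  shows "(1 - \<epsilon>) * ln (real M) \<le> real n * MI \<mu>
    + real M * measure (PiM {..<n} (\<lambda>_. out \<mu>)) {y \<in> space (PiM {..<n} (\<lambda>_. out \<mu>)). dec y = m}"
proof -
  define x where "x = enc m"
  have M: "1 \<le> real M" using code by (simp add: valid_code_def)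
  have dec [measurable]: "dec \<in> measurable (PiM {..<n} (\<lambda>_. borel)) (count_space UNIV)"
    using code by (simp add: valid_code_def)
  note [measurable] = measurable_info[OF optimal_simps(3)]
  interpret Z: prob_space "noise n" by (rule prob_space_noise)
  let ?Q = "PiM {..<n} (\<lambda>_. out \<mu>)"
  interpret Q: prob_space ?Q by (rule prob_space_PiM_out[OF optimal_simps(3)])
  let ?A = "{z \<in> space (noise n). dec (shift n x z) = m}"
  let ?V = "\<lambda>z. exp (- info n \<mu> x z)"
  have A [measurable]: "?A \<in> sets (noise n)" by measurable
  have D [measurable]: "{y \<in> space ?Q. dec y = m} \<in> sets ?Q"
    unfolding space_PiM_out sets_PiM_out by measurable
  have V1: "(\<integral>\<^sup>+z. ennreal (?V z) \<partial>noise n) = 1"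
    using nn_integral_out_noise[OF optimal_simps(3), of "\<lambda>_. 1" n x] Q.emeasure_space_1 by simp
  have intV: "integrable (noise n) ?V"
    by (rule integrableI_nonneg) (auto simp: V1)
  have EV: "(\<integral>z. ?V z \<partial>noise n) = 1"
    using V1 by (subst (asm) nn_integral_eq_integral[OF intV]) (auto simp: ennreal_eq_1)
  have intVA: "integrable (noise n) (\<lambda>z. indicator ?A z * ?V z)"
    by (rule Bochner_Integration.integrable_bound[OF intV]) (auto split: split_indicator)
  have "ennreal (\<integral>z. indicator ?A z * ?V z \<partial>noise n) = (\<integral>\<^sup>+z. ennreal (indicator ?A z * ?V z) \<partial>noise n)"
    by (rule nn_integral_eq_integral[OF intVA, symmetric]) auto
  also have "\<dots> = (\<integral>\<^sup>+z. ennreal (?V z) * indicator {y \<in> space ?Q. dec y = m} (shift n x z) \<partial>noise n)"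
    by (intro nn_integral_cong)
       (auto split: split_indicator simp: space_PiM_out space_PiM PiE_iff)
  also have "\<dots> = (\<integral>\<^sup>+y. indicator {y \<in> space ?Q. dec y = m} y \<partial>?Q)"
    by (rule nn_integral_out_noise[OF optimal_simps(3), symmetric]) (use D in \<open>simp add: sets_PiM_out\<close>)
  also have "\<dots> = ennreal (measure ?Q {y \<in> space ?Q. dec y = m})"
    using D by (simp add: Q.emeasure_eq_measure)
  finally have EVA: "(\<integral>z. indicator ?A z * ?V z \<partial>noise n) = measure ?Q {y \<in> space ?Q. dec y = m}"
    by (subst (asm) ennreal_inj) (auto intro!: integral_nonneg_AE)
  have pt: "1 + indicator ?A z * ln (real M) - (real M * (indicator ?A z * ?V z) + ?V z) \<le> info n \<mu> x z" for z
  proof (cases "z \<in> ?A")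
    case True
    have "1 + (ln (real M) - info n \<mu> x z) \<le> exp (ln (real M) - info n \<mu> x z)"
      by (rule exp_ge_add_one_self)
    also have "\<dots> = real M * ?V z" using M by (simp add: exp_diff exp_minus divide_inverse)
    finally have "1 + (ln (real M) - info n \<mu> x z) \<le> real M * ?V z" .
    moreover have "indicator ?A z = (1::real)" using True by simp
    moreover have "0 < ?V z" by (rule exp_gt_zero)
    ultimately show ?thesis by (simp only: mult_1)
  next
    case False
    then show ?thesis using exp_ge_add_one_self[of "- info n \<mu> x z"] by simp
  qed
  have intA: "integrable (noise n) (\<lambda>z. indicator ?A z * ln (real M))"
    by (intro integrable_mult_left integrable_real_indicator A) (auto simp: Z.emeasure_eq_measure)
  have intR: "integrable (noise n) (\<lambda>z. real M * (indicator ?A z * ?V z) + ?V z)"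
    by (intro Bochner_Integration.integrable_add integrable_mult_right intVA intV)
  have intL: "integrable (noise n) (\<lambda>z. 1 + indicator ?A z * ln (real M))"
    by (intro Bochner_Integration.integrable_add intA) simp
  have PA: "1 - \<epsilon> \<le> measure (noise n) ?A"
  proof -
    have "space (noise n) - ?A = {z \<in> space (noise n). dec (\<lambda>i\<in>{..<n}. enc m i + z i) \<noteq> m}"
      by (auto simp: x_def)
    then show ?thesis
      using Z.prob_compl[OF A] err by (simp add: err_prob_def)
  qed
  have "(1 - \<epsilon>) * ln (real M) \<le> measure (noise n) ?A * ln (real M)"
    using M by (intro mult_right_mono PA) auto
  also have "\<dots> = (\<integral>z. 1 + indicator ?A z * ln (real M) \<partial>noise n) - 1"
    by (subst Bochner_Integration.integral_add[OF _ intA]) (auto simp: Z.prob_space Int_absorb2)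
  also have "\<dots> = (\<integral>z. 1 + indicator ?A z * ln (real M) - (real M * (indicator ?A z * ?V z) + ?V z) \<partial>noise n)
      + (\<integral>z. real M * (indicator ?A z * ?V z) + ?V z \<partial>noise n) - 1"
    by (subst Bochner_Integration.integral_diff[OF intL intR]) simp
  also have "(\<integral>z. real M * (indicator ?A z * ?V z) + ?V z \<partial>noise n)
      = real M * measure ?Q {y \<in> space ?Q. dec y = m} + 1"
    by (subst Bochner_Integration.integral_add[OF integrable_mult_right[OF intVA] intV])
       (simp only: integral_mult_right_zero EVA EV)
  also have "(\<integral>z. 1 + indicator ?A z * ln (real M) - (real M * (indicator ?A z * ?V z) + ?V z) \<partial>noise n)
      \<le> (\<integral>z. info n \<mu> x z \<partial>noise n)"
    by (intro integral_mono pt Bochner_Integration.integrable_diff intL intR integral_info(1)[OF optimal_simps(2)])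
  also have "\<dots> \<le> real n * MI \<mu>"
    unfolding integral_info(2)[OF optimal_simps(2)]
    using code m by (intro codeword_dens_le) (auto simp: valid_code_def x_def)
  finally show ?thesis by simp
qed

text \<open>Averaged over messages, the output probabilities of the disjoint decoding regions sum to
  at most 1, and this is the additive constant.\<close>

lemma converse_bound:
  assumes code: "valid_code \<gamma> q n M enc dec" and err: "\<And>m. m < M \<Longrightarrow> err_prob n enc dec m \<le> \<epsilon>"
  shows "(1 - \<epsilon>) * ln (real M) \<le> real n * MI \<mu> + 1"
proof -
  let ?Q = "PiM {..<n} (\<lambda>_. out \<mu>)"
  interpret Q: prob_space ?Q by (rule prob_space_PiM_out[OF optimal_simps(3)])
  have M: "0 < real M" using code by (simp add: valid_code_def)
  have dec [measurable]: "dec \<in> measurable (PiM {..<n} (\<lambda>_. borel)) (count_space UNIV)"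
    using code by (simp add: valid_code_def)
  let ?D = "\<lambda>m. {y \<in> space ?Q. dec y = m}"
  have D: "?D m \<in> sets ?Q" for m
    unfolding space_PiM_out sets_PiM_out by measurable
  have "(\<Sum>m<M. measure ?Q (?D m)) = measure ?Q (\<Union>m<M. ?D m)"
    by (rule Q.finite_measure_finite_Union[symmetric]) (use D in \<open>auto simp: disjoint_family_on_def\<close>)
  then have sum_le: "(\<Sum>m<M. measure ?Q (?D m)) \<le> 1" by simp
  have "real M * ((1 - \<epsilon>) * ln (real M)) = (\<Sum>m<M. (1 - \<epsilon>) * ln (real M))" by simp
  also have "\<dots> \<le> (\<Sum>m<M. real n * MI \<mu> + real M * measure ?Q (?D m))"
    using converse_bound_message[OF code _ err] by (intro sum_mono) simp
  also have "\<dots> = real M * (real n * MI \<mu>) + real M * (\<Sum>m<M. measure ?Q (?D m))"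
    by (simp add: sum.distrib sum_distrib_left)
  also have "\<dots> \<le> real M * (real n * MI \<mu>) + real M * 1"
    using M sum_le by (intro add_left_mono mult_left_mono) auto
  finally have "real M * ((1 - \<epsilon>) * ln (real M)) \<le> real M * (real n * MI \<mu> + 1)"
    by (simp only: distrib_left)
  then show ?thesis using M by (simp only: mult_le_cancel_left_pos)
qed

text \<open>Error tolerance and rate loss are both \<epsilon>, as \<open>achievable\<close> provides
  them. The constant of \<open>converse_bound\<close> disappears on division by n, and \<epsilon>
  tends to 0 afterwards.\<close>

lemma achievable_le_MI:
  assumes "achievable \<gamma> q R"
  shows "R \<le> MI \<mu>"
proof -
  have bound: "(1 - \<epsilon>) * (R - \<epsilon>) \<le> MI \<mu>" if \<epsilon>: "0 < \<epsilon>" "\<epsilon> < 1" for \<epsilon>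
  proof (rule ccontr)
    assume "\<not> (1 - \<epsilon>) * (R - \<epsilon>) \<le> MI \<mu>"
    then have d: "0 < (1 - \<epsilon>) * (R - \<epsilon>) - MI \<mu>" by simp
    obtain N where N: "\<And>n. n \<ge> N \<Longrightarrow> \<exists>M enc dec.
        valid_code \<gamma> q n M enc dec \<and> real M \<ge> exp (real n * (R - \<epsilon>)) \<and>
        (\<forall>m<M. err_prob n enc dec m \<le> \<epsilon>)"
      using assms \<epsilon>(1) unfolding achievable_def by meson
    obtain n0 :: nat where n0: "1 / ((1 - \<epsilon>) * (R - \<epsilon>) - MI \<mu>) < real n0" using reals_Archimedean2 by blast
    define n where "n = max N n0"
    obtain M enc dec where code: "valid_code \<gamma> q n M enc dec" "exp (real n * (R - \<epsilon>)) \<le> real M"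
      "\<And>m. m < M \<Longrightarrow> err_prob n enc dec m \<le> \<epsilon>"
      using N[of n] unfolding n_def by auto
    have "ln (exp (real n * (R - \<epsilon>))) \<le> ln (real M)"
      by (rule ln_mono[OF code(2)]) simp
    then have "(1 - \<epsilon>) * (real n * (R - \<epsilon>)) \<le> (1 - \<epsilon>) * ln (real M)"
      using \<epsilon> by (intro mult_left_mono) auto
    also have "\<dots> \<le> real n * MI \<mu> + 1" by (rule converse_bound[OF code(1,3)])
    finally have "real n * ((1 - \<epsilon>) * (R - \<epsilon>) - MI \<mu>) \<le> 1" by (simp add: algebra_simps)
    moreover have "1 < real n * ((1 - \<epsilon>) * (R - \<epsilon>) - MI \<mu>)"
    proof -
      have "1 / ((1 - \<epsilon>) * (R - \<epsilon>) - MI \<mu>) < real n" using n0 by (simp add: n_def)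
      then show ?thesis using pos_divide_less_eq[OF d] by blast
    qed
    ultimately show False by simp
  qed
  show ?thesis
  proof (rule LIMSEQ_le_const2)
    have t: "(\<lambda>k. 1 / real (Suc k)) \<longlonglongrightarrow> 0"
      using LIMSEQ_inverse_real_of_nat by (simp add: inverse_eq_divide)
    have "(\<lambda>k. (1 - 1 / real (Suc k)) * (R - 1 / real (Suc k))) \<longlonglongrightarrow> (1 - 0) * (R - 0)"
      by (intro tendsto_intros t)
    then show "(\<lambda>k. (1 - 1 / real (Suc k)) * (R - 1 / real (Suc k))) \<longlonglongrightarrow> R" by simp
    \<comment> \<open>The index k = 0 would mean \<epsilon> = 1, where the bound on error
      probability says nothing.\<close>
    show "\<exists>N. \<forall>k\<ge>N. (1 - 1 / real (Suc k)) * (R - 1 / real (Suc k)) \<le> MI \<mu>"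
      by (intro exI[of _ 1] allI impI bound) auto
  qed
qed

end

section \<open>Achievability\<close>

text \<open>By \<open>PiM_distr_pair\<close> the values of g at the successive pairs of letter and
  noise form one i.i.d. sequence, to which \<open>weak_law\<close> applies.\<close>

lemma weak_law_pair:
  assumes \<mu>: "input_dist \<mu>" and g [measurable]: "g \<in> borel_measurable (borel \<Otimes>\<^sub>M borel)"
    and int: "integrable (\<mu> \<Otimes>\<^sub>M gauss) g" and \<delta>: "0 < \<delta>"
  shows "(\<lambda>n. measure (PiM {..<n} (\<lambda>_. \<mu>) \<Otimes>\<^sub>M noise n)
    {p \<in> space (PiM {..<n} (\<lambda>_. \<mu>) \<Otimes>\<^sub>M noise n).
      real n * \<delta> \<le> \<bar>(\<Sum>i<n. g (fst p i, snd p i)) - real n * (\<integral>q. g q \<partial>(\<mu> \<Otimes>\<^sub>M gauss))\<bar>}) \<longlonglongrightarrow> 0"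
proof -
  note [measurable_cong] = input_dist_simps(1)[OF \<mu>]
  interpret \<mu>: prob_space \<mu> using \<mu> by (simp add: input_dist_def)
  interpret pair_prob_space \<mu> gauss ..
  have gm [measurable]: "g \<in> borel_measurable (\<mu> \<Otimes>\<^sub>M gauss)" by measurable
  let ?K = "distr (\<mu> \<Otimes>\<^sub>M gauss) borel g"
  have K: "prob_space ?K" by (rule prob_space_distr[OF gm])
  have intK: "integrable ?K (\<lambda>x. x)" using int by (subst integrable_distr_eq) auto
  have EK: "(\<integral>x. x \<partial>?K) = (\<integral>q. g q \<partial>(\<mu> \<Otimes>\<^sub>M gauss))" by (subst integral_distr) auto
  have "measure (PiM {..<n} (\<lambda>_. ?K)) {\<omega> \<in> space (PiM {..<n} (\<lambda>_. ?K)).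
      real n * \<delta> \<le> \<bar>(\<Sum>i<n. \<omega> i) - real n * (\<integral>x. x \<partial>?K)\<bar>}
    = measure (PiM {..<n} (\<lambda>_. \<mu>) \<Otimes>\<^sub>M noise n) {p \<in> space (PiM {..<n} (\<lambda>_. \<mu>) \<Otimes>\<^sub>M noise n).
      real n * \<delta> \<le> \<bar>(\<Sum>i<n. g (fst p i, snd p i)) - real n * (\<integral>q. g q \<partial>(\<mu> \<Otimes>\<^sub>M gauss))\<bar>}" for n
  proof -
    let ?T = "\<lambda>p. \<lambda>i\<in>{..<n}. g (fst p i, snd p i)"
    let ?P = "PiM {..<n} (\<lambda>_. \<mu>) \<Otimes>\<^sub>M PiM {..<n} (\<lambda>_. gauss)"
    have T: "?T \<in> measurable ?P (PiM {..<n} (\<lambda>_. borel))" by measurable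
    have sp: "space (PiM {..<n} (\<lambda>_. ?K)) = space (PiM {..<n} (\<lambda>_. borel))"
      by (intro sets_eq_imp_space_eq sets_PiM_cong) auto
    have S: "{\<omega> \<in> space (PiM {..<n} (\<lambda>_. borel)). real n * \<delta> \<le> \<bar>(\<Sum>i<n. \<omega> i) - real n * (\<integral>x. x \<partial>?K)\<bar>}
        \<in> sets (PiM {..<n} (\<lambda>_. borel))" by measurable
    let ?S = "{\<omega> \<in> space (PiM {..<n} (\<lambda>_. borel)). real n * \<delta> \<le> \<bar>(\<Sum>i<n. \<omega> i) - real n * (\<integral>x. x \<partial>?K)\<bar>}"
    have "measure (PiM {..<n} (\<lambda>_. ?K)) ?S = measure ?P (?T -` ?S \<inter> space ?P)"
      unfolding PiM_distr_pair[OF \<mu>.prob_space_axioms gauss.prob_space_axioms finite_lessThan gm]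
      by (rule measure_distr[OF T S])
    also have "?T -` ?S \<inter> space ?P = {p \<in> space ?P.
        real n * \<delta> \<le> \<bar>(\<Sum>i<n. g (fst p i, snd p i)) - real n * (\<integral>q. g q \<partial>(\<mu> \<Otimes>\<^sub>M gauss))\<bar>}"
      unfolding EK using measurable_space[OF T] by auto
    finally show ?thesis unfolding sp noise_eq_PiM .
  qed
  then show ?thesis
    using weak_law[OF K _ intK \<delta>] by simp
qed

lemma integrable_fst_snd_input:
  fixes h :: "real \<Rightarrow> real"
  assumes \<mu>: "input_dist \<mu>" and [measurable]: "h \<in> borel_measurable borel"
  shows "integrable \<mu> h \<Longrightarrow> integrable (\<mu> \<Otimes>\<^sub>M gauss) (\<lambda>p. h (fst p))"
    and "(\<integral>p. h (fst p) \<partial>(\<mu> \<Otimes>\<^sub>M gauss)) = (\<integral>x. h x \<partial>\<mu>)"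
    and "integrable gauss h \<Longrightarrow> integrable (\<mu> \<Otimes>\<^sub>M gauss) (\<lambda>p. h (snd p))"
    and "(\<integral>p. h (snd p) \<partial>(\<mu> \<Otimes>\<^sub>M gauss)) = (\<integral>x. h x \<partial>gauss)"
    and "integrable (out \<mu>) h \<Longrightarrow> integrable (\<mu> \<Otimes>\<^sub>M gauss) (\<lambda>p. h (fst p + snd p))"
    and "(\<integral>p. h (fst p + snd p) \<partial>(\<mu> \<Otimes>\<^sub>M gauss)) = (\<integral>x. h x \<partial>out \<mu>)"
proof -
  note [measurable_cong] = input_dist_simps(1)[OF \<mu>]
  interpret \<mu>: prob_space \<mu> using \<mu> by (simp add: input_dist_def)
  interpret P: pair_prob_space \<mu> gauss ..
  have f: "distr (\<mu> \<Otimes>\<^sub>M gauss) \<mu> fst = \<mu>"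
    by (rule gauss.distr_pair_fst)
  have s: "distr (\<mu> \<Otimes>\<^sub>M gauss) gauss snd = gauss"
  proof (rule measure_eqI)
    fix A assume A: "A \<in> sets (distr (\<mu> \<Otimes>\<^sub>M gauss) gauss snd)"
    then have "snd -` A \<inter> space (\<mu> \<Otimes>\<^sub>M gauss) = space \<mu> \<times> A"
      by (auto simp: space_pair_measure)
    then show "emeasure (distr (\<mu> \<Otimes>\<^sub>M gauss) gauss snd) A = emeasure gauss A"
      using A by (simp add: emeasure_distr gauss.emeasure_pair_measure_Times \<mu>.emeasure_space_1)
  qed simp
  show "integrable \<mu> h \<Longrightarrow> integrable (\<mu> \<Otimes>\<^sub>M gauss) (\<lambda>p. h (fst p))"
    using integrable_distr_eq[of fst "\<mu> \<Otimes>\<^sub>M gauss" \<mu> h] by (simp add: f)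
  show "(\<integral>p. h (fst p) \<partial>(\<mu> \<Otimes>\<^sub>M gauss)) = (\<integral>x. h x \<partial>\<mu>)"
    using integral_distr[of fst "\<mu> \<Otimes>\<^sub>M gauss" \<mu> h] by (simp add: f)
  show "integrable gauss h \<Longrightarrow> integrable (\<mu> \<Otimes>\<^sub>M gauss) (\<lambda>p. h (snd p))"
    using integrable_distr_eq[of snd "\<mu> \<Otimes>\<^sub>M gauss" gauss h] by (simp add: s)
  show "(\<integral>p. h (snd p) \<partial>(\<mu> \<Otimes>\<^sub>M gauss)) = (\<integral>x. h x \<partial>gauss)"
    using integral_distr[of snd "\<mu> \<Otimes>\<^sub>M gauss" gauss h] by (simp add: s)
  show "integrable (out \<mu>) h \<Longrightarrow> integrable (\<mu> \<Otimes>\<^sub>M gauss) (\<lambda>p. h (fst p + snd p))"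
    unfolding out_eq_distr[OF \<mu>] by (subst (asm) integrable_distr_eq) auto
  show "(\<integral>p. h (fst p + snd p) \<partial>(\<mu> \<Otimes>\<^sub>M gauss)) = (\<integral>x. h x \<partial>out \<mu>)"
    unfolding out_eq_distr[OF \<mu>] by (subst integral_distr) auto
qed

text \<open>Nonzero letters are counted by a sum of indicators, so that the set is visibly
  measurable and the weak law speaks about the count.\<close>

definition codewords :: "real \<Rightarrow> real \<Rightarrow> nat \<Rightarrow> (nat \<Rightarrow> real) set" where
  "codewords \<gamma> q n = {x \<in> space (PiM {..<n} (\<lambda>_. borel)).
     (\<Sum>i<n. if x i \<noteq> 0 then 1 else 0) \<le> (1 - q) * real n \<and> (\<Sum>i<n. (x i)\<^sup>2) \<le> \<gamma> * real n}"

lemma sets_codewords [measurable]: "codewords \<gamma> q n \<in> sets (PiM {..<n} (\<lambda>_. borel))"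
  unfolding codewords_def by measurable

abbreviation joint :: "nat \<Rightarrow> real measure \<Rightarrow> ((nat \<Rightarrow> real) \<times> (nat \<Rightarrow> real)) measure" where
  "joint n \<mu> \<equiv> PiM {..<n} (\<lambda>_. \<mu>) \<Otimes>\<^sub>M noise n"

lemma prob_space_joint:
  assumes "input_dist \<mu>"
  shows "prob_space (joint n \<mu>)"
proof -
  interpret X: prob_space "PiM {..<n} (\<lambda>_. \<mu>)"
    using assms by (intro prob_space_PiM) (simp add: input_dist_def)
  interpret Z: prob_space "noise n" by (rule prob_space_noise)
  interpret pair_prob_space "PiM {..<n} (\<lambda>_. \<mu>)" "noise n" ..
  show ?thesis by (rule prob_space_axioms)
qed

lemma sets_PiM_input: "input_dist \<mu> \<Longrightarrow> sets (PiM I (\<lambda>_. \<mu>)) = sets (PiM I (\<lambda>_. borel))"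
  by (intro sets_PiM_cong) (auto simp: input_dist_def)

lemma sets_joint:
  assumes "input_dist \<mu>"
  shows "sets (joint n \<mu>) = sets (PiM {..<n} (\<lambda>_. borel) \<Otimes>\<^sub>M PiM {..<n} (\<lambda>_. borel))"
  by (intro sets_pair_measure_cong sets_PiM_input assms sets_noise)

lemma measurable_info_joint:
  assumes "input_dist \<mu>"
  shows "(\<lambda>p. info n \<mu> (fst p) (snd p)) \<in> borel_measurable (PiM {..<n} (\<lambda>_. borel) \<Otimes>\<^sub>M PiM {..<n} (\<lambda>_. borel))"
proof -
  note [measurable] = measurable_pY[OF assms]
  show ?thesis unfolding info_def by measurable
qed

text \<open>Three weak laws: for the information density, the power and the number of nonzero
  letters. Strict slack in both constraints absorbs the deviations, so a random word is admissible
  with high probability.\<close>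

lemma typical_probability:
  assumes fp: "finite_power \<mu>" and at: "\<mu> \<in> atomic_input q'"
    and slack: "q < measure \<mu> {0}" "(\<integral>x. x\<^sup>2 \<partial>\<mu>) < \<gamma>" and \<delta>: "0 < \<delta>" and \<beta>: "0 < \<beta>"
  shows "eventually (\<lambda>n. 1 - \<beta> \<le> measure (joint n \<mu>) {p \<in> space (joint n \<mu>).
    fst p \<in> codewords \<gamma> q n \<and> real n * (MI \<mu> - \<delta>) < info n \<mu> (fst p) (snd p)}) sequentially"
proof -
  have \<mu>: "input_dist \<mu>" using fp by (rule finite_powerD)
  note [measurable_cong] = input_dist_simps(1)[OF \<mu>]
  note [measurable] = measurable_pY[OF \<mu>]
  interpret \<mu>: prob_space \<mu> using \<mu> by (simp add: input_dist_def)
  let ?g1 = "\<lambda>p. ln (phi (snd p) / pY (fst p + snd p) \<mu>)"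
  let ?g2 = "\<lambda>p::real \<times> real. (fst p)\<^sup>2"
  let ?g3 = "\<lambda>p::real \<times> real. if fst p \<noteq> 0 then 1 else 0 :: real"
  have eq1: "?g1 p = ln (phi (snd p)) + - ln (pY (fst p + snd p) \<mu>)" for p
    using pY_pos[OF \<mu>] by (simp add: ln_divide_pos)
  have ia: "integrable (\<mu> \<Otimes>\<^sub>M gauss) (\<lambda>p. ln (phi (snd p)))"
    by (rule integrable_fst_snd_input(3)[OF \<mu> _ integrable_gauss_ln_phi]) measurable
  have ib: "integrable (\<mu> \<Otimes>\<^sub>M gauss) (\<lambda>p. - ln (pY (fst p + snd p) \<mu>))"
    by (rule integrable_fst_snd_input(5)[OF \<mu> _ integrable_cross_entropy[OF fp at]]) measurable
  have i1: "integrable (\<mu> \<Otimes>\<^sub>M gauss) ?g1"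
    unfolding eq1 by (rule Bochner_Integration.integrable_add[OF ia ib])
  have e1: "(\<integral>p. ?g1 p \<partial>(\<mu> \<Otimes>\<^sub>M gauss)) = MI \<mu>"
  proof -
    have "(\<integral>p. ?g1 p \<partial>(\<mu> \<Otimes>\<^sub>M gauss))
      = (\<integral>p. ln (phi (snd p)) \<partial>(\<mu> \<Otimes>\<^sub>M gauss)) + (\<integral>p. - ln (pY (fst p + snd p) \<mu>) \<partial>(\<mu> \<Otimes>\<^sub>M gauss))"
      unfolding eq1 by (rule Bochner_Integration.integral_add[OF ia ib])
    also have "(\<integral>p. ln (phi (snd p)) \<partial>(\<mu> \<Otimes>\<^sub>M gauss)) = - noise_entropy"
      using integrable_fst_snd_input(4)[OF \<mu>, of "\<lambda>z. ln (phi z)"] by (simp add: noise_entropy_def)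
    also have "(\<integral>p. - ln (pY (fst p + snd p) \<mu>) \<partial>(\<mu> \<Otimes>\<^sub>M gauss)) = cross_entropy \<mu> \<mu>"
      unfolding cross_entropy_def by (rule integrable_fst_snd_input(6)[OF \<mu>]) measurable
    finally show ?thesis by (simp add: MI_eq_cross_entropy[OF fp at])
  qed
  have i2: "integrable (\<mu> \<Otimes>\<^sub>M gauss) ?g2"
    by (rule integrable_fst_snd_input(1)[OF \<mu>]) (use fp in \<open>auto simp: finite_power_def\<close>)
  have e2: "(\<integral>p. ?g2 p \<partial>(\<mu> \<Otimes>\<^sub>M gauss)) = (\<integral>x. x\<^sup>2 \<partial>\<mu>)"
    by (rule integrable_fst_snd_input(2)[OF \<mu>]) measurable
  have h3: "(if x \<noteq> 0 then 1 else 0) = (1 - indicator {0} x :: real)" for x :: real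
    by (simp add: indicator_def)
  have ind: "integrable \<mu> (indicator {0} :: real \<Rightarrow> real)"
    by (rule integrable_real_indicator) (auto simp: \<mu>.emeasure_eq_measure)
  have i3': "integrable \<mu> (\<lambda>x. if x \<noteq> 0 then 1 else 0 :: real)"
    unfolding h3 using ind by (intro Bochner_Integration.integrable_diff) auto
  have i3: "integrable (\<mu> \<Otimes>\<^sub>M gauss) ?g3"
    by (rule integrable_fst_snd_input(1)[OF \<mu> _ i3']) measurable
  have e3: "(\<integral>p. ?g3 p \<partial>(\<mu> \<Otimes>\<^sub>M gauss)) = 1 - measure \<mu> {0}"
  proof -
    have "(\<integral>p. ?g3 p \<partial>(\<mu> \<Otimes>\<^sub>M gauss)) = (\<integral>x. (if x \<noteq> 0 then 1 else 0) \<partial>\<mu>)"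
      by (rule integrable_fst_snd_input(2)[OF \<mu>]) measurable
    also have "\<dots> = 1 - measure \<mu> {0}"
      unfolding h3 using ind \<mu>.prob_space by (subst Bochner_Integration.integral_diff) auto
    finally show ?thesis .
  qed
  \<comment> \<open>The slack itself serves as tolerance.\<close>
  define \<delta>2 where "\<delta>2 = \<gamma> - (\<integral>x. x\<^sup>2 \<partial>\<mu>)"
  define \<delta>3 where "\<delta>3 = measure \<mu> {0} - q"
  have \<delta>23: "0 < \<delta>2" "0 < \<delta>3" using slack by (auto simp: \<delta>2_def \<delta>3_def)
  define B where "B n g \<delta> = {p \<in> space (joint n \<mu>).
      real n * \<delta> \<le> \<bar>(\<Sum>i<n. g (fst p i, snd p i)) - real n * (\<integral>q. g q \<partial>(\<mu> \<Otimes>\<^sub>M gauss))\<bar>}"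
    for n and g :: "real \<times> real \<Rightarrow> real" and \<delta>
  have Bset: "B n g \<delta> \<in> sets (joint n \<mu>)" if [measurable]: "g \<in> borel_measurable (borel \<Otimes>\<^sub>M borel)" for n g \<delta>
    unfolding B_def by measurable
  have g1m [measurable]: "?g1 \<in> borel_measurable (borel \<Otimes>\<^sub>M borel)" by measurable
  have g2m [measurable]: "?g2 \<in> borel_measurable (borel \<Otimes>\<^sub>M borel)" by measurable
  have g3m [measurable]: "?g3 \<in> borel_measurable (borel \<Otimes>\<^sub>M borel)" by measurable
  have "(\<lambda>n. measure (joint n \<mu>) (B n ?g1 \<delta>) + measure (joint n \<mu>) (B n ?g2 \<delta>2) + measure (joint n \<mu>) (B n ?g3 (\<delta>3 / 2)))
      \<longlonglongrightarrow> 0 + 0 + 0"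
    unfolding B_def using \<delta> \<delta>23
    by (intro tendsto_add weak_law_pair[OF \<mu>] g1m g2m g3m i1 i2 i3) auto
  then have "eventually (\<lambda>n. measure (joint n \<mu>) (B n ?g1 \<delta>) + measure (joint n \<mu>) (B n ?g2 \<delta>2)
      + measure (joint n \<mu>) (B n ?g3 (\<delta>3 / 2)) < \<beta>) sequentially"
    using \<beta> by (intro order_tendstoD(2)) auto
  then show ?thesis
    using eventually_gt_at_top[of "0::nat"]
  proof eventually_elim
    case (elim n)
    interpret J: prob_space "joint n \<mu>" by (rule prob_space_joint[OF \<mu>])
    let ?G = "{p \<in> space (joint n \<mu>). fst p \<in> codewords \<gamma> q n \<and> real n * (MI \<mu> - \<delta>) < info n \<mu> (fst p) (snd p)}"
    let ?B1 = "B n ?g1 \<delta>" and ?B2 = "B n ?g2 \<delta>2" and ?B3 = "B n ?g3 (\<delta>3 / 2)"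
    have G: "?G \<in> sets (joint n \<mu>)"
    proof -
      note [measurable] = measurable_info_joint[OF \<mu>]
      have "{p \<in> space (PiM {..<n} (\<lambda>_. borel) \<Otimes>\<^sub>M PiM {..<n} (\<lambda>_. borel)). fst p \<in> codewords \<gamma> q n \<and>
          real n * (MI \<mu> - \<delta>) < info n \<mu> (fst p) (snd p)} \<in> sets (PiM {..<n} (\<lambda>_. borel) \<Otimes>\<^sub>M PiM {..<n} (\<lambda>_. borel))"
        by measurable
      then show ?thesis
        unfolding sets_joint[OF \<mu>] sets_eq_imp_space_eq[OF sets_joint[OF \<mu>]] .
    qed
    have Bs: "?B1 \<in> sets (joint n \<mu>)" "?B2 \<in> sets (joint n \<mu>)" "?B3 \<in> sets (joint n \<mu>)"
      by (rule Bset[OF g1m], rule Bset[OF g2m], rule Bset[OF g3m])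
    have "space (joint n \<mu>) - ?G \<subseteq> ?B1 \<union> ?B2 \<union> ?B3"
    proof
      fix p assume p: "p \<in> space (joint n \<mu>) - ?G"
      show "p \<in> ?B1 \<union> ?B2 \<union> ?B3"
      proof (rule ccontr)
        assume "p \<notin> ?B1 \<union> ?B2 \<union> ?B3"
        then have n1: "\<bar>(\<Sum>i<n. ln (phi (snd p i) / pY (fst p i + snd p i) \<mu>)) - real n * MI \<mu>\<bar> < real n * \<delta>"
          and n2: "\<bar>(\<Sum>i<n. (fst p i)\<^sup>2) - real n * (\<integral>x. x\<^sup>2 \<partial>\<mu>)\<bar> < real n * \<delta>2"
          and n3: "\<bar>(\<Sum>i<n. if fst p i \<noteq> 0 then 1 else 0) - real n * (1 - measure \<mu> {0})\<bar> < real n * (\<delta>3 / 2)"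
          using p unfolding B_def e1 e2 e3 by (auto simp only: Un_iff mem_Collect_eq Diff_iff not_le fst_conv snd_conv)
        have "real n * (MI \<mu> - \<delta>) < info n \<mu> (fst p) (snd p)"
          using n1 unfolding info_def right_diff_distrib by linarith
        moreover have "(\<Sum>i<n. (fst p i)\<^sup>2) \<le> \<gamma> * real n"
          using n2 unfolding \<delta>2_def right_diff_distrib mult.commute[of \<gamma>] by linarith
        moreover have "(\<Sum>i<n. if fst p i \<noteq> 0 then 1 else 0) \<le> (1 - q) * real n"
        proof -
          have "real n * (\<delta>3 / 2) \<le> real n * \<delta>3" using \<delta>23 by (intro mult_left_mono) auto
          moreover have "real n * (1 - measure \<mu> {0}) + real n * \<delta>3 = (1 - q) * real n"
            by (simp add: \<delta>3_def algebra_simps)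
          ultimately show ?thesis using n3 by linarith
        qed
        moreover have "fst p \<in> space (PiM {..<n} (\<lambda>_. borel))"
        proof -
          have "p \<in> space (joint n \<mu>)" using p by blast
          then have "p \<in> space (PiM {..<n} (\<lambda>_. borel) \<Otimes>\<^sub>M PiM {..<n} (\<lambda>_. borel))"
            unfolding sets_eq_imp_space_eq[OF sets_joint[OF \<mu>]] .
          then show ?thesis by (simp only: space_pair_measure mem_Times_iff)
        qed
        ultimately have "fst p \<in> codewords \<gamma> q n" "real n * (MI \<mu> - \<delta>) < info n \<mu> (fst p) (snd p)"
          by (simp_all only: codewords_def mem_Collect_eq simp_thms)
        then show False using p by blast
      qed
    qed
    then have "measure (joint n \<mu>) (space (joint n \<mu>) - ?G) \<le> measure (joint n \<mu>) (?B1 \<union> ?B2 \<union> ?B3)"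
      using Bs by (intro J.finite_measure_mono) auto
    also have "\<dots> \<le> measure (joint n \<mu>) (?B1 \<union> ?B2) + measure (joint n \<mu>) ?B3"
      using Bs by (intro measure_Un_le) auto
    also have "measure (joint n \<mu>) (?B1 \<union> ?B2) \<le> measure (joint n \<mu>) ?B1 + measure (joint n \<mu>) ?B2"
      using Bs by (intro measure_Un_le) auto
    finally show ?case
      using J.prob_compl[OF G] elim(1) by linarith
  qed
qed

text \<open>The decoder sees y and not z, so decoding sets need the information density in this
  form.\<close>

definition info_out :: "nat \<Rightarrow> real measure \<Rightarrow> (nat \<Rightarrow> real) \<Rightarrow> (nat \<Rightarrow> real) \<Rightarrow> real" where
  "info_out n \<mu> x y = (\<Sum>i<n. ln (phi (y i - x i) / pY (y i) \<mu>))"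

lemma info_out_shift: "info_out n \<mu> x (shift n x z) = info n \<mu> x z"
  unfolding info_out_def info_def by (intro sum.cong) auto

lemma sets_info_out [measurable]:
  assumes "input_dist \<mu>"
  shows "{y \<in> space (PiM {..<n} (\<lambda>_. borel)). a < info_out n \<mu> x y} \<in> sets (PiM {..<n} (\<lambda>_. borel))"
proof -
  note [measurable] = measurable_pY[OF assms]
  show ?thesis unfolding info_out_def by measurable
qed

text \<open>Where the information density exceeds a, the product output law has density less than
  exp(-a) with respect to the channel law of x.\<close>

lemma emeasure_out_info:
  assumes \<mu>: "input_dist \<mu>"
  shows "emeasure (PiM {..<n} (\<lambda>_. out \<mu>)) {y \<in> space (PiM {..<n} (\<lambda>_. borel)). a < info_out n \<mu> x y}
    \<le> ennreal (exp (- a))"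
proof -
  let ?B = "{y \<in> space (PiM {..<n} (\<lambda>_. borel)). a < info_out n \<mu> x y}"
  interpret Z: prob_space "noise n" by (rule prob_space_noise)
  have B: "?B \<in> sets (PiM {..<n} (\<lambda>_. borel))" by (rule sets_info_out[OF \<mu>])
  have "emeasure (PiM {..<n} (\<lambda>_. out \<mu>)) ?B = (\<integral>\<^sup>+y. indicator ?B y \<partial>PiM {..<n} (\<lambda>_. out \<mu>))"
    using B by (simp add: sets_PiM_out)
  also have "\<dots> = (\<integral>\<^sup>+z. ennreal (exp (- info n \<mu> x z)) * indicator ?B (shift n x z) \<partial>noise n)"
    by (rule nn_integral_out_noise[OF \<mu>]) (use B in measurable)
  also have "\<dots> \<le> (\<integral>\<^sup>+z. ennreal (exp (- a)) \<partial>noise n)"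
    by (intro nn_integral_mono) (auto split: split_indicator simp: info_out_shift intro!: ennreal_leI)
  also have "\<dots> = ennreal (exp (- a))" by (simp add: Z.emeasure_space_1)
  finally show ?thesis .
qed

text \<open>Feinstein's greedy construction: if no admissible codeword could be added, the decoding sets chosen so far
  would carry too much output probability.\<close>
lemma feinstein:
  fixes n :: nat and a \<epsilon> \<beta> :: real
  assumes \<mu>: "input_dist \<mu>" and F: "F \<in> sets (PiM {..<n} (\<lambda>_. borel))" and \<epsilon>: "\<epsilon> \<le> 1"
    and good: "1 - \<beta> \<le> measure (joint n \<mu>) {p \<in> space (joint n \<mu>). fst p \<in> F \<and> a < info n \<mu> (fst p) (snd p)}"
    and k: "real k * exp (- a) + \<beta> < \<epsilon>"
  shows "\<exists>enc D. (\<forall>m<Suc k. enc m \<in> F \<and> D m \<in> sets (PiM {..<n} (\<lambda>_. borel)) \<and>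
      emeasure (PiM {..<n} (\<lambda>_. out \<mu>)) (D m) \<le> ennreal (exp (- a)) \<and>
      1 - \<epsilon> \<le> measure (noise n) {z \<in> space (noise n). shift n (enc m) z \<in> D m}) \<and>
    disjoint_family_on D {..<Suc k}"
    (is "\<exists>enc D. ?code (Suc k) enc D")
proof -
  interpret X: prob_space "PiM {..<n} (\<lambda>_. \<mu>)"
    using \<mu> by (intro prob_space_PiM) (simp add: input_dist_def)
  interpret Z: prob_space "noise n" by (rule prob_space_noise)
  interpret J: prob_space "joint n \<mu>" by (rule prob_space_joint[OF \<mu>])
  let ?Y = "PiM {..<n} (\<lambda>_. borel :: real measure)"
  let ?Q = "PiM {..<n} (\<lambda>_. out \<mu>)"
  note [measurable_cong] = sets_PiM_input[OF \<mu>, of "{..<n}"]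
  note [measurable] = F measurable_info_joint[OF \<mu>]
  have step: "\<exists>enc D. ?code (Suc j) enc D" if code: "?code j enc D" and j: "real j * exp (- a) + \<beta> < \<epsilon>" for j enc D
  proof -
    define U where "U = (\<Union>m<j. D m)"
    have U [measurable]: "U \<in> sets ?Y" using code by (auto simp: U_def)
    let ?T = "\<lambda>p. \<lambda>i\<in>{..<n}. fst p i + snd p i"
    have T [measurable]: "?T \<in> measurable (joint n \<mu>) ?Y" by measurable
    \<comment> \<open>The product output law is the law of the channel output for a random word, so
      \<open>emeasure ?Q U\<close> is the probability that this output falls into decoding sets
      already taken.\<close>
    have Q: "?Q = distr (joint n \<mu>) ?Y ?T"
    proof -
      have "?Q = PiM {..<n} (\<lambda>_. distr (\<mu> \<Otimes>\<^sub>M gauss) borel (\<lambda>p. fst p + snd p))"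
        by (simp only: out_eq_distr[OF \<mu>])
      also have "\<dots> = distr (joint n \<mu>) ?Y ?T"
      proof -
        note [measurable_cong] = input_dist_simps(1)[OF \<mu>]
        have "(\<lambda>p. fst p + snd p) \<in> borel_measurable (\<mu> \<Otimes>\<^sub>M gauss)" by measurable
        from PiM_distr_pair[OF _ gauss.prob_space_axioms finite_lessThan this]
        show ?thesis using \<mu> by (simp add: noise_eq_PiM input_dist_def)
      qed
      finally show ?thesis .
    qed
    have QU: "emeasure ?Q U \<le> ennreal (real j * exp (- a))"
    proof -
      have "emeasure ?Q U \<le> (\<Sum>m<j. emeasure ?Q (D m))"
        unfolding U_def by (rule emeasure_subadditive_finite) (use code in \<open>auto simp: sets_PiM_out\<close>)
      also have "\<dots> \<le> (\<Sum>m<j. ennreal (exp (- a)))"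
        using code by (intro sum_mono) auto
      also have "\<dots> = ennreal (real j * exp (- a))"
        by (simp add: ennreal_of_nat_eq_real_of_nat ennreal_mult)
      finally show ?thesis .
    qed
    let ?B = "\<lambda>x. {y \<in> space ?Y. a < info_out n \<mu> x y}"
    \<comment> \<open>Candidate decoding sets are threshold sets minus U. If all admissible x
      failed, a typical pair would avoid U with probability at most 1 - \<epsilon> and hit it with
      probability at most j exp(-a), too little for 1 - \<beta>.\<close>
    have "\<exists>x\<in>F. 1 - \<epsilon> \<le> measure (noise n) {z \<in> space (noise n). shift n x z \<in> ?B x - U}"
    proof (rule ccontr)
      assume "\<not> ?thesis"
      then have small: "\<And>x. x \<in> F \<Longrightarrow> measure (noise n) {z \<in> space (noise n). shift n x z \<in> ?B x - U} \<le> 1 - \<epsilon>"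
        by force
      let ?G = "{p \<in> space (joint n \<mu>). fst p \<in> F \<and> a < info n \<mu> (fst p) (snd p)}"
      let ?G1 = "{p \<in> space (joint n \<mu>). fst p \<in> F \<and> a < info n \<mu> (fst p) (snd p) \<and> ?T p \<notin> U}"
      let ?G2 = "?T -` U \<inter> space (joint n \<mu>)"
      have sj: "sets (joint n \<mu>) = sets (?Y \<Otimes>\<^sub>M ?Y)" by (rule sets_joint[OF \<mu>])
      have Gm: "?G1 \<in> sets (joint n \<mu>)"
      proof -
        have "{p \<in> space (?Y \<Otimes>\<^sub>M ?Y). fst p \<in> F \<and> a < info n \<mu> (fst p) (snd p) \<and> ?T p \<notin> U} \<in> sets (?Y \<Otimes>\<^sub>M ?Y)"
          by measurable
        then show ?thesis unfolding sj sets_eq_imp_space_eq[OF sj] .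
      qed
      have G2m: "?G2 \<in> sets (joint n \<mu>)" by (rule measurable_sets[OF T U])
      have "ennreal (1 - \<beta>) \<le> emeasure (joint n \<mu>) ?G"
        using good by (simp add: J.emeasure_eq_measure ennreal_leI)
      also have "\<dots> \<le> emeasure (joint n \<mu>) (?G1 \<union> ?G2)"
        using Gm G2m by (intro emeasure_mono) auto
      also have "\<dots> \<le> emeasure (joint n \<mu>) ?G1 + emeasure (joint n \<mu>) ?G2"
        by (rule emeasure_subadditive[OF Gm G2m])
      also have "emeasure (joint n \<mu>) ?G2 = emeasure ?Q U"
        unfolding Q by (rule emeasure_distr[OF T U, symmetric])
      also have "emeasure (joint n \<mu>) ?G1 = (\<integral>\<^sup>+x. emeasure (noise n) (Pair x -` ?G1) \<partial>PiM {..<n} (\<lambda>_. \<mu>))"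
        by (rule Z.emeasure_pair_measure_alt[OF Gm])
      also have "\<dots> \<le> (\<integral>\<^sup>+x. ennreal (1 - \<epsilon>) \<partial>PiM {..<n} (\<lambda>_. \<mu>))"
      proof (rule nn_integral_mono)
        fix x
        show "emeasure (noise n) (Pair x -` ?G1) \<le> ennreal (1 - \<epsilon>)"
        proof (cases "x \<in> F")
          case True
          have "emeasure (noise n) (Pair x -` ?G1)
            \<le> emeasure (noise n) {z \<in> space (noise n). shift n x z \<in> ?B x - U}"
          proof (rule emeasure_mono)
            show "Pair x -` ?G1 \<subseteq> {z \<in> space (noise n). shift n x z \<in> ?B x - U}"
              by (auto simp: space_pair_measure info_out_shift space_PiM PiE_iff)
            note [measurable] = sets_info_out[OF \<mu>]
            have "shift n x -` (?B x - U) \<inter> space (noise n) \<in> sets (noise n)"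
              by (rule measurable_sets[OF measurable_shift]) measurable
            then show "{z \<in> space (noise n). shift n x z \<in> ?B x - U} \<in> sets (noise n)"
              by (simp add: vimage_def Int_def conj_commute)
          qed
          also have "\<dots> \<le> ennreal (1 - \<epsilon>)"
            using small[OF True] by (simp add: Z.emeasure_eq_measure ennreal_leI)
          finally show ?thesis .
        next
          case False
          then have empty: "Pair x -` ?G1 = {}" by auto
          show ?thesis unfolding empty by simp
        qed
      qed
      also have "\<dots> = ennreal (1 - \<epsilon>)" by (simp add: X.emeasure_space_1)
      also note QU
      finally have "ennreal (1 - \<beta>) \<le> ennreal (1 - \<epsilon> + real j * exp (- a))"
        using \<epsilon> by simp
      moreover have "0 \<le> 1 - \<epsilon> + real j * exp (- a)" using \<epsilon> by simp
      ultimately have "1 - \<beta> \<le> 1 - \<epsilon> + real j * exp (- a)"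
        using ennreal_le_iff by blast
      then show False using j by simp
    qed
    then obtain x where x: "x \<in> F" "1 - \<epsilon> \<le> measure (noise n) {z \<in> space (noise n). shift n x z \<in> ?B x - U}"
      by blast
    have Bx: "?B x - U \<in> sets ?Y" using sets_info_out[OF \<mu>] U by blast
    have Qx: "emeasure ?Q (?B x - U) \<le> ennreal (exp (- a))"
      using sets_info_out[OF \<mu>, of n a x]
      by (intro order_trans[OF emeasure_mono emeasure_out_info[OF \<mu>]]) (auto simp: sets_PiM_out)
    define B' where "B' = ?B x - U"
    have B': "B' \<in> sets ?Y" "emeasure ?Q B' \<le> ennreal (exp (- a))"
      "1 - \<epsilon> \<le> measure (noise n) {z \<in> space (noise n). shift n x z \<in> B'}"
      unfolding B'_def by (fact Bx, fact Qx, fact x(2))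
    have disj: "D m \<inter> B' = {}" if "m < j" for m
      using that by (auto simp: U_def B'_def)
    have old: "enc m \<in> F" "D m \<in> sets ?Y" "emeasure ?Q (D m) \<le> ennreal (exp (- a))"
      "1 - \<epsilon> \<le> measure (noise n) {z \<in> space (noise n). shift n (enc m) z \<in> D m}" if "m < j" for m
      using code that by blast+
    have "?code (Suc j) (enc(j := x)) (D(j := B'))"
    proof (intro conjI allI impI)
      fix m assume "m < Suc j"
      then have "m \<noteq> j \<Longrightarrow> m < j" by linarith
      note old = old[OF this]
      show "(enc(j := x)) m \<in> F"
        using old(1) x(1) by (cases "m = j") simp_all
      show "(D(j := B')) m \<in> sets ?Y"
        using old(2) B'(1) by (cases "m = j") simp_all
      show "emeasure ?Q ((D(j := B')) m) \<le> ennreal (exp (- a))"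
        using old(3) B'(2) by (cases "m = j") simp_all
      show "1 - \<epsilon> \<le> measure (noise n) {z \<in> space (noise n). shift n ((enc(j := x)) m) z \<in> (D(j := B')) m}"
        using old(4) B'(3) by (cases "m = j") simp_all
    next
      show "disjoint_family_on (D(j := B')) {..<Suc j}"
        unfolding disjoint_family_on_def
      proof (intro ballI impI)
        fix m m' assume mm: "m \<in> {..<Suc j}" "m' \<in> {..<Suc j}" "m \<noteq> m'"
        have dD: "D m \<inter> D m' = {}" if "m < j" "m' < j"
          using code that mm(3) by (auto simp: disjoint_family_on_def)
        show "(D(j := B')) m \<inter> (D(j := B')) m' = {}"
        proof (cases "m = j")
          case True
          then show ?thesis using mm disj[of m'] by (simp add: Int_commute)
        next
          case m: False
          show ?thesis
          proof (cases "m' = j")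
            case True
            then show ?thesis using m mm disj[of m] by simp
          next
            case False
            then show ?thesis using m mm dD by simp
          qed
        qed
      qed
    qed
    then show ?thesis by blast
  qed
  \<comment> \<open>Passing from j to j + 1 codewords pays only for the j sets in place, so the
    hypothesis on k yields k + 1 codewords.\<close>
  have "\<exists>enc D. ?code j enc D" if "j \<le> Suc k" for j
    using that
  proof (induction j)
    case 0
    show ?case by (auto simp: disjoint_family_on_def)
  next
    case (Suc j)
    then obtain enc D where "?code j enc D" by auto
    moreover have "real j * exp (- a) + \<beta> < \<epsilon>"
    proof -
      have "real j * exp (- a) \<le> real k * exp (- a)" using Suc by (intro mult_right_mono) auto
      then show ?thesis using k by linarith
    qed
    ultimately show ?case by (rule step)
  qed
  then show ?thesis by blast
qed

lemma MI_return_0: "MI (return borel 0) = 0"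
proof -
  have a: "return borel 0 \<in> atomic_input 1" by (rule return_0_in_atomic_input) auto
  have "cross 0 (return borel 0) = noise_entropy"
    by (simp add: cross_def noise_entropy_def pY_return)
  then show ?thesis
    by (simp add: MI_eq_cross_entropy[OF finite_power_return a] cross_entropy_return[OF a])
qed

text \<open>Disjointness makes the \<open>LEAST\<close> index the only one, and \<open>LEAST\<close>
  is measurable. Outputs in no decoding set get some fixed value, which is harmless since they are
  already counted as errors.\<close>

lemma code_of_decoding_sets:
  assumes M: "1 \<le> M"
    and code: "\<And>m. m < M \<Longrightarrow> enc m \<in> codewords \<gamma> q n" "\<And>m. m < M \<Longrightarrow> D m \<in> sets (PiM {..<n} (\<lambda>_. borel))"
      "\<And>m. m < M \<Longrightarrow> 1 - \<epsilon> \<le> measure (noise n) {z \<in> space (noise n). shift n (enc m) z \<in> D m}"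
    and disj: "disjoint_family_on D {..<M}"
  shows "\<exists>dec. valid_code \<gamma> q n M enc dec \<and> (\<forall>m<M. err_prob n enc dec m \<le> \<epsilon>)"
proof (intro exI conjI allI impI)
  define dec where "dec y = (LEAST m. m < M \<and> y \<in> D m)" for y
  have D: "Measurable.pred (PiM {..<n} (\<lambda>_. borel)) (\<lambda>y. m < M \<and> y \<in> D m)" for m
  proof (cases "m < M")
    case True
    then show ?thesis using code(2)[OF True] by simp
  qed simp
  have dec_eq_Least: "dec = (\<lambda>y. LEAST m. m < M \<and> y \<in> D m)" by (rule ext) (rule dec_def)
  have dec_m: "dec \<in> measurable (PiM {..<n} (\<lambda>_. borel)) (count_space UNIV)"
    unfolding dec_eq_Least by (rule measurable_Least) (rule D)
  have dec_eq: "dec y = m" if "m < M" "y \<in> D m" for y m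
    unfolding dec_def
  proof (rule Least_equality)
    fix m' assume m': "m' < M \<and> y \<in> D m'"
    have "m' = m"
    proof (rule ccontr)
      assume "m' \<noteq> m"
      then have "D m' \<inter> D m = {}" using disj m' that by (auto simp: disjoint_family_on_def)
      then show False using m' that by auto
    qed
    then show "m \<le> m'" by simp
  qed (use that in auto)
  show "valid_code \<gamma> q n M enc dec"
    using M dec_m code(1) unfolding valid_code_def codewords_def card_eq_sum_if by blast
  fix m assume m: "m < M"
  interpret Z: prob_space "noise n" by (rule prob_space_noise)
  let ?E = "{z \<in> space (noise n). dec (shift n (enc m) z) \<noteq> m}"
  let ?S = "{z \<in> space (noise n). shift n (enc m) z \<in> D m}"
  have "shift n (enc m) -` D m \<inter> space (noise n) \<in> sets (noise n)"
    by (rule measurable_sets[OF measurable_shift code(2)[OF m]])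
  then have S: "?S \<in> sets (noise n)" by (simp add: vimage_def Int_def conj_commute)
  have "?E \<subseteq> space (noise n) - ?S" using dec_eq[OF m] by auto
  then have "measure (noise n) ?E \<le> measure (noise n) (space (noise n) - ?S)"
    using S by (intro Z.finite_measure_mono) auto
  also have "\<dots> \<le> \<epsilon>" using Z.prob_compl[OF S] code(3)[OF m] by simp
  finally show "err_prob n enc dec m \<le> \<epsilon>" by (simp add: err_prob_def)
qed

section \<open>Codes at rates below the optimum\<close>

context optimal_input
begin

text \<open>Mixing with the point mass at 0 lifts the atom strictly above q < 1 and scales the power
  by 1 - t, while concavity limits the loss to t times \<open>MI \<mu>\<close>.\<close>

lemma near_optimal_with_slack:
  assumes "0 < \<epsilon>"
  obtains \<nu> where "finite_power \<nu>" "\<nu> \<in> atomic_input q" "q < measure \<nu> {0}" "(\<integral>x. x\<^sup>2 \<partial>\<nu>) < \<gamma>" "MI \<mu> - \<epsilon> \<le> MI \<nu>"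
proof -
  \<comment> \<open>The cap 1/2 keeps t < 1; the second term gives t * MI \<mu> \<le> \<epsilon>,
    with 1 added against division by 0.\<close>
  define t where "t = min (1/2) (\<epsilon> / (\<bar>MI \<mu>\<bar> + 1))"
  have t: "0 < t" "t < 1" using assms by (auto simp: t_def)
  let ?\<nu> = "mix t \<mu> (return borel 0)"
  have r: "return borel 0 \<in> atomic_input q" "finite_power (return borel (0::real))"
    using q by (auto intro: return_0_in_atomic_input)
  have "finite_power ?\<nu>" using t r optimal_simps by (intro finite_power_mix) auto
  moreover have "?\<nu> \<in> atomic_input q" using t r optimal_simps by (intro atomic_input_mix) auto
  moreover have "q < measure ?\<nu> {0}"
  proof -
    have "measure ?\<nu> {0} = (1 - t) * measure \<mu> {0} + t"
      using t optimal_simps by (subst measure_mix) (auto simp: measure_return)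
    moreover have "(1 - t) * q \<le> (1 - t) * measure \<mu> {0}"
      using t optimal_simps(2) by (intro mult_left_mono) (auto simp: atomic_input_def)
    moreover have "t * q < t * 1" using t q by (intro mult_strict_left_mono) auto
    ultimately show ?thesis by (simp add: algebra_simps)
  qed
  moreover have "(\<integral>x. x\<^sup>2 \<partial>?\<nu>) < \<gamma>"
  proof -
    have "(\<integral>x. x\<^sup>2 \<partial>?\<nu>) = (1 - t) * \<gamma>"
      using t optimal_simps r by (subst second_moment_mix) (auto simp: second_moment_eq second_moment_return)
    moreover have "0 < t * \<gamma>" using t \<gamma> by simp
    ultimately show ?thesis by (simp add: algebra_simps)
  qed
  moreover have "MI \<mu> - \<epsilon> \<le> MI ?\<nu>"
  proof -
    have "(1 - t) * MI \<mu> + t * MI (return borel 0) \<le> MI ?\<nu>"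
      using t r optimal_simps by (intro MI_concave) auto
    moreover have "t * MI \<mu> \<le> \<epsilon>"
    proof -
      have "t * MI \<mu> \<le> t * (\<bar>MI \<mu>\<bar> + 1)" using t by (intro mult_left_mono) auto
      also have "\<dots> \<le> \<epsilon> / (\<bar>MI \<mu>\<bar> + 1) * (\<bar>MI \<mu>\<bar> + 1)"
        by (intro mult_right_mono) (auto simp: t_def)
      also have "\<dots> = \<epsilon>" by (simp add: add_nonneg_pos less_imp_neq[symmetric])
      finally show ?thesis .
    qed
    ultimately show ?thesis by (simp add: MI_return_0 algebra_simps)
  qed
  ultimately show ?thesis using that by blast
qed

lemma MI_achievable: "achievable \<gamma> q (MI \<mu>)"
  unfolding achievable_def
proof (intro allI impI)
  fix \<epsilon> :: real assume \<epsilon>: "0 < \<epsilon>"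
  \<comment> \<open>The coding lemma takes error bounds up to 1 only.\<close>
  define e where "e = min \<epsilon> 1"
  have e: "0 < e" "e \<le> 1" "e \<le> \<epsilon>" using \<epsilon> by (auto simp: e_def)
  obtain \<nu> where \<nu>: "finite_power \<nu>" "\<nu> \<in> atomic_input q" "q < measure \<nu> {0}" "(\<integral>x. x\<^sup>2 \<partial>\<nu>) < \<gamma>"
    "MI \<mu> - \<epsilon> / 4 \<le> MI \<nu>"
    using near_optimal_with_slack[of "\<epsilon> / 4"] \<epsilon> by auto
  have typical: "eventually (\<lambda>n. 1 - e / 2 \<le> measure (joint n \<nu>) {p \<in> space (joint n \<nu>).
    fst p \<in> codewords \<gamma> q n \<and> real n * (MI \<nu> - \<epsilon> / 4) < info n \<nu> (fst p) (snd p)}) sequentially"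
    using \<epsilon> e by (intro typical_probability[OF \<nu>(1-4)]) auto
  have "(\<lambda>n. exp (- (\<epsilon> / 2)) ^ n) \<longlonglongrightarrow> 0"
    using \<epsilon> by (intro LIMSEQ_realpow_zero) auto
  then have "eventually (\<lambda>n. exp (- (\<epsilon> / 2)) ^ n < e / 2) sequentially"
    using e by (intro order_tendstoD(2)) auto
  with typical have "eventually (\<lambda>n. \<exists>M enc dec. valid_code \<gamma> q n M enc dec \<and>
      exp (real n * (MI \<mu> - \<epsilon>)) \<le> real M \<and> (\<forall>m<M. err_prob n enc dec m \<le> \<epsilon>)) sequentially"
  proof eventually_elim
    case (elim n)
    \<comment> \<open>Two losses of \<epsilon>/4, from the slack and from typicality, leave the
      threshold at least n (MI \<mu> - \<epsilon>/2); a codebook of rate MI \<mu> - \<epsilon> then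
      has k exp(-a) \<le> exp(-n \<epsilon>/2).\<close>
    define a where "a = real n * (MI \<nu> - \<epsilon> / 4)"
    \<comment> \<open>Rounding down keeps k within the hypothesis of \<open>feinstein\<close>, while
      the k + 1 codewords obtained still reach the required number.\<close>
    define k where "k = nat \<lfloor>exp (real n * (MI \<mu> - \<epsilon>))\<rfloor>"
    have k1: "real k \<le> exp (real n * (MI \<mu> - \<epsilon>))"
      unfolding k_def by (simp add: of_nat_nat)
    have k2: "exp (real n * (MI \<mu> - \<epsilon>)) \<le> real (Suc k)"
      unfolding k_def by (simp add: of_nat_nat) linarith
    have "real n * (MI \<mu> - \<epsilon> / 2) \<le> a"
      unfolding a_def using \<nu>(5) by (intro mult_left_mono) auto
    then have "real n * (MI \<mu> - \<epsilon>) + - a \<le> real n * (MI \<mu> - \<epsilon>) + - (real n * (MI \<mu> - \<epsilon> / 2))" by simp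
    also have "\<dots> = real n * (- (\<epsilon> / 2))" by (simp add: algebra_simps)
    finally have "exp (real n * (MI \<mu> - \<epsilon>)) * exp (- a) \<le> exp (- (\<epsilon> / 2)) ^ n"
      unfolding exp_add[symmetric] exp_of_nat_mult[symmetric] by simp
    moreover have "real k * exp (- a) \<le> exp (real n * (MI \<mu> - \<epsilon>)) * exp (- a)"
      using k1 by (intro mult_right_mono) auto
    ultimately have small: "real k * exp (- a) + e / 2 < e" using elim(2) by linarith
    have good: "1 - e / 2 \<le> measure (joint n \<nu>) {p \<in> space (joint n \<nu>).
        fst p \<in> codewords \<gamma> q n \<and> a < info n \<nu> (fst p) (snd p)}"
      unfolding a_def by (rule elim(1))
    from feinstein[OF finite_powerD[OF \<nu>(1)] sets_codewords e(2) good small]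
    obtain enc D where code: "\<And>m. m < Suc k \<Longrightarrow> enc m \<in> codewords \<gamma> q n"
      "\<And>m. m < Suc k \<Longrightarrow> D m \<in> sets (PiM {..<n} (\<lambda>_. borel))"
      "\<And>m. m < Suc k \<Longrightarrow> 1 - e \<le> measure (noise n) {z \<in> space (noise n). shift n (enc m) z \<in> D m}"
      "disjoint_family_on D {..<Suc k}"
      by blast
    from code_of_decoding_sets[OF _ code] obtain dec where
      "valid_code \<gamma> q n (Suc k) enc dec" "\<And>m. m < Suc k \<Longrightarrow> err_prob n enc dec m \<le> e"
      by auto
    then show ?case using k2 e(3) by (meson order_trans)
  qed
  then show "\<exists>N. \<forall>n\<ge>N. \<exists>M enc dec. valid_code \<gamma> q n M enc dec \<and>
      exp (real n * (MI \<mu> - \<epsilon>)) \<le> real M \<and> (\<forall>m<M. err_prob n enc dec m \<le> \<epsilon>)"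
    unfolding eventually_sequentially .
qed

text \<open>The \<epsilon> inside \<open>achievable\<close> makes \<open>MI \<mu>\<close> itself
  achievable, so the supremum is a maximum.\<close>

lemma op_capacity_eq: "op_capacity \<gamma> q = MI \<mu>"
  unfolding op_capacity_def
  by (rule cSup_eq_maximum) (auto intro: MI_achievable achievable_le_MI)

end

theorem theorem1:
  fixes \<gamma> q :: real
  assumes "\<gamma> > 0" and "0 < q" and "q < 1"
  shows "\<exists>\<mu>0\<in>Lambda \<gamma> q.
           op_capacity \<gamma> q = MI \<mu>0 \<and>
           (\<forall>\<mu>\<in>Lambda \<gamma> q. MI \<mu> \<le> MI \<mu>0) \<and>
           (\<forall>\<mu>\<in>Lambda \<gamma> q. MI \<mu> = MI \<mu>0 \<longrightarrow> \<mu> = \<mu>0) \<and>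
           (\<forall>A\<in>sets borel. emeasure \<mu>0 (uminus ` A) = emeasure \<mu>0 A) \<and>
           (\<integral>\<^sup>+ x. ennreal (x\<^sup>2) \<partial>\<mu>0) = ennreal \<gamma> \<and>
           emeasure \<mu>0 {x. measure \<mu>0 {x} > 0} = 1 \<and>
           infinite {x. measure \<mu>0 {x} > 0} \<and>
           (\<forall>a b. finite {x \<in> {a..b}. measure \<mu>0 {x} > 0})"
proof -
  obtain \<mu> where \<mu>: "\<mu> \<in> Lambda \<gamma> q" "\<And>\<nu>. \<nu> \<in> Lambda \<gamma> q \<Longrightarrow> MI \<nu> \<le> MI \<mu>"
    using MI_maximizer_exists[of \<gamma> q] assms by auto
  interpret optimal_input \<gamma> q \<mu>
    by unfold_locales (use assms \<mu> in auto)
  have unique: "\<nu> = \<mu>" if "\<nu> \<in> Lambda \<gamma> q" "MI \<nu> = MI \<mu>" for \<nu>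
    by (rule MI_maximizer_unique[OF assms(2) less_imp_le[OF assms(1)] \<mu>(1) that \<mu>(2)])
  have power: "(\<integral>\<^sup>+ x. ennreal (x\<^sup>2) \<partial>\<mu>) = ennreal \<gamma>"
    using optimal_simps(1) second_moment_eq
    by (subst nn_integral_eq_integral) (auto simp: finite_power_def)
  show ?thesis
    using \<mu> unique power op_capacity_eq symmetric emeasure_mass_points mass_points_infinite
      mass_points_locally_finite
    by (intro bexI[of _ \<mu>]) blast+
qed

end
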